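(* Let $X$ be a smooth projective toric surface associated with a fan $\Sigma$, let $D$ be an ample (torus-invariant) divisor on $X$, let $v_N\in N$ be primitive, and let $Y_\bullet$ be the non-toric flag on $X$ determined by $v_N$. The valuation semigroup $S_{Y_\bullet}(D)$ is finitely generated if and only if $v_N$ is not strongly decomposable in $\sigma^+$ and $-v_N$ is not strongly decomposable in $\sigma^-$.
   Context: $\mathbb N=\{0,1,2,\dots\}$. $N\cong\mathbb Z^2$ is a lattice with dual lattice $M$, $N_{\mathbb R}=N\otimes\mathbb R$, $M_{\mathbb R}=M\otimes\mathbb R$; $\Sigma$ is a smooth complete fan in $N_{\mathbb R}$, $X=\mathbb{TV}(\Sigma)$ is the associated smooth projective toric surface over $\mathbb C$ with torus $\mathbb T=\operatorname{Spec}\mathbb C[M]$. Rays $\rho\in\Sigma(1)$ are identified with their primitive lattice generators; $D_\rho$ is the torus-invariant prime divisor of $\rho$. For $D=\sum a_\rho D_\rho$ ample, $\Delta(D)=\{m\in M_{\mathbb R}\mid\langle m,\rho\rangle\ge -a_\rho\ \forall\rho\in\Sigma(1)\}$. Flag: for primitive $v_N\in N$, the inclusion $\mathbb Zv_N\hookrightarrow N$ induces a toric map $\iota:\mathbb P^1\to X$ (the closure of the one-parameter subgroup of $v_N$). Put $Y_1=\iota(\mathbb P^1)$, $Y_2=\iota(1)$, and $Y_\bullet: X\supseteq Y_1\supseteq Y_2$. Valuation: for a nonzero section $s$ of a line bundle on $X$, $\operatorname{val}_{Y_\bullet}(s)=\big(\operatorname{ord}_{Y_1}(s),\operatorname{ord}_{Y_2}(\tilde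 s|_{Y_1})\big)$, where $\tilde s=s/f^{\operatorname{ord}_{Y_1}(s)}$ and $f$ is a local equation of $Y_1$ near $Y_2$. The valuation semigroup is $S_{Y_\bullet}(D)=\{(\ell,\operatorname{val}_{Y_\bullet}(s))\mid \ell\in\mathbb N,\ s\in\Gamma(X,\mathcal O_X(\ell D))\setminus\{0\}\}\subseteq\mathbb N^3$. Strong decomposability: for a cone $\sigma\subseteq N_{\mathbb R}$, a lattice point $u\in\operatorname{int}(\sigma)\cap N$ is strongly decomposable in $\sigma$ if $u=u'+u''$ for some $u',u''\in\operatorname{int}(\sigma)\cap N$. Cones $\sigma^\pm$: let $\Delta(D)\cap[v_N=c]$ be a line segment of maximal length among all line segments $\Delta(D)\cap[v_N=c']$, $c'\in\mathbb R$ (where $[v_N=c]=\{m\in M_{\mathbb R}\mid\langle m,v_N\rangle=c\}$, and similarly for inequalities), with endpoints $v_1,v_2$. Let $e_i^+$ ($i=1,2$) be the part, lying in $[v_N\ge c]$, of the edge of $\Delta(D)$ that starts at $v_i$ and goes into this half-plane, and $e_i^-$ the analogous part of an edge lying in $[v_N\le c]$. (If $v_i$ is in the interior of an edge, $e_i^+$ and $e_i^-$ are the two parts of this edge; if $v_i$ is a vertex they lie on the two edges at $v_i$. If the segment is itself an edge of $\Delta(D)$ at which $v_N$ is minimal, resp. maximal, on $\Delta(D)$, then $e_1^-=e_2^-$, resp. $e_1^+=e_2^+$, is that edge.) Then $\sigma^-\subseteq N_{\mathbb R}$ is the cone generated by the inner normal vectors of (the edges of $\Delta(D)$ containing) $e_1^+$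 and $e_2^+$, and $\sigma^+$ is the cone generated by the inner normal vectors of $e_1^-$ and $e_2^-$. If the two inner normals are opposite to each other, $\sigma^+$ (resp. $\sigma^-$) means the closed half-plane bounded by the line they span and containing $v_N$ (resp. $-v_N$). *)

theory Defs
  imports "HOL-Analysis.Analysis" "HOL-Library.Poly_Mapping"
begin

section \<open>Lattices\<close>

text \<open>A basis of \<open>N\<close> and the dual basis of \<open>M\<close> are fixed, so \<open>N\<close> and \<open>M\<close> are both
  \<open>int \<times> int\<close>, their real extensions are \<open>real \<times> real\<close>, and the pairing is the standard one
  (the inner product on \<open>real \<times> real\<close>).\<close>

definition pairing :: "int \<times> int \<Rightarrow> int \<times> int \<Rightarrow> int" where
  "pairing m u = fst m * fst u + snd m * snd u"

definition of_lattice :: "int \<times> int \<Rightarrow> real \<times> real" where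
  "of_lattice u = (real_of_int (fst u), real_of_int (snd u))"

definition primitive :: "int \<times> int \<Rightarrow> bool" where
  "primitive u \<longleftrightarrow> coprime (fst u) (snd u)"

text \<open>Two elements generating a free abelian group of rank two form a basis of it.\<close>

definition lattice_basis :: "int \<times> int \<Rightarrow> int \<times> int \<Rightarrow> bool" where
  "lattice_basis u w \<longleftrightarrow>
     (\<forall>n. \<exists>i j. n = (i * fst u + j * fst w, i * snd u + j * snd w))"


section \<open>Smooth complete fans\<close>

definition cone_over :: "(int \<times> int) set \<Rightarrow> (real \<times> real) set" where
  "cone_over B = convex_cone hull (of_lattice ` B)"

definition rational_cone :: "(real \<times> real) set \<Rightarrow> bool" where
  "rational_cone \<sigma> \<longleftrightarrow> (\<exists>B. finite B \<and> \<sigma> = cone_over B)"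

definition strongly_convex :: "(real \<times> real) set \<Rightarrow> bool" where
  "strongly_convex \<sigma> \<longleftrightarrow> \<sigma> \<inter> uminus ` \<sigma> = {0}"

definition fan :: "(real \<times> real) set set \<Rightarrow> bool" where
  "fan \<Sigma> \<longleftrightarrow> finite \<Sigma> \<and>
     (\<forall>\<sigma>\<in>\<Sigma>. rational_cone \<sigma> \<and> strongly_convex \<sigma>) \<and>
     (\<forall>\<sigma>\<in>\<Sigma>. \<forall>\<tau>. \<tau> face_of \<sigma> \<and> \<tau> \<noteq> {} \<longrightarrow> \<tau> \<in> \<Sigma>) \<and>
     (\<forall>\<sigma>\<in>\<Sigma>. \<forall>\<tau>\<in>\<Sigma>. (\<sigma> \<inter> \<tau>) face_of \<sigma> \<and> (\<sigma> \<inter> \<tau>) face_of \<tau>)"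

definition complete_fan :: "(real \<times> real) set set \<Rightarrow> bool" where
  "complete_fan \<Sigma> \<longleftrightarrow> fan \<Sigma> \<and> \<Union>\<Sigma> = UNIV"

definition smooth_cone :: "(real \<times> real) set \<Rightarrow> bool" where
  "smooth_cone \<sigma> \<longleftrightarrow> (\<exists>u w B. lattice_basis u w \<and> B \<subseteq> {u, w} \<and> \<sigma> = cone_over B)"

definition smooth_complete_fan :: "(real \<times> real) set set \<Rightarrow> bool" where
  "smooth_complete_fan \<Sigma> \<longleftrightarrow> complete_fan \<Sigma> \<and> (\<forall>\<sigma>\<in>\<Sigma>. smooth_cone \<sigma>)"

text \<open>Rays are represented by their primitive generators.\<close>

definition rays :: "(real \<times> real) set set \<Rightarrow> (int \<times> int) set" where
  "rays \<Sigma> = {u. primitive u \<and> cone_over {u} \<in> \<Sigma>}"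


section \<open>The toric surface and its line bundles\<close>

text \<open>The surface \<open>X = TV(\<Sigma>)\<close> is glued from the affine charts \<open>U \<sigma> = Spec \<complex>[dual_monoid \<sigma>]\<close>,
  \<open>\<sigma> \<in> \<Sigma>\<close>, where \<open>U \<sigma>\<close> and \<open>U \<tau>\<close> meet in \<open>U (\<sigma> \<inter> \<tau>)\<close>. All coordinate rings are subrings of the
  coordinate ring \<open>\<complex>[M]\<close> of the torus, the chart of the cone \<open>{0}\<close>.\<close>

type_synonym laurent = "(int \<times> int) \<Rightarrow>\<^sub>0 complex"

definition chi :: "int \<times> int \<Rightarrow> laurent" where
  "chi m = Poly_Mapping.single m 1"

definition dual_monoid :: "(real \<times> real) set \<Rightarrow> (int \<times> int) set" where
  "dual_monoid \<sigma> = {m. \<forall>u\<in>\<sigma>. of_lattice m \<bullet> u \<ge> 0}"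

definition coord_ring :: "(real \<times> real) set \<Rightarrow> laurent set" where
  "coord_ring \<sigma> = {f. Poly_Mapping.keys f \<subseteq> dual_monoid \<sigma>}"

text \<open>The closed points of \<open>U \<sigma>\<close> are the monoid homomorphisms from \<open>dual_monoid \<sigma>\<close> to the
  multiplicative monoid \<open>\<complex>\<close>; values outside \<open>dual_monoid \<sigma>\<close> are irrelevant.\<close>

definition chart_points :: "(real \<times> real) set \<Rightarrow> (int \<times> int \<Rightarrow> complex) set" where
  "chart_points \<sigma> = {x. x 0 = 1 \<and>
     (\<forall>m\<in>dual_monoid \<sigma>. \<forall>m'\<in>dual_monoid \<sigma>. x (m + m') = x m * x m')}"

definition value_at :: "laurent \<Rightarrow> (int \<times> int \<Rightarrow> complex) \<Rightarrow> complex" where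
  "value_at f x = (\<Sum>m\<in>Poly_Mapping.keys f. Poly_Mapping.lookup f m * x m)"

text \<open>A torus-invariant divisor \<open>D = (\<Sum>\<rho>. a \<rho> D\<^sub>\<rho>)\<close> is given by its coefficients \<open>a\<close>, of which
  only the values on \<open>rays \<Sigma>\<close> matter. As \<open>chi m\<close> vanishes along \<open>D\<^sub>\<rho>\<close> to the order
  \<open>pairing m \<rho>\<close>, the following says that \<open>chi m\<close> is a local equation of \<open>D\<close> on \<open>U \<sigma>\<close>.\<close>

definition chart_exponent ::
    "(real \<times> real) set set \<Rightarrow> (int \<times> int \<Rightarrow> int) \<Rightarrow> (real \<times> real) set \<Rightarrow> int \<times> int \<Rightarrow> bool" where
  "chart_exponent \<Sigma> a \<sigma> m \<longleftrightarrow> (\<forall>\<rho>\<in>rays \<Sigma>. of_lattice \<rho> \<in> \<sigma> \<longrightarrow> pairing m \<rho> = a \<rho>)"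

text \<open>\<open>O(D)\<close> is the subsheaf of the constant sheaf \<open>\<complex>(X)\<close> that is generated on each \<open>U \<sigma>\<close> by the
  inverse of a local equation of \<open>D\<close>, so that \<open>chi m * s\<close> below is the section \<open>s\<close> written in the
  local trivialisation. Global sections are regular on the torus, hence lie in \<open>\<complex>[M]\<close>; over the
  torus \<open>O(D)\<close> is the structure sheaf.\<close>

definition sections :: "(real \<times> real) set set \<Rightarrow> (int \<times> int \<Rightarrow> int) \<Rightarrow> laurent set" where
  "sections \<Sigma> a = {s. \<forall>\<sigma>\<in>\<Sigma>. \<exists>m. chart_exponent \<Sigma> a \<sigma> m \<and> chi m * s \<in> coord_ring \<sigma>}"

definition nonvanishing ::
    "(real \<times> real) set set \<Rightarrow> (int \<times> int \<Rightarrow> int) \<Rightarrow> laurent \<Rightarrow> (real \<times> real) set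
      \<Rightarrow> (int \<times> int \<Rightarrow> complex) \<Rightarrow> bool" where
  "nonvanishing \<Sigma> a s \<sigma> x \<longleftrightarrow>
     (\<exists>m. chart_exponent \<Sigma> a \<sigma> m \<and> value_at (chi m * s) x \<noteq> 0)"

definition multiple :: "nat \<Rightarrow> (int \<times> int \<Rightarrow> int) \<Rightarrow> int \<times> int \<Rightarrow> int" where
  "multiple n a = (\<lambda>\<rho>. int n * a \<rho>)"

text \<open>Ampleness as in EGA II, 4.5.3: the nonvanishing loci \<open>X_s\<close> of the sections \<open>s\<close> of the
  positive multiples of \<open>D\<close> form a base of the Zariski topology. It suffices to test this on
  closed points \<open>x\<close> and on the principal open subsets \<open>D(f)\<close> of the charts. The final clause says
  \<open>X_s \<subseteq> D(f)\<close>: each point \<open>y\<close> of \<open>X_s\<close>, in whatever chart \<open>U \<tau>\<close>, comes from a point \<open>z\<close> of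
  \<open>U (\<sigma> \<inter> \<tau>)\<close> at which \<open>f\<close> does not vanish.\<close>

definition ample :: "(real \<times> real) set set \<Rightarrow> (int \<times> int \<Rightarrow> int) \<Rightarrow> bool" where
  "ample \<Sigma> a \<longleftrightarrow>
     (\<forall>\<sigma>\<in>\<Sigma>. \<forall>x\<in>chart_points \<sigma>. \<forall>f\<in>coord_ring \<sigma>. value_at f x \<noteq> 0 \<longrightarrow>
        (\<exists>n\<ge>1. \<exists>s\<in>sections \<Sigma> (multiple n a).
           nonvanishing \<Sigma> (multiple n a) s \<sigma> x \<and>
           (\<forall>\<tau>\<in>\<Sigma>. \<forall>y\<in>chart_points \<tau>. nonvanishing \<Sigma> (multiple n a) s \<tau> y \<longrightarrow>
              (\<exists>z\<in>chart_points (\<sigma> \<inter> \<tau>). (\<forall>m\<in>dual_monoid \<tau>. z m = y m) \<and> value_at f z \<noteq> 0))))"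

definition polytope_of :: "(real \<times> real) set set \<Rightarrow> (int \<times> int \<Rightarrow> int) \<Rightarrow> (real \<times> real) set" where
  "polytope_of \<Sigma> a = {m. \<forall>\<rho>\<in>rays \<Sigma>. m \<bullet> of_lattice \<rho> \<ge> - real_of_int (a \<rho>)}"


section \<open>The flag, its valuation and the valuation semigroup\<close>

text \<open>Pullback of Laurent polynomials along the one-parameter subgroup of \<open>v\<close>, with values in
  \<open>\<complex>[t, 1/t]\<close>. For primitive \<open>v\<close> this is also the restriction to \<open>Y\<^sub>1\<close> (intersected with the
  torus), with \<open>Y\<^sub>2\<close> the point \<open>t = 1\<close>. In the torus \<open>Y\<^sub>2\<close> is the unit \<open>\<lambda>_. 1\<close>.\<close>

definition restrict_Y1 :: "int \<times> int \<Rightarrow> laurent \<Rightarrow> (int \<Rightarrow>\<^sub>0 complex)" where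
  "restrict_Y1 v f =
     (\<Sum>m\<in>Poly_Mapping.keys f. Poly_Mapping.single (pairing m v) (Poly_Mapping.lookup f m))"

definition ideal_Y1 :: "int \<times> int \<Rightarrow> laurent set" where
  "ideal_Y1 v = {f. restrict_Y1 v f = 0}"

definition value_Y2 :: "laurent \<Rightarrow> complex" where
  "value_Y2 f = value_at f (\<lambda>_. 1)"

text \<open>\<open>f\<close> generates the ideal of \<open>Y\<^sub>1\<close> in the local ring of \<open>X\<close> at \<open>Y\<^sub>2\<close>. This ring is the
  localisation of \<open>\<complex>[M]\<close> at \<open>Y\<^sub>2\<close>, and statements in it are written with cleared denominators \<open>h\<close>.\<close>

definition local_equation_Y1 :: "int \<times> int \<Rightarrow> laurent \<Rightarrow> bool" where
  "local_equation_Y1 v f \<longleftrightarrow>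
     f \<in> ideal_Y1 v \<and> (\<forall>p\<in>ideal_Y1 v. \<exists>h. value_Y2 h \<noteq> 0 \<and> f dvd h * p)"

text \<open>Order of vanishing in the discrete valuation ring of \<open>X\<close> at the generic point of \<open>Y\<^sub>1\<close>,
  where denominators \<open>h\<close> outside the ideal of \<open>Y\<^sub>1\<close> are allowed.\<close>

definition ord_Y1 :: "int \<times> int \<Rightarrow> laurent \<Rightarrow> nat" where
  "ord_Y1 v s = (GREATEST k. \<exists>f h. local_equation_Y1 v f \<and> h \<notin> ideal_Y1 v \<and> f ^ k dvd h * s)"

definition ord_Y2 :: "(int \<Rightarrow>\<^sub>0 complex) \<Rightarrow> nat" where
  "ord_Y2 g = (GREATEST k. (Poly_Mapping.single 1 1 - 1) ^ k dvd g)"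

text \<open>Below \<open>g / h\<close> is the section \<open>s / f ^ ord_Y1 v s\<close> near \<open>Y\<^sub>2\<close>; the denominator \<open>h\<close> is a unit
  there and does not affect the order. Sections of \<open>O(D)\<close> near \<open>Y\<^sub>2\<close> are plain functions.\<close>

definition flag_val :: "int \<times> int \<Rightarrow> laurent \<Rightarrow> nat \<times> nat" where
  "flag_val v s =
     (ord_Y1 v s,
      THE b. \<exists>f g h. local_equation_Y1 v f \<and> value_Y2 h \<noteq> 0 \<and>
        h * s = f ^ ord_Y1 v s * g \<and> b = ord_Y2 (restrict_Y1 v g))"

definition valuation_semigroup ::
    "(real \<times> real) set set \<Rightarrow> (int \<times> int \<Rightarrow> int) \<Rightarrow> int \<times> int \<Rightarrow> (nat \<times> nat \<times> nat) set" where
  "valuation_semigroup \<Sigma> a v =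
     {(l, flag_val v s) | l s. s \<in> sections \<Sigma> (multiple l a) \<and> s \<noteq> 0}"

definition submonoid :: "'a::monoid_add set \<Rightarrow> bool" where
  "submonoid S \<longleftrightarrow> 0 \<in> S \<and> (\<forall>x\<in>S. \<forall>y\<in>S. x + y \<in> S)"

definition finitely_generated :: "'a::monoid_add set \<Rightarrow> bool" where
  "finitely_generated S \<longleftrightarrow> (\<exists>G. finite G \<and> S = submonoid hull G)"


section \<open>Strong decomposability and the cones of the flag\<close>

definition strongly_decomposable :: "int \<times> int \<Rightarrow> (real \<times> real) set \<Rightarrow> bool" where
  "strongly_decomposable u \<sigma> \<longleftrightarrow> of_lattice u \<in> interior \<sigma> \<and>
     (\<exists>u' u''. of_lattice u' \<in> interior \<sigma> \<and> of_lattice u'' \<in> interior \<sigma> \<and> u = u' + u'')"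

definition level_set :: "(real \<times> real) set \<Rightarrow> int \<times> int \<Rightarrow> real \<Rightarrow> (real \<times> real) set" where
  "level_set \<Delta> w c = {m \<in> \<Delta>. m \<bullet> of_lattice w = c}"

definition longest_segment ::
    "(real \<times> real) set \<Rightarrow> int \<times> int \<Rightarrow> real \<Rightarrow> real \<times> real \<Rightarrow> real \<times> real \<Rightarrow> bool" where
  "longest_segment \<Delta> w c p q \<longleftrightarrow> level_set \<Delta> w c = closed_segment p q \<and>
     (\<forall>c' p' q'. level_set \<Delta> w c' = closed_segment p' q' \<longrightarrow> dist p' q' \<le> dist p q)"

text \<open>\<open>E\<close> is the edge of \<open>\<Delta>\<close> that starts at \<open>p\<close> and goes into the half-plane \<open>[w \<ge> c]\<close>. If \<open>\<Delta>\<close>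
  lies in \<open>[w \<le> c]\<close>, it is the edge on which \<open>w\<close> is maximal. Otherwise \<open>E\<close> has to enter the open
  half-plane, which matters if the segment is the edge on which \<open>w\<close> is minimal: then \<open>E\<close> is the
  other edge at \<open>p\<close>.\<close>

definition edge_into ::
    "(real \<times> real) set \<Rightarrow> int \<times> int \<Rightarrow> real \<Rightarrow> real \<times> real \<Rightarrow> (real \<times> real) set \<Rightarrow> bool" where
  "edge_into \<Delta> w c p E \<longleftrightarrow> E edge_of \<Delta> \<and> p \<in> E \<and>
     (if \<forall>m\<in>\<Delta>. m \<bullet> of_lattice w \<le> c then E = level_set \<Delta> w c
      else \<exists>m\<in>E. m \<bullet> of_lattice w > c)"

definition inner_normal :: "(real \<times> real) set \<Rightarrow> (real \<times> real) set \<Rightarrow> real \<times> real \<Rightarrow> bool" where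
  "inner_normal \<Delta> E n \<longleftrightarrow> n \<noteq> 0 \<and> (\<forall>e\<in>E. \<forall>m\<in>\<Delta>. e \<bullet> n \<le> m \<bullet> n)"

definition cone_of_normals ::
    "int \<times> int \<Rightarrow> real \<times> real \<Rightarrow> real \<times> real \<Rightarrow> (real \<times> real) set" where
  "cone_of_normals w n n' =
     (if \<exists>k>0. n' = - k *\<^sub>R n then {x *\<^sub>R n + y *\<^sub>R of_lattice w | x y. y \<ge> 0}
      else convex_cone hull {n, n'})"

text \<open>The cone generated by the inner normals of the two edges that start at the endpoints \<open>p\<close>,
  \<open>q\<close> of the segment \<open>[w = c]\<close> and go into \<open>[w \<le> c]\<close>, i.e. into \<open>[-w \<ge> -c]\<close>; it is taken on the
  side of \<open>w\<close> if they are opposite. Thus \<open>flag_cone \<Delta> v c p q\<close> describes \<open>\<sigma>\<^sup>+\<close> and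
  \<open>flag_cone \<Delta> (- v) (- c) p q\<close> describes \<open>\<sigma>\<^sup>-\<close>. It is a relation because the inner
  normals are only determined up to positive factors.\<close>

definition flag_cone ::
    "(real \<times> real) set \<Rightarrow> int \<times> int \<Rightarrow> real \<Rightarrow> real \<times> real \<Rightarrow> real \<times> real
      \<Rightarrow> (real \<times> real) set \<Rightarrow> bool" where
  "flag_cone \<Delta> w c p q \<sigma> \<longleftrightarrow>
     (\<exists>E E' n n'. edge_into \<Delta> (- w) (- c) p E \<and> edge_into \<Delta> (- w) (- c) q E' \<and>
        inner_normal \<Delta> E n \<and> inner_normal \<Delta> E' n' \<and> \<sigma> = cone_of_normals w n n')"

end

theory Submission
  imports Defs
begin

text \<open>In coordinates on the character lattice in which \<open>v\<close> is the second coordinate, \<open>Y\<^sub>1\<close> is \<open>x = 1\<close>, and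
  a section is a family of Laurent polynomials in \<open>x\<close>, one for each row of the polygon. A nonzero
  combination of \<open>r\<close> monomials vanishes at \<open>1\<close> to an order less than \<open>r\<close>, and every such order occurs.
  Hence \<open>(l, k, b)\<close> lies in the valuation semigroup iff more than \<open>b\<close> rows of \<open>l \<Delta>\<close> contain at least
  \<open>k + 1\<close> lattice points.

  Let \<open>A\<close> and \<open>B\<close> be the slopes of the edges below the longest row, so that rows grow by \<open>A + B\<close> per step
  towards it. That \<open>v\<close> is not strongly decomposable means \<open>\<lfloor>A n\<rfloor> + \<lfloor>B n\<rfloor> \<ge> 0\<close> for all \<open>n \<ge> 1\<close>. Then a row
  of \<open>k + 1\<close> lattice points forces as many in all rows between it and the longest one. If this
  holds on both sides, the rows in question form an interval, and the semigroup is the projection of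
  the lattice points of a rational cone. Otherwise, points of the upper boundary of the
  Newton-Okounkov body near the longest row are not attained by the semigroup, which
  contradicts finite generation.\<close>

section \<open>Laurent polynomials\<close>

text \<open>Why floors appear on both sides: write points of N by their pairings with
  \<open>d\<close> and \<open>e\<close>, so that \<open>v\<close> is (0, 1). If the polygon extends
  below its longest row, the interior of \<open>\<sigma>plus\<close> consists of the (n, j) with j >
  A n and j > - B n. A splitting of \<open>v\<close> has summands (n, j) and (-n, 1 - j); up to
  order n >= 1, and an integer j with A n < j < 1 - B n exists iff the floors of A n and B n have
  negative sum. In the polygon, moving n rows towards the longest row gains at least A n at the left
  end and B n at the right end. A run of lattice points survives if it can be shifted left by an
  integer t with - B n <= t <= A n, and such a t exists iff the same sum is nonnegative. This shift
  is the only possibility when both ends of the run lie on the flanking lines. The obstacle in the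
  negative direction is to produce such a tight run. The semigroup only approximates the boundary
  points of the body, but finite generation makes its slices span a closed polygon, so a generator
  must attain the boundary. Attaining it leaves no slack: the lowest row has integral index, and its
  run touches both flanks.\<close>

lemma pm_induct [case_names zero single add]:
  assumes "P 0" "\<And>a c. P (Poly_Mapping.single a c)" "\<And>f g. P f \<Longrightarrow> P g \<Longrightarrow> P (f + g)"
  shows "P (f :: 'a \<Rightarrow>\<^sub>0 'b::comm_monoid_add)"
proof (induction f rule: Poly_Mapping.update_induct)
  case const
  then show ?case by (rule assms(1))
next
  case (update f a b)
  have "Poly_Mapping.update a b f = f + Poly_Mapping.single a b"
    using update(1) by (intro poly_mapping_eqI)
      (auto simp: lookup_add lookup_single Poly_Mapping.lookup_update when_def in_keys_iff)
  then show ?case using assms update by metis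
qed

lemma lookup_single_times:
  fixes f :: "'a::ab_group_add \<Rightarrow>\<^sub>0 complex"
  shows "Poly_Mapping.lookup (Poly_Mapping.single a c * f) m = c * Poly_Mapping.lookup f (m - a)"
proof (induction f rule: pm_induct)
  case (single b c')
  have "a + b = m \<longleftrightarrow> b = m - a" by (auto simp: algebra_simps)
  then show ?case by (simp add: mult_single lookup_single when_def)
qed (auto simp: lookup_add algebra_simps)

lemma keys_single_times:
  fixes f :: "'a::ab_group_add \<Rightarrow>\<^sub>0 complex"
  shows "Poly_Mapping.keys (Poly_Mapping.single a 1 * f) = (\<lambda>m. a + m) ` Poly_Mapping.keys f"
proof -
  have "m \<in> (\<lambda>m. a + m) ` Poly_Mapping.keys f \<longleftrightarrow> m - a \<in> Poly_Mapping.keys f" for m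
    by (auto simp: image_iff) (metis add.commute diff_add_cancel)
  then show ?thesis by (auto simp: in_keys_iff lookup_single_times)
qed

section \<open>Pushing exponents forward, and evaluation at 1\<close>

text \<open>For additive \<open>\<phi>\<close> this is the induced homomorphism of monoid algebras.
  Restriction to the curve, evaluation at 1 and the inclusion of a single row into the Laurent
  polynomials on M are all instances.\<close>

definition push :: "('a \<Rightarrow> 'b) \<Rightarrow> ('a \<Rightarrow>\<^sub>0 complex) \<Rightarrow> ('b \<Rightarrow>\<^sub>0 complex)" where
  "push \<phi> f = (\<Sum>m\<in>Poly_Mapping.keys f. Poly_Mapping.single (\<phi> m) (Poly_Mapping.lookup f m))"

lemma push_superset:
  assumes "finite A" "Poly_Mapping.keys f \<subseteq> A"
  shows "push \<phi> f = (\<Sum>m\<in>A. Poly_Mapping.single (\<phi> m) (Poly_Mapping.lookup f m))"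
  unfolding push_def using assms by (intro sum.mono_neutral_left) (auto simp: in_keys_iff)

lemma push_zero [simp]: "push \<phi> 0 = 0"
  by (simp add: push_def)

lemma push_single [simp]: "push \<phi> (Poly_Mapping.single a c) = Poly_Mapping.single (\<phi> a) c"
  by (subst push_superset[of "{a}"]) auto

lemma push_add: "push \<phi> (f + g) = push \<phi> f + push \<phi> g"
proof -
  let ?A = "Poly_Mapping.keys f \<union> Poly_Mapping.keys g"
  have "Poly_Mapping.keys (f + g) \<subseteq> ?A" by (rule Poly_Mapping.keys_add)
  then show ?thesis
    by (simp add: push_superset[of ?A] lookup_add single_add sum.distrib)
qed

lemma push_uminus: "push \<phi> (- f) = - push \<phi> f"
  using push_add[of \<phi> f "- f"] by (simp add: eq_neg_iff_add_eq_0 add.commute)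

lemma push_diff: "push \<phi> (f - g) = push \<phi> f - push \<phi> g"
  using push_add[of \<phi> f "- g"] by (simp add: push_uminus)

lemma push_mult:
  fixes \<phi> :: "'a::comm_monoid_add \<Rightarrow> 'b::comm_monoid_add"
  assumes "\<And>x y. \<phi> (x + y) = \<phi> x + \<phi> y"
  shows "push \<phi> (f * g) = push \<phi> f * push \<phi> g"
proof (induction f rule: pm_induct)
  case (single a c)
  show ?case
  proof (induction g rule: pm_induct)
    case (single b c')
    then show ?case by (simp add: mult_single assms)
  qed (auto simp: push_add distrib_left)
qed (auto simp: push_add distrib_right)

lemma push_power:
  fixes \<phi> :: "'a::comm_monoid_add \<Rightarrow> 'b::comm_monoid_add"
  assumes "\<And>x y. \<phi> (x + y) = \<phi> x + \<phi> y" "\<phi> 0 = 0"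
  shows "push \<phi> (f ^ n) = push \<phi> f ^ n"
  by (induction n) (auto simp: push_mult[OF assms(1)] assms(2) simp flip: single_one)

lemma push_push: "push \<phi> (push \<psi> f) = push (\<phi> \<circ> \<psi>) f"
  by (induction f rule: pm_induct) (auto simp: push_add)

lemma push_id: "push (\<lambda>x. x) f = f"
  by (induction f rule: pm_induct) (auto simp: push_add)

text \<open>The value at the unit of the torus. Encoding it as a push to the single exponent 0 lets
  multiplicativity and compatibility with other pushes follow from the general lemmas.\<close>

definition coeff_sum :: "('a \<Rightarrow>\<^sub>0 complex) \<Rightarrow> complex" where
  "coeff_sum f = Poly_Mapping.lookup (push (\<lambda>_. 0::int) f) 0"

lemma push_const: "push (\<lambda>_. 0::int) f = Poly_Mapping.single 0 (coeff_sum f)"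
  unfolding coeff_sum_def by (induction f rule: pm_induct) (auto simp: push_add lookup_add single_add)

lemma coeff_sum_add: "coeff_sum (f + g) = coeff_sum f + coeff_sum g"
  by (simp add: coeff_sum_def push_add lookup_add)

lemma coeff_sum_diff: "coeff_sum (f - g) = coeff_sum f - coeff_sum g"
  by (simp add: coeff_sum_def push_diff lookup_minus)

lemma coeff_sum_single [simp]: "coeff_sum (Poly_Mapping.single a c) = c"
  by (simp add: coeff_sum_def)

lemma coeff_sum_mult:
  fixes f :: "'a::comm_monoid_add \<Rightarrow>\<^sub>0 complex"
  shows "coeff_sum (f * g) = coeff_sum f * coeff_sum g"
proof -
  have "push (\<lambda>_. 0::int) (f * g) = push (\<lambda>_. 0) f * push (\<lambda>_. 0) g"
    by (rule push_mult) auto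
  then have "Poly_Mapping.single (0::int) (coeff_sum (f * g)) = Poly_Mapping.single 0 (coeff_sum f * coeff_sum g)"
    by (simp add: push_const mult_single)
  from arg_cong[OF this, of coeff_sum] show ?thesis by simp
qed

lemma coeff_sum_one [simp]: "coeff_sum (1 :: 'a::zero \<Rightarrow>\<^sub>0 complex) = 1"
  unfolding single_one[symmetric] by (rule coeff_sum_single)

lemma coeff_sum_push: "coeff_sum (push \<phi> f) = coeff_sum f"
  by (simp add: coeff_sum_def push_push o_def)

lemma coeff_sum_conv: "coeff_sum f = (\<Sum>m\<in>Poly_Mapping.keys f. Poly_Mapping.lookup f m)"
  by (simp add: coeff_sum_def push_def lookup_sum)

section \<open>Order of vanishing at 1 in one variable\<close>

abbreviation T :: "int \<Rightarrow>\<^sub>0 complex" where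
  "T \<equiv> Poly_Mapping.single 1 1 - 1"

lemma T_nonzero: "T \<noteq> 0"
proof
  assume "T = 0"
  then have "Poly_Mapping.lookup T 0 = 0" by simp
  then show False by (simp add: lookup_minus lookup_single)
qed

lemma single_one_power: "Poly_Mapping.single (1::int) (1::complex) ^ n = Poly_Mapping.single (int n) 1"
  by (induction n) (auto simp: mult_single)

lemma T_dvd_monomial_diff: "T dvd Poly_Mapping.single i 1 - 1"
proof -
  have nat_case: "T dvd Poly_Mapping.single (int n) 1 - 1" for n
    by (simp flip: single_one_power add: power_diff_1_eq)
  show ?thesis
  proof (cases "i \<ge> 0")
    case True
    then show ?thesis using nat_case[of "nat i"] by simp
  next
    case False
    have inv: "Poly_Mapping.single i (1::complex) * Poly_Mapping.single (int (nat (-i))) 1 = 1"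
      using False by (simp add: mult_single)
    have "Poly_Mapping.single i (1::complex) - 1
        = - (Poly_Mapping.single i 1 * (Poly_Mapping.single (int (nat (-i))) 1 - 1)) "
      by (simp only: right_diff_distrib inv mult_1_right minus_diff_eq)
    then show ?thesis using nat_case by (metis dvd_minus_iff dvd_mult)
  qed
qed

text \<open>The factor theorem at 1: modulo \<open>T\<close> every monomial is 1, so
  \<open>p\<close> is congruent to the constant \<open>coeff_sum p\<close>.\<close>

lemma T_dvd_iff: "T dvd p \<longleftrightarrow> coeff_sum p = 0"
proof
  assume "T dvd p"
  then show "coeff_sum p = 0"
    by (auto simp: coeff_sum_mult coeff_sum_diff elim!: dvdE)
next
  assume *: "coeff_sum p = 0"
  have "T dvd p - Poly_Mapping.single 0 (coeff_sum p)"
  proof (induction p rule: pm_induct)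
    case (single a c)
    have "Poly_Mapping.single a c - Poly_Mapping.single 0 c
        = Poly_Mapping.single 0 c * (Poly_Mapping.single a 1 - 1)"
      by (simp add: right_diff_distrib mult_single)
    then show ?case by (simp add: T_dvd_monomial_diff)
  next
    case (add f g)
    then show ?case
      using dvd_add[OF add] by (simp add: coeff_sum_add single_add algebra_simps)
  next
    case zero
    then show ?case by (simp add: coeff_sum_def)
  qed
  then show "T dvd p" using * by simp
qed

lemma lookup_T_times:
  "Poly_Mapping.lookup (T * q) j = Poly_Mapping.lookup q (j - 1) - Poly_Mapping.lookup q j"
  by (simp add: left_diff_distrib lookup_minus lookup_single_times)

lemma T_power_dvd_card:
  assumes "T ^ b dvd p" "p \<noteq> 0"
  shows "b < card (Poly_Mapping.keys p)"
  using assms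
proof (induction b arbitrary: p)
  case 0
  then show ?case by (simp add: card_gt_0_iff)
next
  case (Suc b)
  obtain a where a: "a \<in> Poly_Mapping.keys p"
    using Suc.prems(2) by (metis all_not_in_conv keys_eq_empty)
  text \<open>The Euler operator \<open>t\<^sup>j \<mapsto> (j - a) t\<^sup>j\<close> kills one term and costs one factor \<open>T\<close>.\<close>
  define \<theta> where "\<theta> = Poly_Mapping.mapp (\<lambda>j (c::complex). of_int (j - a) * c)"
  have lookup_\<theta>: "Poly_Mapping.lookup (\<theta> q) j = of_int (j - a) * Poly_Mapping.lookup q j" for q j
    by (auto simp: \<theta>_def lookup_mapp when_def in_keys_iff)
  have \<theta>_T: "\<theta> (T * q) = T * \<theta> q + Poly_Mapping.single 1 1 * q" for q
    by (intro poly_mapping_eqI, unfold lookup_\<theta> lookup_add lookup_T_times lookup_single_times)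
      (simp add: algebra_simps)
  have \<theta>_dvd: "T ^ n dvd \<theta> (T ^ Suc n * q)" for n q
  proof (induction n)
    case (Suc n)
    have "\<theta> (T ^ Suc (Suc n) * q) = T * \<theta> (T ^ Suc n * q) + Poly_Mapping.single 1 1 * (T ^ Suc n * q)"
      using \<theta>_T[of "T ^ Suc n * q"] by (simp add: mult.assoc)
    moreover have "T ^ Suc n dvd T * \<theta> (T ^ Suc n * q)"
      using mult_dvd_mono[OF dvd_refl[of T] Suc] by simp
    moreover have "T ^ Suc n dvd Poly_Mapping.single 1 1 * (T ^ Suc n * q)"
      by (intro dvd_mult dvd_triv_left)
    ultimately show ?case by simp
  qed simp
  have dvd: "T ^ b dvd \<theta> p"
    using Suc.prems(1) \<theta>_dvd by (auto elim!: dvdE)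
  have keys: "Poly_Mapping.keys (\<theta> p) = Poly_Mapping.keys p - {a}"
    by (auto simp: in_keys_iff lookup_\<theta>)
  \<comment> \<open>Otherwise \<open>p\<close> would be a single monomial, whose value at 1 is its
    coefficient, against divisibility by \<open>T\<close>.\<close>
  have "\<theta> p \<noteq> 0"
  proof
    assume "\<theta> p = 0"
    then have "Poly_Mapping.keys p = {a}" using keys a by auto
    then have "p = Poly_Mapping.single a (Poly_Mapping.lookup p a)"
      by (intro poly_mapping_eqI) (metis lookup_single_eq lookup_single_not_eq not_in_keys_iff_lookup_eq_zero singletonD)
    moreover have "coeff_sum p = 0"
      using Suc.prems(1) T_dvd_iff by (metis dvd_mult_left power_Suc)
    ultimately have "Poly_Mapping.lookup p a = 0" by (metis coeff_sum_single)
    then show False using a by (simp add: in_keys_iff)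
  qed
  then have "b < card (Poly_Mapping.keys p - {a})" using Suc.IH[OF dvd] keys by simp
  then show ?case using a by simp
qed

text \<open>On exactly b + 1 exponents, \<open>T_power_dvd_card\<close> excludes a further factor
  \<open>T\<close>, so only a nonzero multiple of \<open>T ^ b\<close> has to be found. Inductively,
  take two polynomials whose supports avoid different points \<open>i\<close> and \<open>j\<close>,
  and combine them so that the values at 1 of their cofactors cancel.\<close>

lemma T_power_exact:
  assumes "finite J" "b < card J"
  obtains p where "Poly_Mapping.keys p \<subseteq> J" "T ^ b dvd p" "\<not> T ^ Suc b dvd p"
proof -
  have main: "\<exists>p. Poly_Mapping.keys p \<subseteq> J \<and> T ^ b dvd p \<and> p \<noteq> 0" if "finite J" "card J = Suc b" for J b
    using that
  proof (induction b arbitrary: J)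
    case 0
    then obtain j where "J = {j}" by (auto simp: card_1_singleton_iff)
    then show ?case by (intro exI[of _ "Poly_Mapping.single j 1"]) (auto simp flip: keys_eq_empty)
  next
    case (Suc b)
    obtain i where i: "i \<in> J" using Suc.prems by fastforce
    obtain j where j: "j \<in> J - {i}" using Suc.prems i
      by (metis card.empty card_Suc_Diff1 ex_in_conv nat.inject old.nat.distinct(1))
    obtain p where p: "Poly_Mapping.keys p \<subseteq> J - {i}" "T ^ b dvd p" "p \<noteq> 0"
      using Suc.IH[of "J - {i}"] Suc.prems i by auto
    obtain q where q: "Poly_Mapping.keys q \<subseteq> J - {j}" "T ^ b dvd q" "q \<noteq> 0"
      using Suc.IH[of "J - {j}"] Suc.prems j by auto
    obtain p' q' where p': "p = T ^ b * p'" and q': "q = T ^ b * q'" using p q by (auto elim!: dvdE)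
    let ?r = "Poly_Mapping.single 0 (coeff_sum q') * p - Poly_Mapping.single 0 (coeff_sum p') * q"
    have le: "card (Poly_Mapping.keys p) \<le> Suc b"
      using card_mono[OF _ p(1)] Suc.prems i by simp
    have le2: "card (Poly_Mapping.keys q) \<le> Suc b"
      using card_mono[OF _ q(1)] Suc.prems j by simp
    have cq: "coeff_sum q' \<noteq> 0"
    proof
      assume "coeff_sum q' = 0"
      then have "T ^ Suc b dvd q" unfolding q' power_Suc2
        by (intro mult_dvd_mono) (auto simp: T_dvd_iff)
      then show False using T_power_dvd_card[of "Suc b" q] q(3) le2 by linarith
    qed
    have "T ^ Suc b dvd ?r"
    proof -
      have "T dvd Poly_Mapping.single 0 (coeff_sum q') * p' - Poly_Mapping.single 0 (coeff_sum p') * q'"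
        by (simp add: T_dvd_iff coeff_sum_diff coeff_sum_mult)
      then have "T ^ b * T dvd T ^ b * (Poly_Mapping.single 0 (coeff_sum q') * p' - Poly_Mapping.single 0 (coeff_sum p') * q')"
        by (intro mult_dvd_mono) auto
      then show ?thesis by (simp add: p' q' algebra_simps)
    qed
    moreover have lookup_r: "Poly_Mapping.lookup ?r m =
        coeff_sum q' * Poly_Mapping.lookup p m - coeff_sum p' * Poly_Mapping.lookup q m" for m
      by (simp add: lookup_minus lookup_single_times)
    have "Poly_Mapping.keys ?r \<subseteq> J"
    proof
      fix m assume "m \<in> Poly_Mapping.keys ?r"
      then have "m \<in> Poly_Mapping.keys p \<or> m \<in> Poly_Mapping.keys q"
        unfolding in_keys_iff lookup_r by auto
      then show "m \<in> J" using p q by auto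
    qed
    \<comment> \<open>The bound on the number of terms makes the support of \<open>p\<close> all of
      \<open>J - {i}\<close>. So \<open>j\<close> occurs in \<open>p\<close> but not in
      \<open>q\<close>, and its coefficient survives because \<open>cq\<close> holds.\<close>
    moreover have "?r \<noteq> 0"
    proof -
      have "Poly_Mapping.keys p = J - {i}"
        using p Suc.prems i T_power_dvd_card[OF p(2,3)] by (intro card_seteq) auto
      then have "Poly_Mapping.lookup p j \<noteq> 0" using j by (auto simp: in_keys_iff)
      moreover have "Poly_Mapping.lookup q j = 0" using q(1) by (auto simp: in_keys_iff)
      ultimately have "Poly_Mapping.lookup ?r j \<noteq> 0" unfolding lookup_r using cq by simp
      then show ?thesis by auto
    qed
    ultimately show ?case by blast
  qed
  obtain J' where J': "J' \<subseteq> J" "card J' = Suc b" "finite J'"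
    using assms by (metis Suc_leI obtain_subset_with_card_n rev_finite_subset)
  obtain p where p: "Poly_Mapping.keys p \<subseteq> J'" "T ^ b dvd p" "p \<noteq> 0"
    using main[OF J'(3,2)] by blast
  have "\<not> T ^ Suc b dvd p"
    using T_power_dvd_card[of "Suc b" p] card_mono[OF J'(3) p(1)] J'(2) p(3) by auto
  then show ?thesis using that p J' by blast
qed

lemma ord_Y2_eqI:
  assumes "T ^ b dvd p" "\<not> T ^ Suc b dvd p"
  shows "ord_Y2 p = b"
  unfolding ord_Y2_def
proof (rule Greatest_equality)
  show "T ^ b dvd p" by fact
  fix k assume "T ^ k dvd p"
  then show "k \<le> b"
    using assms(2) by (meson dvd_trans le_imp_power_dvd not_less_eq_eq)
qed

lemma ord_Y2_exists:
  assumes "p \<noteq> 0"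
  obtains "T ^ ord_Y2 p dvd p" "\<not> T ^ Suc (ord_Y2 p) dvd p"
proof -
  have bounded: "T ^ k dvd p \<Longrightarrow> k \<le> card (Poly_Mapping.keys p)" for k
    using T_power_dvd_card assms by (metis less_imp_le)
  have "T ^ ord_Y2 p dvd p"
    unfolding ord_Y2_def by (rule GreatestI_nat[of "\<lambda>k. T ^ k dvd p" 0, OF _ bounded]) auto
  moreover have "k \<le> ord_Y2 p" if "T ^ k dvd p" for k
    unfolding ord_Y2_def by (rule Greatest_le_nat[of "\<lambda>k. T ^ k dvd p", OF that bounded])
  ultimately show ?thesis using that by (metis Suc_n_not_le_n)
qed

lemma T_power_dvd_mult_cancel:
  assumes "coeff_sum h \<noteq> 0"
  shows "T ^ k dvd h * p \<longleftrightarrow> T ^ k dvd p"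
proof
  show "T ^ k dvd h * p \<Longrightarrow> T ^ k dvd p"
  proof (induction k arbitrary: p)
    case (Suc k)
    then have "T dvd h * p" by (metis dvd_mult_left power_Suc)
    then have "T dvd p" using assms by (simp add: T_dvd_iff coeff_sum_mult)
    then obtain q where q: "p = T * q" by (rule dvdE)
    have "T * T ^ k dvd T * (h * q)" using Suc.prems q by (simp add: mult.left_commute)
    then have "T ^ k dvd h * q" using T_nonzero by (subst (asm) dvd_mult_cancel_left) auto
    then have "T ^ k dvd q" by (rule Suc.IH)
    then show ?case using q by simp
  qed simp
qed simp

lemma ord_Y2_unit_mult:
  assumes "coeff_sum h \<noteq> 0"
  shows "ord_Y2 (h * p) = ord_Y2 p"
  unfolding ord_Y2_def by (simp add: T_power_dvd_mult_cancel[OF assms])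


section \<open>The valuation of the flag\<close>

text \<open>A character \<open>pt i j = i d + j e\<close> pairs to \<open>j\<close> with \<open>v\<close>, so the rows of a set of characters (\<open>j\<close> fixed)
  are its level sets for \<open>v\<close>. For the flag of \<open>- v\<close> the frame is \<open>(- v, - e)\<close>, which negates both coordinates.\<close>

locale flag_frame =
  fixes v e :: "int \<times> int"
  assumes pairing_e_v: "pairing e v = 1"
begin

section \<open>Coordinates on M adapted to the flag\<close>

definition d :: "int \<times> int" where
  "d = (snd v, - fst v)"

definition pt :: "int \<Rightarrow> int \<Rightarrow> int \<times> int" where
  "pt i j = (i * fst d + j * fst e, i * snd d + j * snd e)"

definition col :: "int \<times> int \<Rightarrow> int" where
  "col m = fst m * snd e - snd m * fst e"

text \<open>This is the determinant of (\<open>d\<close>, \<open>e\<close>). Since it is 1, the two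
  characters form a basis of M, with coordinates \<open>col\<close> and the pairing with
  \<open>v\<close>.\<close>

lemma det_eq: "fst e * fst v + snd e * snd v = 1"
  using pairing_e_v by (simp add: pairing_def)

lemma pairing_pt [simp]: "pairing (pt i j) v = j"
proof -
  have "pairing (pt i j) v = j * (fst e * fst v + snd e * snd v)"
    by (simp add: pairing_def pt_def d_def algebra_simps)
  then show ?thesis by (simp add: det_eq)
qed

lemma col_pt [simp]: "col (pt i j) = i"
proof -
  have "col (pt i j) = i * (fst e * fst v + snd e * snd v)"
    by (simp add: col_def pt_def d_def algebra_simps)
  then show ?thesis by (simp add: det_eq)
qed

lemma pt_col_pairing [simp]: "pt (col m) (pairing m v) = m"
proof -
  have "pt (col m) (pairing m v) =
      (fst m * (fst e * fst v + snd e * snd v), snd m * (fst e * fst v + snd e * snd v))"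
    by (simp add: pairing_def pt_def col_def d_def algebra_simps)
  then show ?thesis by (simp add: det_eq)
qed

lemma pt_eq_iff [simp]: "pt i j = pt i' j' \<longleftrightarrow> i = i' \<and> j = j'"
  by (metis col_pt pairing_pt)

lemma pt_add: "pt (i + i') (j + j') = pt i j + pt i' j'"
  by (simp add: pt_def algebra_simps)

lemma pt_cases [case_names pt]: obtains i j where "m = pt i j"
  by (metis pt_col_pairing)

section \<open>The equation of the curve, and rows\<close>

text \<open>The curve is the closure of the one-parameter subgroup of \<open>v\<close>, which the
  torus cuts out by the equation that the character \<open>d\<close> equals 1.\<close>

definition D :: laurent where
  "D = Poly_Mapping.single d 1 - 1"

lemma pt_1_0: "pt 1 0 = d"
  by (simp add: pt_def)

lemma pt_0_0: "pt 0 0 = 0"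
  by (simp add: pt_def zero_prod_def)

text \<open>The inclusion of row \<open>j\<close> is a ring homomorphism only for
  \<open>j = 0\<close>; in general it is that homomorphism followed by multiplication by the
  monomial of \<open>pt 0 j\<close>.\<close>

lemma push_T: "push (\<lambda>i. pt i j) (T * p) = D * push (\<lambda>i. pt i j) p"
proof -
  have 1: "push (\<lambda>i. pt i j) p = Poly_Mapping.single (pt 0 j) 1 * push (\<lambda>i. pt i 0) p" for p
    by (induction p rule: pm_induct) (auto simp: push_add distrib_left mult_single simp flip: pt_add)
  have 2: "push (\<lambda>i. pt i 0) (T * p) = push (\<lambda>i. pt i 0) T * push (\<lambda>i. pt i 0) p"
    by (rule push_mult) (simp flip: pt_add)
  have 3: "push (\<lambda>i. pt i 0) T = D"
    by (simp add: push_diff pt_1_0 D_def pt_0_0 flip: single_one)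
  show ?thesis
    unfolding 1[of "T * p"] 1[of p] 2 3 by (rule mult.left_commute)
qed

lemma restrict_eq_push: "restrict_Y1 v = push (\<lambda>m. pairing m v)"
  by (simp add: fun_eq_iff restrict_Y1_def push_def)

lemma pairing_add: "pairing (m + m') v = pairing m v + pairing m' v"
  by (simp add: pairing_def algebra_simps)

lemma restrict_mult: "restrict_Y1 v (f * g) = restrict_Y1 v f * restrict_Y1 v g"
  unfolding restrict_eq_push by (rule push_mult) (rule pairing_add)

lemma restrict_power: "restrict_Y1 v (f ^ n) = restrict_Y1 v f ^ n"
  unfolding restrict_eq_push by (rule push_power) (simp_all add: pairing_add, simp add: pairing_def)

lemma restrict_D: "restrict_Y1 v D = 0"
  by (simp add: restrict_eq_push D_def push_diff pairing_add flip: pt_1_0 pt_0_0 single_one)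

text \<open>Modulo \<open>D\<close> the monomial of \<open>pt i j\<close> equals that of
  \<open>pt 0 j\<close>, so every \<open>f\<close> is congruent to a lift of its own restriction. If
  the restriction vanishes, \<open>D\<close> divides \<open>f\<close>.\<close>

lemma ideal_iff: "f \<in> ideal_Y1 v \<longleftrightarrow> D dvd f"
proof
  assume "D dvd f"
  then show "f \<in> ideal_Y1 v"
    by (auto simp: ideal_Y1_def restrict_mult restrict_D elim!: dvdE)
next
  assume *: "f \<in> ideal_Y1 v"
  have "D dvd f - push (\<lambda>j. pt 0 j) (restrict_Y1 v f)"
  proof (induction f rule: pm_induct)
    case (single m c)
    obtain i j where m: "m = pt i j" by (rule pt_cases)
    have "T dvd Poly_Mapping.single i c - Poly_Mapping.single 0 c"
      by (simp add: T_dvd_iff coeff_sum_diff)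
    then obtain q where "Poly_Mapping.single i c - Poly_Mapping.single 0 c = T * q" by (rule dvdE)
    from arg_cong[OF this, of "push (\<lambda>i. pt i j)"]
    have "Poly_Mapping.single (pt i j) c - Poly_Mapping.single (pt 0 j) c = D * push (\<lambda>i. pt i j) q"
      by (simp add: push_T push_diff)
    then show ?case by (simp add: restrict_eq_push m)
  next
    case (add f g)
    then show ?case
      using dvd_add[OF add] by (simp add: restrict_eq_push push_add algebra_simps)
  qed (simp add: restrict_eq_push)
  then show "D dvd f" using * by (simp add: ideal_Y1_def)
qed

definition row :: "int \<Rightarrow> laurent \<Rightarrow> (int \<Rightarrow>\<^sub>0 complex)" where
  "row j = Poly_Mapping.map_key (\<lambda>i. pt i j)"

lemma lookup_row [simp]: "Poly_Mapping.lookup (row j f) i = Poly_Mapping.lookup f (pt i j)"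
  unfolding row_def by (subst map_key.rep_eq) (auto simp: inj_def)

lemma row_D_mult: "row j (D * f) = T * row j f"
proof (intro poly_mapping_eqI)
  fix i
  have "pt i j - d = pt (i - 1) j" by (simp add: prod_eq_iff pt_def algebra_simps)
  then show "Poly_Mapping.lookup (row j (D * f)) i = Poly_Mapping.lookup (T * row j f) i"
    unfolding lookup_T_times by (simp add: D_def left_diff_distrib lookup_minus lookup_single_times)
qed

lemma row_D_power_mult: "row j (D ^ k * f) = T ^ k * row j f"
  by (induction k) (auto simp: row_D_mult mult.assoc)

lemma row_eq_zero_iff: "(\<forall>j. row j f = 0) \<longleftrightarrow> f = 0"
proof
  assume *: "\<forall>j. row j f = 0"
  show "f = 0"
  proof (intro poly_mapping_eqI)
    fix m
    obtain i j where "m = pt i j" by (rule pt_cases)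
    then show "Poly_Mapping.lookup f m = Poly_Mapping.lookup 0 m" using lookup_row[of j f i] * by simp
  qed
qed (auto intro!: poly_mapping_eqI)

text \<open>\<open>D\<close> acts on each row as the nonzero element \<open>T\<close> of an integral
  domain, so it can be cancelled.\<close>

lemma D_mult_eq_0_iff [simp]: "D * f = 0 \<longleftrightarrow> f = 0"
  using T_nonzero by (simp flip: row_eq_zero_iff add: row_D_mult)

lemma D_mult_cancel: "D * f = D * g \<longleftrightarrow> f = g"
  using D_mult_eq_0_iff[of "f - g"] by (simp add: right_diff_distrib)

lemma D_power_mult_cancel: "D ^ k * f = D ^ k * g \<longleftrightarrow> f = g"
  by (induction k) (auto simp: mult.assoc D_mult_cancel)

lemma keys_row: "i \<in> Poly_Mapping.keys (row j f) \<longleftrightarrow> pt i j \<in> Poly_Mapping.keys f"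
  by (simp add: in_keys_iff)

lemma lookup_restrict: "Poly_Mapping.lookup (restrict_Y1 v f) j = coeff_sum (row j f)"
proof (induction f rule: pm_induct)
  case (single m c)
  obtain i j' where m: "m = pt i j'" by (rule pt_cases)
  have "row j (Poly_Mapping.single (pt i j') c) = (if j = j' then Poly_Mapping.single i c else 0)"
    by (intro poly_mapping_eqI) (auto simp: lookup_single when_def)
  then show ?case by (auto simp: restrict_eq_push m lookup_single when_def coeff_sum_def)
next
  case (add f g)
  have "row j (f + g) = row j f + row j g"
    by (intro poly_mapping_eqI) (simp add: lookup_add)
  then show ?case using add by (simp add: restrict_eq_push push_add lookup_add coeff_sum_add)
next
  case zero
  have "row j 0 = 0" by (intro poly_mapping_eqI) simp
  then show ?case by (simp add: restrict_eq_push coeff_sum_def)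
qed

lemma value_Y2_eq: "value_Y2 f = coeff_sum (restrict_Y1 v f)"
  by (simp add: value_Y2_def value_at_def restrict_eq_push coeff_sum_push flip: coeff_sum_conv)

section \<open>The valuation in terms of the fixed equation \<open>D\<close>\<close>

lemma D_power_bounded:
  assumes "s \<noteq> 0" "D ^ k dvd s"
  shows "k \<le> card (Poly_Mapping.keys s)"
proof -
  obtain j where j: "row j s \<noteq> 0" using assms(1) row_eq_zero_iff by blast
  obtain g where "s = D ^ k * g" using assms(2) by (rule dvdE)
  then have "T ^ k dvd row j s" by (simp add: row_D_power_mult)
  then have "k < card (Poly_Mapping.keys (row j s))" using j by (rule T_power_dvd_card)
  also have "card (Poly_Mapping.keys (row j s)) \<le> card (Poly_Mapping.keys s)"
    by (rule card_inj_on_le[of "\<lambda>i. pt i j"]) (auto simp: inj_on_def keys_row)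
  finally show ?thesis by simp
qed

lemma D_factorisation:
  assumes "s \<noteq> 0"
  obtains k g where "s = D ^ k * g" "g \<notin> ideal_Y1 v"
proof -
  let ?k = "GREATEST k. D ^ k dvd s"
  have "D ^ ?k dvd s"
    by (rule GreatestI_nat[of "\<lambda>k. D ^ k dvd s" 0]) (use D_power_bounded assms in auto)
  then obtain g where g: "s = D ^ ?k * g" by (rule dvdE)
  have "\<not> D dvd g"
  proof
    assume "D dvd g"
    then have "D ^ Suc ?k dvd s" using g by (metis dvd_refl mult_dvd_mono power_Suc2)
    moreover have "\<And>y. D ^ y dvd s \<Longrightarrow> y \<le> ?k"
      by (rule Greatest_le_nat[of "\<lambda>k. D ^ k dvd s"]) (use D_power_bounded assms in auto)
    ultimately show False by (metis Suc_n_not_le_n)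
  qed
  then show ?thesis using that[OF g] ideal_iff by blast
qed

lemma local_equation_D: "local_equation_Y1 v D"
proof -
  have "value_Y2 1 = 1" by (simp add: value_Y2_eq restrict_eq_push push_def coeff_sum_def)
  then show ?thesis unfolding local_equation_Y1_def
    using ideal_iff by (auto intro!: exI[of _ 1])
qed

lemma one_notin_ideal: "1 \<notin> ideal_Y1 v"
  using value_Y2_eq[of 1] by (auto simp: ideal_Y1_def value_Y2_def value_at_def coeff_sum_def)

lemma mult_in_ideal_iff: "f * g \<in> ideal_Y1 v \<longleftrightarrow> f \<in> ideal_Y1 v \<or> g \<in> ideal_Y1 v"
  by (simp add: ideal_Y1_def restrict_mult)

text \<open>The order \<open>k\<close> is attained by \<open>D\<close> itself. Every other local
  equation is a multiple of \<open>D\<close>, so a higher power would make \<open>D\<close> divide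
  \<open>h * g\<close>, while the ideal of the curve is prime because its quotient embeds in a
  domain.\<close>

lemma ord_Y1_eq:
  assumes "g \<notin> ideal_Y1 v"
  shows "ord_Y1 v (D ^ k * g) = k"
  unfolding ord_Y1_def
proof (rule Greatest_equality)
  have "D ^ k dvd 1 * (D ^ k * g)" by simp
  then show "\<exists>f h. local_equation_Y1 v f \<and> h \<notin> ideal_Y1 v \<and> f ^ k dvd h * (D ^ k * g)"
    using local_equation_D one_notin_ideal by blast
  fix j assume "\<exists>f h. local_equation_Y1 v f \<and> h \<notin> ideal_Y1 v \<and> f ^ j dvd h * (D ^ k * g)"
  then obtain f h where fh: "local_equation_Y1 v f" "h \<notin> ideal_Y1 v" "f ^ j dvd h * (D ^ k * g)" by blast
  have "D dvd f" using fh(1) ideal_iff by (auto simp: local_equation_Y1_def)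
  then have dvd: "D ^ j dvd D ^ k * (h * g)"
    unfolding mult.left_commute[of "D ^ k"] using fh(3) by (rule dvd_trans[OF dvd_power_same])
  show "j \<le> k"
  proof (rule ccontr)
    assume "\<not> j \<le> k"
    then have "D ^ Suc k dvd D ^ j" by (intro le_imp_power_dvd) simp
    then have "D ^ k * D dvd D ^ k * (h * g)"
      using dvd unfolding power_Suc2 by (rule dvd_trans)
    then have "D dvd h * g"
      by (auto simp: mult.assoc D_power_mult_cancel elim!: dvdE)
    then show False using assms fh(2) by (simp add: mult_in_ideal_iff flip: ideal_iff)
  qed
qed

text \<open>The existence half of \<open>THE\<close> uses \<open>D\<close>. For uniqueness, another
  local equation is \<open>D * u\<close> with \<open>u\<close> a unit at the point of the flag, so
  the two cofactors of \<open>s\<close> differ only by units there and their restrictions vanish to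
  the same order.\<close>

lemma flag_val_eq:
  assumes "g \<notin> ideal_Y1 v"
  shows "flag_val v (D ^ k * g) = (k, ord_Y2 (restrict_Y1 v g))"
  unfolding flag_val_def ord_Y1_eq[OF assms]
proof (intro arg_cong2[of _ _ _ _ Pair] refl the_equality)
  show "\<exists>f g' h. local_equation_Y1 v f \<and> value_Y2 h \<noteq> 0 \<and> h * (D ^ k * g) = f ^ k * g' \<and>
      ord_Y2 (restrict_Y1 v g) = ord_Y2 (restrict_Y1 v g')"
    using local_equation_D
    by (intro exI[of _ D] exI[of _ g] exI[of _ 1]) (auto simp: value_Y2_eq restrict_eq_push push_def coeff_sum_def)
next
  fix b assume "\<exists>f g' h. local_equation_Y1 v f \<and> value_Y2 h \<noteq> 0 \<and> h * (D ^ k * g) = f ^ k * g' \<and>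
      b = ord_Y2 (restrict_Y1 v g')"
  then obtain f g' h where f: "local_equation_Y1 v f" and h: "value_Y2 h \<noteq> 0"
    and eq: "h * (D ^ k * g) = f ^ k * g'" and b: "b = ord_Y2 (restrict_Y1 v g')" by blast
  obtain u where u: "f = D * u"
    using f ideal_iff by (auto simp: local_equation_Y1_def elim!: dvdE)
  \<comment> \<open>Applying the local equation \<open>f\<close> to the element \<open>D\<close> of
    the ideal gives the converse divisibility. Cancelling \<open>D\<close> leaves
    \<open>h' = u * w\<close>, hence \<open>u\<close> does not vanish at the point.\<close>
  obtain h' where h': "value_Y2 h' \<noteq> 0" "f dvd h' * D"
    using f restrict_D unfolding local_equation_Y1_def ideal_Y1_def by blast
  then obtain w where "h' * D = f * w" by (elim dvdE)
  then have "D * h' = D * (u * w)" by (simp add: u mult.commute mult.left_commute)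
  then have "value_Y2 u \<noteq> 0" using h'(1) by (auto simp: D_mult_cancel value_Y2_eq restrict_mult coeff_sum_mult)
  then have u_unit: "coeff_sum (restrict_Y1 v u ^ k) \<noteq> 0"
    by (induction k) (auto simp: value_Y2_eq coeff_sum_mult)
  have "D ^ k * (h * g) = D ^ k * (u ^ k * g')"
    using eq by (simp add: u power_mult_distrib algebra_simps)
  then have "h * g = u ^ k * g'" by (simp add: D_power_mult_cancel)
  then have "restrict_Y1 v h * restrict_Y1 v g = restrict_Y1 v u ^ k * restrict_Y1 v g'"
    by (metis restrict_mult restrict_power)
  then show "b = ord_Y2 (restrict_Y1 v g)"
    using ord_Y2_unit_mult h u_unit b by (metis value_Y2_eq)
qed

section \<open>Values of all sections with a given support\<close>

text \<open>If the rows of \<open>A\<close> have no holes, these are the rows with at least k + 1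
  points, expressed by two points at distance \<open>k\<close> so that no counting is
  involved.\<close>

definition wide_rows :: "(int \<times> int) set \<Rightarrow> nat \<Rightarrow> int set" where
  "wide_rows A k = {j. \<exists>i. pt i j \<in> A \<and> pt (i + int k) j \<in> A}"

lemma finite_wide_rows:
  assumes "finite A"
  shows "finite (wide_rows A k)"
proof (rule finite_subset)
  show "wide_rows A k \<subseteq> (\<lambda>m. pairing m v) ` A"
    by (force simp: wide_rows_def image_iff)
qed (use assms in auto)

text \<open>For a section \<open>D ^ k * g\<close>, a row in which \<open>g\<close> is nonzero
  carries a nonzero multiple of \<open>T ^ k\<close>, hence more than \<open>k\<close> terms; so the
  restriction of \<open>g\<close> is supported on wide rows, which bounds its order. Conversely, a
  polynomial of order exactly \<open>b\<close> supported on the wide rows is lifted to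
  \<open>g\<close> by placing each exponent at the left end of a run, and \<open>D ^ k\<close>
  spreads it over that run.\<close>

lemma flag_vals_of_support:
  assumes "finite A"
    and convex: "\<And>i h i' j. pt i j \<in> A \<Longrightarrow> pt i' j \<in> A \<Longrightarrow> i \<le> h \<Longrightarrow> h \<le> i' \<Longrightarrow> pt h j \<in> A"
  shows "flag_val v ` {s. Poly_Mapping.keys s \<subseteq> A \<and> s \<noteq> 0} = {(k, b). b < card (wide_rows A k)}"
proof (intro equalityI subsetI)
  fix z assume "z \<in> flag_val v ` {s. Poly_Mapping.keys s \<subseteq> A \<and> s \<noteq> 0}"
  then obtain s where s: "Poly_Mapping.keys s \<subseteq> A" "s \<noteq> 0" and z: "z = flag_val v s" by auto
  obtain k g where sg: "s = D ^ k * g" and g: "g \<notin> ideal_Y1 v" using s(2) by (rule D_factorisation)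
  let ?p = "restrict_Y1 v g"
  have p: "?p \<noteq> 0" using g by (simp add: ideal_Y1_def)
  have "Poly_Mapping.keys ?p \<subseteq> wide_rows A k"
  proof
    fix j assume "j \<in> Poly_Mapping.keys ?p"
    then have "row j g \<noteq> 0" by (auto simp: in_keys_iff lookup_restrict coeff_sum_def)
    then have nz: "row j s \<noteq> 0" using T_nonzero by (simp add: sg row_D_power_mult)
    let ?K = "Poly_Mapping.keys (row j s)"
    have K: "?K \<noteq> {}" "finite ?K" using nz by auto
    have "k < card ?K" using nz by (intro T_power_dvd_card) (simp_all add: sg row_D_power_mult)
    also have "card ?K \<le> card {Min ?K..Max ?K}" using K by (intro card_mono) auto
    \<comment> \<open>More than \<open>k\<close> distinct exponents span a length of at least
      \<open>k\<close>; the hypothesis \<open>convex\<close> then supplies the point at distance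
      exactly \<open>k\<close> from the left end.\<close>
    finally have "Min ?K + int k \<le> Max ?K" by simp
    moreover have "pt (Min ?K) j \<in> A" "pt (Max ?K) j \<in> A"
      using Min_in[OF K(2,1)] Max_in[OF K(2,1)] s(1) by (auto simp: keys_row)
    ultimately show "j \<in> wide_rows A k"
      using convex[of "Min ?K" j "Max ?K" "Min ?K + int k"] by (auto simp: wide_rows_def)
  qed
  then have "card (Poly_Mapping.keys ?p) \<le> card (wide_rows A k)"
    using finite_wide_rows[OF assms(1)] by (rule card_mono[rotated])
  moreover have "ord_Y2 ?p < card (Poly_Mapping.keys ?p)"
    using T_power_dvd_card ord_Y2_exists p by blast
  ultimately show "z \<in> {(k, b). b < card (wide_rows A k)}" by (simp add: z sg flag_val_eq[OF g])
next
  fix z assume "z \<in> {(k, b). b < card (wide_rows A k)}"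
  then obtain k b where z: "z = (k, b)" and b: "b < card (wide_rows A k)" by auto
  obtain p where p: "Poly_Mapping.keys p \<subseteq> wide_rows A k" "T ^ b dvd p" "\<not> T ^ Suc b dvd p"
    using T_power_exact[OF finite_wide_rows[OF assms(1)] b] by blast
  have "\<forall>j\<in>wide_rows A k. \<exists>i. pt i j \<in> A \<and> pt (i + int k) j \<in> A"
    by (auto simp: wide_rows_def)
  then obtain x where x: "\<And>j. j \<in> wide_rows A k \<Longrightarrow> pt (x j) j \<in> A \<and> pt (x j + int k) j \<in> A"
    by metis
  define g where "g = push (\<lambda>j. pt (x j) j) p"
  have rg: "restrict_Y1 v g = p"
    by (simp add: restrict_eq_push g_def push_push o_def push_id)
  have "g \<notin> ideal_Y1 v" using p(3) by (auto simp: ideal_Y1_def rg)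
  have val: "flag_val v (D ^ k * g) = z"
    using ord_Y2_eqI[OF p(2,3)] by (simp add: flag_val_eq[OF \<open>g \<notin> ideal_Y1 v\<close>] rg z)
  have "g \<noteq> 0" using p(3) rg by (auto simp: restrict_eq_push)
  \<comment> \<open>Each factor \<open>D\<close> adds a copy shifted by one place within the row, so
    n factors spread a monomial over at most n + 1 consecutive points.\<close>
  have supp: "Poly_Mapping.keys (D ^ n * Poly_Mapping.single (pt i j) c) \<subseteq> (\<lambda>h. pt h j) ` {i..i + int n}" for n i j c
  proof (induction n)
    case (Suc n)
    let ?f = "D ^ n * Poly_Mapping.single (pt i j) c"
    have "D ^ Suc n * Poly_Mapping.single (pt i j) c = Poly_Mapping.single d 1 * ?f - ?f"
      by (simp add: D_def algebra_simps)
    then have "Poly_Mapping.keys (D ^ Suc n * Poly_Mapping.single (pt i j) c)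
        \<subseteq> (\<lambda>m. d + m) ` Poly_Mapping.keys ?f \<union> Poly_Mapping.keys ?f"
      by (metis keys_diff keys_single_times)
    moreover have "d + pt h j = pt (h + 1) j" for h by (simp add: prod_eq_iff pt_def algebra_simps)
    ultimately show ?case using Suc by (fastforce simp: image_iff)
  qed simp
  have expand: "D ^ k * g = (\<Sum>j\<in>Poly_Mapping.keys p. D ^ k * Poly_Mapping.single (pt (x j) j) (Poly_Mapping.lookup p j))"
    by (simp add: g_def push_def sum_distrib_left)
  have "Poly_Mapping.keys (D ^ k * g) \<subseteq>
      (\<Union>j\<in>Poly_Mapping.keys p. Poly_Mapping.keys (D ^ k * Poly_Mapping.single (pt (x j) j) (Poly_Mapping.lookup p j)))"
    unfolding expand by (rule Poly_Mapping.keys_sum)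
  also have "\<dots> \<subseteq> (\<Union>j\<in>Poly_Mapping.keys p. (\<lambda>h. pt h j) ` {x j..x j + int k})"
    by (intro UN_mono supp) auto
  also have "\<dots> \<subseteq> A"
  proof (intro UN_least image_subsetI)
    fix j h assume "j \<in> Poly_Mapping.keys p" and h: "h \<in> {x j..x j + int k}"
    then have "j \<in> wide_rows A k" using p(1) by blast
    then show "pt h j \<in> A" using x convex[of "x j" j "x j + int k" h] h by auto
  qed
  finally have "Poly_Mapping.keys (D ^ k * g) \<subseteq> A" .
  moreover have "D ^ k * g \<noteq> 0"
    using \<open>g \<noteq> 0\<close> D_power_mult_cancel[of k g 0] by simp
  ultimately show "z \<in> flag_val v ` {s. Poly_Mapping.keys s \<subseteq> A \<and> s \<noteq> 0}"
    using val by blast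
qed

end

section \<open>Finite generation of monoids\<close>

lemma submonoid_hull: "submonoid (submonoid hull G)"
  by (auto simp: submonoid_def hull_def)

text \<open>Dickson's lemma in terms of sequences. The coordinates are treated one after another,
  since passing to a further subsequence preserves monotonicity in the coordinates already
  treated.\<close>

lemma monotone_subsequences:
  fixes f :: "nat \<Rightarrow> 'i \<Rightarrow> nat"
  assumes "finite I"
  obtains r where "strict_mono r" "\<And>i. i \<in> I \<Longrightarrow> incseq (\<lambda>n. f (r n) i)"
proof -
  have "\<exists>r::nat\<Rightarrow>nat. strict_mono r \<and> (\<forall>i\<in>I. incseq (\<lambda>n. f (r n) i))"
    using assms
  proof induction
    case empty
    then show ?case by (auto intro: strict_mono_id)
  next
    case (insert i I)
    then obtain r where r: "strict_mono r" "\<forall>i\<in>I. incseq (\<lambda>n. f (r n) i)" by blast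
    obtain q where q: "strict_mono q" "monoseq (\<lambda>n. f (r (q n)) i)"
      using seq_monosub[of "\<lambda>n. f (r n) i"] by (auto simp: o_def)
    have "\<exists>q. strict_mono q \<and> incseq (\<lambda>n. f (r (q n)) i)"
    proof (cases "incseq (\<lambda>n. f (r (q n)) i)")
      case True
      then show ?thesis using q by blast
    next
      \<comment> \<open>A decreasing sequence of natural numbers is constant from an index on where
        its minimum is attained, so a shift of it is increasing as well.\<close>
      case False
      then have dec: "decseq (\<lambda>n. f (r (q n)) i)" using q(2) by (simp add: monoseq_iff)
      define m where "m = (LEAST m. \<exists>n. f (r (q n)) i = m)"
      have "\<exists>n. f (r (q n)) i = m" unfolding m_def by (rule LeastI) blast
      then obtain n0 where n0: "f (r (q n0)) i = m" by blast
      have least: "m \<le> f (r (q n)) i" for n unfolding m_def by (rule Least_le) blast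
      have "f (r (q (n0 + n))) i = m" for n
        using least[of "n0 + n"] decseqD[OF dec, of n0 "n0 + n"] n0 by simp
      then have "incseq (\<lambda>n. f (r (q (n0 + n))) i)" by (simp add: incseq_def)
      moreover have "strict_mono (\<lambda>n. q (n0 + n))" using q(1) by (simp add: strict_mono_def)
      ultimately show ?thesis by blast
    qed
    then obtain q where q: "strict_mono q" "incseq (\<lambda>n. f (r (q n)) i)" by blast
    have "strict_mono (r \<circ> q)" using r q strict_mono_o by blast
    moreover have "incseq (\<lambda>n. f ((r \<circ> q) n) j)" if "j \<in> insert i I" for j
      using that q(2) r(2) strict_mono_mono[OF q(1)] by (auto simp: mono_def)
    ultimately show ?case by blast
  qed
  then show ?thesis using that by blast
qed

text \<open>The argument of Gordan's lemma: two distinct irreducible elements cannot be comparable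
  in all slacks, because their difference would split the larger one. By Dickson's lemma there are
  finitely many irreducibles, and induction on the degree shows that they generate. The map
  \<open>\<phi>\<close> may be non-additive, so the slacks of an arbitrarily chosen witness are
  admissible; this is what makes projections of cones accessible.\<close>

lemma finitely_generated_if_slacks:
  fixes S :: "'a::comm_monoid_add set" and \<phi> :: "'a \<Rightarrow> 'i \<Rightarrow> nat"
  assumes S: "submonoid S" and "finite I"
    and diff: "\<And>x y. x \<in> S \<Longrightarrow> y \<in> S \<Longrightarrow> (\<And>i. i \<in> I \<Longrightarrow> \<phi> x i \<le> \<phi> y i) \<Longrightarrow> \<exists>z\<in>S. y = x + z"
    and deg_add: "\<And>x y. deg (x + y) = deg x + (deg y :: nat)"
    and deg_0: "\<And>x. x \<in> S \<Longrightarrow> deg x = 0 \<Longrightarrow> x = 0"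
  shows "finitely_generated S"
proof -
  define G where "G = {x\<in>S. x \<noteq> 0 \<and> (\<forall>y\<in>S. \<forall>z\<in>S. x = y + z \<longrightarrow> y = 0 \<or> z = 0)}"
  have "finite G"
  proof (rule ccontr)
    assume "infinite G"
    then obtain f :: "nat \<Rightarrow> 'a" where f: "inj f" "range f \<subseteq> G"
      using infinite_countable_subset by blast
    obtain r where r: "strict_mono r" "\<And>i. i \<in> I \<Longrightarrow> incseq (\<lambda>n. \<phi> (f (r n)) i)"
      using monotone_subsequences[OF \<open>finite I\<close>, of "\<lambda>n. \<phi> (f n)"] by blast
    have G: "f n \<in> G" for n using f(2) by blast
    have "\<exists>z\<in>S. f (r 1) = f (r 0) + z"
      using G r(2) by (intro diff) (auto simp: G_def incseq_def)
    then obtain z where "z \<in> S" "f (r 1) = f (r 0) + z" by blast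
    moreover have "f (r 0) \<in> S" "f (r 0) \<noteq> 0" using G[of "r 0"] by (auto simp: G_def)
    moreover have "\<forall>y\<in>S. \<forall>z\<in>S. f (r 1) = y + z \<longrightarrow> y = 0 \<or> z = 0" using G[of "r 1"] by (simp add: G_def)
    ultimately have "f (r 1) = f (r 0)" by (metis add.right_neutral)
    then have "r 1 = r 0" using f(1) by (simp add: inj_eq)
    then show False using strict_mono_eq[OF r(1), of 1 0] by simp
  qed
  have "x \<in> submonoid hull G" if "x \<in> S" for x
    using that
  proof (induction "deg x" arbitrary: x rule: less_induct)
    case less
    show ?case
    proof (cases "x = 0 \<or> x \<in> G")
      case True
      then show ?thesis using submonoid_hull[of G] by (auto simp: submonoid_def hull_inc)
    next
      case False
      then obtain y z where yz: "y \<in> S" "z \<in> S" "x = y + z" "y \<noteq> 0" "z \<noteq> 0"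
        using less.prems by (auto simp: G_def)
      then have "deg y \<noteq> 0" "deg z \<noteq> 0" using deg_0 by auto
      then have "y \<in> submonoid hull G" "z \<in> submonoid hull G"
        using less.hyps yz deg_add by auto
      then show ?thesis using submonoid_hull[of G] yz(3) by (auto simp: submonoid_def)
    qed
  qed
  moreover have "submonoid hull G \<subseteq> S" using S by (intro hull_minimal) (auto simp: G_def)
  ultimately show ?thesis unfolding finitely_generated_def using \<open>finite G\<close> by blast
qed


section \<open>Lattice points in the rows of multiples of a polygon\<close>

definition wide_rows_of :: "(int \<times> int) set \<Rightarrow> nat \<Rightarrow> int set" where
  "wide_rows_of P k = {j. \<exists>i. (i, j) \<in> P \<and> (i + int k, j) \<in> P}"

lemma finite_wide_rows_of:
  assumes "finite P"
  shows "finite (wide_rows_of P k)"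
  by (rule finite_subset[of _ "snd ` P"]) (use assms in \<open>force simp: wide_rows_of_def image_iff\<close>)+

text \<open>Without gaps between the wide rows, \<open>b\<close> is bounded by the difference of two row indices, and the
  monoid is the projection of the lattice points of a rational polyhedral cone.\<close>

lemma finitely_generated_if_no_gaps:
  fixes H :: "(int \<times> int \<times> int) set"
  defines "P \<equiv> (\<lambda>l. {(x, y). \<forall>(\<alpha>, \<beta>, \<gamma>)\<in>H. \<alpha> * x + \<beta> * y + int l * \<gamma> \<ge> 0})"
  assumes "finite H" and P_0: "P 0 \<subseteq> {0}" and finite_P: "\<And>l. finite (P l)"
    and no_gaps: "\<And>l k j1 j j2. j1 \<in> wide_rows_of (P l) k \<Longrightarrow> j2 \<in> wide_rows_of (P l) k \<Longrightarrow>
      j1 \<le> j \<Longrightarrow> j \<le> j2 \<Longrightarrow> j \<in> wide_rows_of (P l) k"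
  shows "finitely_generated {(l, k, b). b < card (wide_rows_of (P l) k)}" (is "finitely_generated ?S")
proof -
  \<comment> \<open>The witness holds the left ends of runs of k + 1 points in two rows at least
    \<open>b\<close> apart. This turns a cardinality into homogeneous linear inequalities in the
    element and its witness.\<close>
  define M where "M = (\<lambda>(l, k, b) (x1, y1, x2, y2). (x1, y1) \<in> P l \<and> (x1 + int k, y1) \<in> P l \<and>
    (x2, y2) \<in> P l \<and> (x2 + int k, y2) \<in> P l \<and> int b \<le> y2 - y1)"
  have S_iff: "s \<in> ?S \<longleftrightarrow> (\<exists>w. M s w)" for s
  proof -
    obtain l k b where s: "s = (l, k, b)" by (cases s)
    let ?J = "wide_rows_of (P l) k"
    have fin: "finite ?J" by (intro finite_wide_rows_of finite_P)
    have "b < card ?J \<longleftrightarrow> (\<exists>y1\<in>?J. \<exists>y2\<in>?J. int b \<le> y2 - y1)"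
    proof
      assume b: "b < card ?J"
      then have "?J \<noteq> {}" by auto
      have "card ?J \<le> card {Min ?J..Max ?J}" using fin by (intro card_mono) auto
      then have "int b \<le> Max ?J - Min ?J" using b by simp
      then show "\<exists>y1\<in>?J. \<exists>y2\<in>?J. int b \<le> y2 - y1"
        using Min_in[OF fin \<open>?J \<noteq> {}\<close>] Max_in[OF fin \<open>?J \<noteq> {}\<close>] by blast
    next
      assume "\<exists>y1\<in>?J. \<exists>y2\<in>?J. int b \<le> y2 - y1"
      then obtain y1 y2 where y: "y1 \<in> ?J" "y2 \<in> ?J" "int b \<le> y2 - y1" by blast
      have "{y1..y2} \<subseteq> ?J" using no_gaps[OF y(1,2)] by auto
      then have "card {y1..y2} \<le> card ?J" using fin by (intro card_mono)
      then show "b < card ?J" using y(3) by simp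
    qed
    moreover have "(\<exists>w. M s w) \<longleftrightarrow> (\<exists>y1\<in>?J. \<exists>y2\<in>?J. int b \<le> y2 - y1)"
    proof
      assume "\<exists>w. M s w"
      then obtain x1 y1 x2 y2 where "M s (x1, y1, x2, y2)" by (metis prod_cases4)
      then have "y1 \<in> ?J" "y2 \<in> ?J" "int b \<le> y2 - y1" by (auto simp: M_def s wide_rows_of_def)
      then show "\<exists>y1\<in>?J. \<exists>y2\<in>?J. int b \<le> y2 - y1" by blast
    next
      assume "\<exists>y1\<in>?J. \<exists>y2\<in>?J. int b \<le> y2 - y1"
      then obtain x1 y1 x2 y2 where "M s (x1, y1, x2, y2)" by (auto simp: M_def s wide_rows_of_def)
      then show "\<exists>w. M s w" by blast
    qed
    ultimately show ?thesis by (simp add: s)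
  qed
  have M_add: "M (s + s') (w + w')" if "M s w" "M s' w'" for s s' w w'
  proof -
    have P_add: "(x + x', y + y') \<in> P (l + l')" if "(x, y) \<in> P l" "(x', y') \<in> P l'" for x x' y y' l l'
      unfolding P_def mem_Collect_eq prod.case
    proof clarify
      fix \<alpha> \<beta> \<gamma> assume "(\<alpha>, \<beta>, \<gamma>) \<in> H"
      then have "\<alpha> * x + \<beta> * y + int l * \<gamma> \<ge> 0" "\<alpha> * x' + \<beta> * y' + int l' * \<gamma> \<ge> 0"
        using that by (auto simp: P_def)
      then show "0 \<le> \<alpha> * (x + x') + \<beta> * (y + y') + int (l + l') * \<gamma>"
        by (simp add: algebra_simps)
    qed
    obtain l k b x1 y1 x2 y2 where s: "s = (l, k, b)" "w = (x1, y1, x2, y2)"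
      by (metis prod_cases3 prod_cases4)
    obtain l' k' b' x1' y1' x2' y2' where s': "s' = (l', k', b')" "w' = (x1', y1', x2', y2')"
      by (metis prod_cases3 prod_cases4)
    show ?thesis
      using that P_add[of "x1 + int k" y1 l "x1' + int k'" y1' l']
        P_add[of "x2 + int k" y2 l "x2' + int k'" y2' l']
      by (simp add: s s' M_def P_add algebra_simps)
  qed
  define wit where "wit s = (SOME w. M s w)" for s
  have M_wit: "M s (wit s)" if "s \<in> ?S" for s
    using that S_iff unfolding wit_def by (metis someI_ex)
  \<comment> \<open>All linear forms that define \<open>M\<close>, together with \<open>l\<close>,
    \<open>k\<close> and \<open>b\<close> themselves; the latter ensure that the subtractions of
    natural numbers below are genuine.\<close>
  define I :: "((nat \<times> nat \<times> nat) \<times> (int \<times> int \<times> int \<times> int) \<Rightarrow> int) set" where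
    "I = {\<lambda>((l, k, b), x1, y1, x2, y2). int l, \<lambda>((l, k, b), x1, y1, x2, y2). int k,
      \<lambda>((l, k, b), x1, y1, x2, y2). int b, \<lambda>((l, k, b), x1, y1, x2, y2). y2 - y1 - int b} \<union>
      (\<Union>(\<alpha>, \<beta>, \<gamma>)\<in>H. {\<lambda>((l, k, b), x1, y1, x2, y2). \<alpha> * x1 + \<beta> * y1 + int l * \<gamma>,
        \<lambda>((l, k, b), x1, y1, x2, y2). \<alpha> * (x1 + int k) + \<beta> * y1 + int l * \<gamma>,
        \<lambda>((l, k, b), x1, y1, x2, y2). \<alpha> * x2 + \<beta> * y2 + int l * \<gamma>,
        \<lambda>((l, k, b), x1, y1, x2, y2). \<alpha> * (x2 + int k) + \<beta> * y2 + int l * \<gamma>})"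
  have "finite I" using \<open>finite H\<close> by (auto simp: I_def)
  have I_nonneg: "\<psi> (s, w) \<ge> 0" if "M s w" "\<psi> \<in> I" for \<psi> s w
    using that by (auto simp: M_def I_def P_def split: prod.splits)
  show ?thesis
  proof (rule finitely_generated_if_slacks[where \<phi> = "\<lambda>s \<psi>. nat (\<psi> (s, wit s))" and I = I and deg = fst])
    show "submonoid ?S"
      unfolding submonoid_def
    proof (intro conjI ballI)
      have "M 0 0" by (auto simp: M_def zero_prod_def P_def)
      then show "0 \<in> ?S" unfolding S_iff by blast
      fix s s' assume "s \<in> ?S" "s' \<in> ?S"
      then show "s + s' \<in> ?S" unfolding S_iff using M_add by blast
    qed
    show "finite I" by fact
    show "fst (s + s') = fst s + fst s'" for s s' :: "nat \<times> nat \<times> nat" by simp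
    show "s = 0" if mem: "s \<in> ?S" and deg: "fst s = 0" for s
    proof -
      obtain k b where s: "s = (0, k, b)" using deg by (cases s) auto
      obtain x1 y1 x2 y2 where "M s (x1, y1, x2, y2)" using M_wit[OF mem] by (metis prod_cases4)
      then have w: "(x1, y1) \<in> P 0" "(x1 + int k, y1) \<in> P 0" "(x2, y2) \<in> P 0" "int b \<le> y2 - y1"
        unfolding M_def s by simp_all
      have "(x1, y1) = 0" "(x1 + int k, y1) = 0" "(x2, y2) = 0" using P_0 w(1-3) by blast+
      then have "k = 0" "b = 0" using w(4) by (simp_all add: zero_prod_def)
      then show ?thesis by (simp add: s zero_prod_def)
    qed
    show "\<exists>z\<in>?S. s' = s + z" if "s \<in> ?S" "s' \<in> ?S"
      and le: "\<And>\<psi>. \<psi> \<in> I \<Longrightarrow> nat (\<psi> (s, wit s)) \<le> nat (\<psi> (s', wit s'))" for s s'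
    proof -
      have le': "\<psi> (s, wit s) \<le> \<psi> (s', wit s')" if "\<psi> \<in> I" for \<psi>
        using le[OF that] I_nonneg[OF M_wit that] \<open>s \<in> ?S\<close> \<open>s' \<in> ?S\<close> by (simp add: le_nat_iff)
      obtain l k b x1 y1 x2 y2 where s: "s = (l, k, b)" "wit s = (x1, y1, x2, y2)"
        by (metis prod_cases3 prod_cases4)
      obtain l' k' b' x1' y1' x2' y2' where s': "s' = (l', k', b')" "wit s' = (x1', y1', x2', y2')"
        by (metis prod_cases3 prod_cases4)
      have 1: "l \<le> l'" "k \<le> k'" "b \<le> b'" "y2 - y1 - int b \<le> y2' - y1' - int b'"
        using le'[of "\<lambda>((l, k, b), x1, y1, x2, y2). int l"]
          le'[of "\<lambda>((l, k, b), x1, y1, x2, y2). int k"]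
          le'[of "\<lambda>((l, k, b), x1, y1, x2, y2). int b"]
          le'[of "\<lambda>((l, k, b), x1, y1, x2, y2). y2 - y1 - int b"]
        by (simp_all add: I_def s s' s(2)[unfolded s(1)] s'(2)[unfolded s'(1)])
      have 2: "\<alpha> * x1 + \<beta> * y1 + int l * \<gamma> \<le> \<alpha> * x1' + \<beta> * y1' + int l' * \<gamma>"
        "\<alpha> * (x1 + int k) + \<beta> * y1 + int l * \<gamma> \<le> \<alpha> * (x1' + int k') + \<beta> * y1' + int l' * \<gamma>"
        "\<alpha> * x2 + \<beta> * y2 + int l * \<gamma> \<le> \<alpha> * x2' + \<beta> * y2' + int l' * \<gamma>"
        "\<alpha> * (x2 + int k) + \<beta> * y2 + int l * \<gamma> \<le> \<alpha> * (x2' + int k') + \<beta> * y2' + int l' * \<gamma>"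
        if h: "(\<alpha>, \<beta>, \<gamma>) \<in> H" for \<alpha> \<beta> \<gamma>
      proof -
        have mem: "{\<lambda>((l, k, b), x1, y1, x2, y2). \<alpha> * x1 + \<beta> * y1 + int l * \<gamma>,
          \<lambda>((l, k, b), x1, y1, x2, y2). \<alpha> * (x1 + int k) + \<beta> * y1 + int l * \<gamma>,
          \<lambda>((l, k, b), x1, y1, x2, y2). \<alpha> * x2 + \<beta> * y2 + int l * \<gamma>,
          \<lambda>((l, k, b), x1, y1, x2, y2). \<alpha> * (x2 + int k) + \<beta> * y2 + int l * \<gamma>} \<subseteq> I"
          unfolding I_def using h by (intro le_supI2) (auto intro!: bexI[of _ "(\<alpha>, \<beta>, \<gamma>)"])
        show "\<alpha> * x1 + \<beta> * y1 + int l * \<gamma> \<le> \<alpha> * x1' + \<beta> * y1' + int l' * \<gamma>"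
          using le'[of "\<lambda>((l, k, b), x1, y1, x2, y2). \<alpha> * x1 + \<beta> * y1 + int l * \<gamma>"] mem by (simp add: s s' s(2)[unfolded s(1)] s'(2)[unfolded s'(1)])
        show "\<alpha> * (x1 + int k) + \<beta> * y1 + int l * \<gamma> \<le> \<alpha> * (x1' + int k') + \<beta> * y1' + int l' * \<gamma>"
          using le'[of "\<lambda>((l, k, b), x1, y1, x2, y2). \<alpha> * (x1 + int k) + \<beta> * y1 + int l * \<gamma>"] mem by (simp add: s s' s(2)[unfolded s(1)] s'(2)[unfolded s'(1)])
        show "\<alpha> * x2 + \<beta> * y2 + int l * \<gamma> \<le> \<alpha> * x2' + \<beta> * y2' + int l' * \<gamma>"
          using le'[of "\<lambda>((l, k, b), x1, y1, x2, y2). \<alpha> * x2 + \<beta> * y2 + int l * \<gamma>"] mem by (simp add: s s' s(2)[unfolded s(1)] s'(2)[unfolded s'(1)])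
        show "\<alpha> * (x2 + int k) + \<beta> * y2 + int l * \<gamma> \<le> \<alpha> * (x2' + int k') + \<beta> * y2' + int l' * \<gamma>"
          using le'[of "\<lambda>((l, k, b), x1, y1, x2, y2). \<alpha> * (x2 + int k) + \<beta> * y2 + int l * \<gamma>"] mem by (simp add: s s' s(2)[unfolded s(1)] s'(2)[unfolded s'(1)])
      qed
      \<comment> \<open>The forms are linear, so their values at the difference of the elements and
        witnesses are the differences of slacks, which are nonnegative. The difference of the
        witnesses therefore witnesses the difference of the elements.\<close>
      let ?z = "(l' - l, k' - k, b' - b)"
      have "M ?z (x1' - x1, y1' - y1, x2' - x2, y2' - y2)"
        using 1 2 by (auto simp: M_def P_def of_nat_diff algebra_simps)
      then have "?z \<in> ?S" unfolding S_iff by blast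
      moreover have "s' = s + ?z" using 1 by (simp add: s s')
      ultimately show ?thesis by blast
    qed
  qed
qed


section \<open>Polygons and their widest row\<close>

lemma convex_row:
  fixes Q :: "(real \<times> real) set"
  assumes "convex Q" "(x, y) \<in> Q" "(x', y) \<in> Q" "x \<le> z" "z \<le> x'"
  shows "(z, y) \<in> Q"
proof -
  have "z \<in> closed_segment x x'" using assms(4,5) by (simp add: closed_segment_eq_real_ivl)
  then obtain u where u: "0 \<le> u" "u \<le> 1" "z = (1 - u) * x + u * x'"
    by (auto simp: closed_segment_def)
  have "(1 - u) *\<^sub>R (x, y) + u *\<^sub>R (x', y) \<in> Q"
    using assms(1-3) u by (intro convexD) auto
  moreover have "(1 - u) *\<^sub>R (x, y) + u *\<^sub>R (x', y) = (z, y)"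
    using u by (simp add: algebra_simps)
  ultimately show ?thesis by simp
qed

text \<open>The lattice points of the l-fold multiple of \<open>Q\<close>, with all levels referring
  to the same \<open>Q\<close>. Division by zero makes this meaningless for \<open>l = 0\<close>;
  that level is treated separately.\<close>

definition scaled_points :: "(real \<times> real) set \<Rightarrow> nat \<Rightarrow> (int \<times> int) set" where
  "scaled_points Q l = {(i, j). (of_int i / real l, of_int j / real l) \<in> Q}"

lemma finite_scaled_points:
  assumes "bounded Q" "l > 0"
  shows "finite (scaled_points Q l)"
proof -
  obtain r where r: "\<And>z. z \<in> Q \<Longrightarrow> norm z \<le> r" using assms(1) by (auto simp: bounded_iff)
  have "scaled_points Q l \<subseteq> {- \<lceil>l * r\<rceil>..\<lceil>l * r\<rceil>} \<times> {- \<lceil>l * r\<rceil>..\<lceil>l * r\<rceil>}"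
  proof clarify
    fix i j assume "(i, j) \<in> scaled_points Q l"
    then have "norm (of_int i / real l, of_int j / real l) \<le> r" using r by (simp add: scaled_points_def)
    then have "\<bar>of_int i / real l\<bar> \<le> r" "\<bar>of_int j / real l\<bar> \<le> r"
      using norm_fst_le[of "of_int i / real l" "of_int j / real l"]
        norm_snd_le[of "of_int j / real l" "of_int i / real l"] by auto
    then have "\<bar>real_of_int i\<bar> \<le> l * r" "\<bar>real_of_int j\<bar> \<le> l * r"
      using assms(2) by (simp_all add: abs_divide field_simps)
    then show "i \<in> {- \<lceil>l * r\<rceil>..\<lceil>l * r\<rceil>} \<and> j \<in> {- \<lceil>l * r\<rceil>..\<lceil>l * r\<rceil>}"
      by (simp add: abs_le_iff) linarith
  qed
  then show ?thesis by (rule finite_subset) simp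
qed

text \<open>\<open>A\<close> and \<open>B\<close> are slopes of supporting lines at the two ends of row \<open>c\<close>, with signs such that row
  \<open>c - h\<close> is shorter than row \<open>c\<close> by at least \<open>(A + B) h\<close>.\<close>

definition flanked :: "(real \<times> real) set \<Rightarrow> real \<Rightarrow> real \<Rightarrow> real \<Rightarrow> real \<Rightarrow> real \<Rightarrow> bool" where
  "flanked Q c x0 x1 A B \<longleftrightarrow> (x0, c) \<in> Q \<and> (x1, c) \<in> Q \<and>
     (\<forall>(x, y)\<in>Q. x0 + A * (c - y) \<le> x \<and> x \<le> x1 - B * (c - y))"

text \<open>Interpolating between the run in row \<open>j1\<close> and the ends of row
  \<open>c\<close> moves the left end outwards by at least \<open>A * n\<close> and the right end by
  at least \<open>B * n\<close>. The hypothesis on floors says that shifting the run left by the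
  floor of \<open>A * n\<close> keeps its right end inside.\<close>

lemma wide_rows_extend_up:
  fixes A B c x0 x1 :: real
  assumes "convex Q" "flanked Q c x0 x1 A B"
    and floors: "\<And>n::int. n \<ge> 1 \<Longrightarrow> \<lfloor>A * n\<rfloor> + \<lfloor>B * n\<rfloor> \<ge> 0"
    and "l > 0" "j1 \<in> wide_rows_of (scaled_points Q l) k" "j1 \<le> j" "of_int j \<le> l * c"
  shows "j \<in> wide_rows_of (scaled_points Q l) k"
proof (cases "j = j1")
  case False
  define n where "n = j - j1"
  have n: "n \<ge> 1" using False assms(6) by (simp add: n_def)
  obtain i where i: "(i / l, j1 / l) \<in> Q" "((i + int k) / l, j1 / l) \<in> Q"
    using assms(5) by (auto simp: wide_rows_of_def scaled_points_def)
  have pos: "l * c - j1 > 0" using assms(6,7) False by linarith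
  \<comment> \<open>Row \<open>j\<close> lies at the fraction \<open>t\<close> of the way from row
    \<open>j1\<close> to the longest row.\<close>
  define t where "t = n / (l * c - j1)"
  have t: "0 \<le> t" "t \<le> 1" using pos n assms(7) by (auto simp: t_def n_def field_simps)
  have tn: "t * (l * c - j1) = n" using pos by (simp add: t_def)
  have y: "(1 - t) * (j1 / l) + t * c = j / l"
  proof -
    have "(1 - t) * (j1 / l) + t * c = (j1 + t * (l * c - j1)) / l"
      using assms(4) by (simp add: field_simps)
    also have "\<dots> = j / l" unfolding tn by (simp add: n_def)
    finally show ?thesis .
  qed
  have mem: "((1 - t) * x + t * x', j / l) \<in> Q" if "(x, j1 / l) \<in> Q" "(x', c) \<in> Q" for x x'
  proof -
    have "(1 - t) *\<^sub>R (x, j1 / l) + t *\<^sub>R (x', c) \<in> Q"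
      using assms(1) that t by (intro convexD) auto
    then show ?thesis using y by simp
  qed
  have left: "((1 - t) * (i / l) + t * x0, j / l) \<in> Q"
    using assms(2) i by (intro mem) (auto simp: flanked_def)
  have right: "((1 - t) * ((i + int k) / l) + t * x1, j / l) \<in> Q"
    using assms(2) i by (intro mem) (auto simp: flanked_def)
  have tl: "t * (c - j1 / l) = n / l"
    using tn assms(4) by (simp add: field_simps)
  have "x0 + A * (c - j1 / l) \<le> i / l" using assms(2) i(1) by (auto simp: flanked_def)
  then have "t * (x0 + A * (c - j1 / l)) \<le> t * (i / l)" using t by (intro mult_left_mono)
  then have "t * x0 + A * (t * (c - j1 / l)) \<le> t * (i / l)" by (simp add: algebra_simps)
  then have L: "(1 - t) * (i / l) + t * x0 \<le> (i - A * n) / l"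
    unfolding tl by (simp add: left_diff_distrib diff_divide_distrib)
  have "(i + int k) / l \<le> x1 - B * (c - j1 / l)" using assms(2) i(2) by (auto simp: flanked_def)
  then have "t * ((i + int k) / l) \<le> t * (x1 - B * (c - j1 / l))" using t by (intro mult_left_mono)
  then have "t * ((i + int k) / l) \<le> t * x1 - B * (t * (c - j1 / l))" by (simp add: algebra_simps)
  then have R: "(i + int k + B * n) / l \<le> (1 - t) * ((i + int k) / l) + t * x1"
    unfolding tl left_diff_distrib by (simp add: add_divide_distrib)
  \<comment> \<open>The leftmost integer that is certainly in row \<open>j\<close>; by
    \<open>floors\<close> it exceeds \<open>i\<close> by at most the floor of \<open>B * n\<close>,
    so the right end of the shifted run fits too.\<close>
  define i' where "i' = i - \<lfloor>A * n\<rfloor>"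
  have 1: "(i - A * n) / l \<le> i' / l" using assms(4) by (intro divide_right_mono) (auto simp: i'_def)
  have "i' + int k \<le> i + int k + \<lfloor>B * n\<rfloor>" using floors[OF n] by (simp add: i'_def)
  then have "real_of_int (i' + int k) \<le> i + int k + B * n" by linarith
  then have 2: "(i' + int k) / l \<le> (i + int k + B * n) / l" using assms(4) by (intro divide_right_mono) auto
  have 3: "i' / l \<le> (i' + int k) / l" using assms(4) by (intro divide_right_mono) auto
  have "(i' / l, j / l) \<in> Q" "((i' + int k) / l, j / l) \<in> Q"
    using L R 1 2 3 by (auto intro!: convex_row[OF assms(1) left right])
  then show ?thesis by (auto simp: wide_rows_of_def scaled_points_def)
qed (use assms in simp)

text \<open>Transfers results about rows below the longest one to rows above it. Reflection reverses
  a run, so the left end \<open>i\<close> becomes \<open>- (i + int k)\<close>.\<close>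

lemma wide_rows_of_uminus:
  "wide_rows_of (scaled_points (uminus ` Q) l) k = uminus ` wide_rows_of (scaled_points Q l) k"
proof -
  have mem: "(x, y) \<in> uminus ` Q \<longleftrightarrow> (- x, - y) \<in> Q" for x y :: real and Q
    by (force simp: image_iff)
  have imp: "- j \<in> wide_rows_of (scaled_points Q l) k"
    if j: "j \<in> wide_rows_of (scaled_points (uminus ` Q) l) k" for j and Q :: "(real \<times> real) set"
  proof -
    obtain i where "(- (of_int i / l), - (of_int j / l)) \<in> Q" "(- (of_int (i + int k) / l), - (of_int j / l)) \<in> Q"
      using j unfolding wide_rows_of_def scaled_points_def mem_Collect_eq prod.case mem by blast
    moreover have "of_int (- (i + int k)) / real l = - (of_int (i + int k) / l)"
      "of_int (- (i + int k) + int k) / real l = - (of_int i / l)"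
      "of_int (- j) / real l = - (of_int j / l)"
      by (simp_all add: diff_divide_distrib add_divide_distrib)
    ultimately show ?thesis
      unfolding wide_rows_of_def scaled_points_def mem_Collect_eq prod.case by metis
  qed
  have "j \<in> wide_rows_of (scaled_points (uminus ` Q) l) k" if "- j \<in> wide_rows_of (scaled_points Q l) k" for j
    using imp[of "- j" "uminus ` Q"] that by (simp add: image_image)
  then show ?thesis using imp by (force simp: image_iff)
qed

section \<open>Real row lengths and the obstruction to finite generation\<close>

definition rows_wide :: "(real \<times> real) set \<Rightarrow> real \<Rightarrow> real set" where
  "rows_wide Q s = {y. \<exists>x. (x, y) \<in> Q \<and> (x + s, y) \<in> Q}"

lemma compact_rows_wide:
  assumes "compact Q"
  shows "compact (rows_wide Q s)"
proof -
  have "closed ((\<lambda>z. (fst z + s, snd z)) -` Q)"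
    by (intro closed_vimage[OF compact_imp_closed[OF assms]] continuous_intros)
  then have "compact (Q \<inter> (\<lambda>z. (fst z + s, snd z)) -` Q)"
    by (rule compact_Int_closed[OF assms])
  then have "compact (snd ` (Q \<inter> (\<lambda>z. (fst z + s, snd z)) -` Q))"
    by (intro compact_continuous_image continuous_on_snd continuous_on_id)
  moreover have "rows_wide Q s = snd ` (Q \<inter> (\<lambda>z. (fst z + s, snd z)) -` Q)"
    by (force simp: rows_wide_def image_iff)
  ultimately show ?thesis by simp
qed

text \<open>Convexity jointly in length and height is what later makes the lowest sufficiently long
  row a convex function of the length, and the highest one a concave function.\<close>

lemma convex_rows_wide:
  assumes "convex Q"
  shows "convex {(s, y). y \<in> rows_wide Q s}"
proof (rule convexI)
  fix z z' :: "real \<times> real" and u w :: real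
  assume z: "z \<in> {(s, y). y \<in> rows_wide Q s}" "z' \<in> {(s, y). y \<in> rows_wide Q s}"
    and uw: "0 \<le> u" "0 \<le> w" "u + w = 1"
  obtain s y s' y' where z_eq: "z = (s, y)" "z' = (s', y')" by (cases z, cases z')
  from z obtain x x' where x: "(x, y) \<in> Q" "(x + s, y) \<in> Q" "(x', y') \<in> Q" "(x' + s', y') \<in> Q"
    by (auto simp: z_eq rows_wide_def)
  have "u *\<^sub>R (x, y) + w *\<^sub>R (x', y') \<in> Q" "u *\<^sub>R (x + s, y) + w *\<^sub>R (x' + s', y') \<in> Q"
    by (rule convexD[OF assms x(1,3) uw], rule convexD[OF assms x(2,4) uw])
  moreover have "u *\<^sub>R (x, y) + w *\<^sub>R (x', y') = (u * x + w * x', u * y + w * y')"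
    "u *\<^sub>R (x + s, y) + w *\<^sub>R (x' + s', y') = (u * x + w * x' + (u * s + w * s'), u * y + w * y')"
    by (simp_all add: algebra_simps)
  ultimately have "u * y + w * y' \<in> rows_wide Q (u * s + w * s')"
    unfolding rows_wide_def by auto
  then show "u *\<^sub>R z + w *\<^sub>R z' \<in> {(s, y). y \<in> rows_wide Q s}" by (simp add: z_eq)
qed

lemma rows_wide_between:
  assumes "convex Q" "y1 \<in> rows_wide Q s" "y2 \<in> rows_wide Q s" "y1 \<le> y" "y \<le> y2"
  shows "y \<in> rows_wide Q s"
proof -
  have "y \<in> closed_segment y1 y2" using assms(4,5) by (simp add: closed_segment_eq_real_ivl)
  then obtain u where u: "0 \<le> u" "u \<le> 1" "y = (1 - u) * y1 + u * y2"
    by (auto simp: closed_segment_def)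
  have "(1 - u) *\<^sub>R (s, y1) + u *\<^sub>R (s, y2) \<in> {(s, y). y \<in> rows_wide Q s}"
    using assms(2,3) u by (intro convexD[OF convex_rows_wide[OF assms(1)]]) auto
  moreover have "(1 - u) *\<^sub>R (s, y1) + u *\<^sub>R (s, y2) = (s, y)"
    using u by (simp add: algebra_simps)
  ultimately show ?thesis by simp
qed

lemma submonoid_multiple:
  fixes l k b :: nat
  assumes "submonoid S" "(l, k, b) \<in> S"
  shows "(r * l, r * k, r * b) \<in> S"
proof (induction r)
  case 0
  then show ?case using assms(1) by (simp add: submonoid_def zero_prod_def)
next
  case (Suc r)
  have "(l, k, b) + (r * l, r * k, r * b) \<in> S"
    using Suc assms unfolding submonoid_def by blast
  then show ?case by simp
qed

text \<open>The slice of a sum is the average of the slices, weighted by the levels. So all slices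
  stay in the convex hull of the slices of the generators; \<open>no_0\<close> excludes nonzero
  generators of level 0, which would contribute directions at infinity.\<close>

lemma submonoid_hull_slices:
  fixes G :: "(nat \<times> nat \<times> nat) set"
  assumes no_0: "\<And>k b. (0, k, b) \<in> submonoid hull G \<Longrightarrow> k = 0 \<and> b = 0"
    and "(l, k, b) \<in> submonoid hull G" "l > 0"
  shows "(real k / l, real b / l) \<in> convex hull {(real k / l, real b / l) | l k b. (l, k, b) \<in> G \<and> l > 0}"
    (is "_ \<in> ?C")
proof -
  define N :: "(nat \<times> nat \<times> nat) set" where "N = {(l, k, b). (l, k, b) = 0 \<or> l > 0 \<and> (real k / l, real b / l) \<in> ?C}"
  have "submonoid N"
    unfolding submonoid_def
  proof (intro conjI ballI)
    show "0 \<in> N" by (auto simp: N_def zero_prod_def)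
    fix x y assume xy: "x \<in> N" "y \<in> N"
    show "x + y \<in> N"
    proof (cases "x = 0 \<or> y = 0")
      case False
      obtain l k b where x: "x = (l, k, b)" by (cases x)
      obtain l' k' b' where y: "y = (l', k', b')" by (cases y)
      have l: "l > 0" "l' > 0" and C: "(real k / l, real b / l) \<in> ?C" "(real k' / l', real b' / l') \<in> ?C"
        using xy False by (auto simp: N_def x y)
      have "(l / (l + l')) *\<^sub>R (real k / l, real b / l) + (l' / (l + l')) *\<^sub>R (real k' / l', real b' / l') \<in> ?C"
        using l by (intro convexD[OF convex_convex_hull C]) (auto simp flip: add_divide_distrib)
      then have "(real (k + k') / (l + l'), real (b + b') / (l + l')) \<in> ?C"
        using l by (simp add: add_divide_distrib)
      then show ?thesis using l by (simp add: N_def x y)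
    qed (use xy in auto)
  qed
  moreover have "G \<subseteq> N"
  proof
    fix g assume g: "g \<in> G"
    obtain l k b where lkb: "g = (l, k, b)" by (cases g)
    have "g \<in> submonoid hull G" using g by (rule hull_inc)
    then have "l = 0 \<Longrightarrow> g = 0" using no_0 by (auto simp: lkb zero_prod_def)
    moreover have "(real k / l, real b / l) \<in> ?C" if "l > 0"
      using g that by (intro hull_inc) (auto simp: lkb)
    ultimately show "g \<in> N" by (cases "l = 0") (auto simp: N_def lkb)
  qed
  ultimately have "submonoid hull G \<subseteq> N" by (intro hull_minimal)
  then show ?thesis using assms(2,3) by (auto simp: N_def zero_prod_def)
qed

text \<open>The slices of the monoid fill a convex body whose upper boundary over \<open>s\<close> is the height of the
  set of rows of length at least \<open>s\<close>. A point of this boundary over an \<open>s\<close> for which the lowest such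
  row is bounded by the flanks is a convex combination of slices of generators of the same kind. A
  generator of this kind has multiples in which all rows starting from the lowest one are wide enough;
  the flanks exclude this for the row of index \<open>n\<close> above the lowest one.\<close>

lemma not_finitely_generated_if_floors_neg:
  fixes A B c x0 x1 \<epsilon> :: real and n :: int
  assumes "convex Q" "compact Q" and flanked: "flanked Q c x0 x1 A B"
    and widest: "\<And>x x' y. (x, y) \<in> Q \<Longrightarrow> (x', y) \<in> Q \<Longrightarrow> x' - x \<le> x1 - x0"
    and "x0 < x1" "\<epsilon> > 0" and below: "(x0 + A * \<epsilon>, c - \<epsilon>) \<in> Q" "(x1 - B * \<epsilon>, c - \<epsilon>) \<in> Q"
    and n: "n \<ge> 1" "\<lfloor>A * n\<rfloor> + \<lfloor>B * n\<rfloor> < 0"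
    and S_0: "\<And>k b. (0, k, b) \<in> S \<Longrightarrow> k = 0 \<and> b = 0"
    and S_pos: "\<And>l k b. l > 0 \<Longrightarrow> (l, k, b) \<in> S \<longleftrightarrow> b < card (wide_rows_of (scaled_points Q l) k)"
  shows "\<not> finitely_generated S"
proof
  assume "finitely_generated S"
  then obtain G where G: "finite G" "S = submonoid hull G" by (auto simp: finitely_generated_def)
  have "submonoid S" unfolding G(2) by (rule submonoid_hull)
  let ?J = "\<lambda>l k. wide_rows_of (scaled_points Q l) k"
  let ?K = "rows_wide Q"
  define bot top where "bot s = Inf (?K s)" and "top s = Sup (?K s)" for s
  have fin: "finite (?J l k)" if "l > 0" for l k
    using that by (intro finite_wide_rows_of finite_scaled_points compact_imp_bounded assms)
  have K_bounds: "bot s \<le> y" "y \<le> top s" "bot s \<in> ?K s" "top s \<in> ?K s" if "y \<in> ?K s" for y s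
  proof -
    have K: "closed (?K s)" "bdd_below (?K s)" "bdd_above (?K s)"
      using compact_rows_wide[OF assms(2), of s]
      by (auto intro: compact_imp_closed compact_imp_bounded bounded_imp_bdd_below bounded_imp_bdd_above)
    then show "bot s \<le> y" "y \<le> top s" "bot s \<in> ?K s" "top s \<in> ?K s"
      using that unfolding bot_def top_def
      by (auto intro: cInf_lower cSup_upper closed_contains_Inf closed_contains_Sup)
  qed
  have K_convex: "(\<Sum>i\<in>I. u i * y i) \<in> ?K (\<Sum>i\<in>I. u i * s i)"
    if "finite I" "\<And>i. i \<in> I \<Longrightarrow> u i \<ge> 0" "sum u I = 1" "\<And>i. i \<in> I \<Longrightarrow> y i \<in> ?K (s i)"
    for I :: "(real \<times> real) set" and u s y
  proof -
    have "(\<Sum>i\<in>I. u i *\<^sub>R (s i, y i)) \<in> {(s, y). y \<in> ?K s}"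
      using that by (intro convex_sum convex_rows_wide assms) auto
    moreover have "(\<Sum>i\<in>I. u i *\<^sub>R (s i, y i)) = (\<Sum>i\<in>I. u i * s i, \<Sum>i\<in>I. u i * y i)"
      by (simp add: sum_prod)
    ultimately show ?thesis by simp
  qed
  have K_flank: "(A + B) * (c - y) \<le> x1 - x0 - s" if y: "y \<in> ?K s" for y s
  proof -
    obtain x where "(x, y) \<in> Q" "(x + s, y) \<in> Q" using y by (auto simp: rows_wide_def)
    then have "x0 + A * (c - y) \<le> x" "x + s \<le> x1 - B * (c - y)"
      using flanked unfolding flanked_def by auto
    then show ?thesis by (simp add: algebra_simps)
  qed
  have K_J: "of_int j / l \<in> ?K (real k / l)" if "j \<in> ?J l k" for j l k
    using that by (auto simp: wide_rows_of_def scaled_points_def rows_wide_def add_divide_distrib)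
  \<comment> \<open>Row \<open>c - \<epsilon>\<close> reaches from one flank to the other and is not
    longer than row \<open>c\<close>.\<close>
  have AB: "A + B \<ge> 0"
  proof -
    have "x1 - B * \<epsilon> - (x0 + A * \<epsilon>) \<le> x1 - x0" by (rule widest[OF below])
    then have "(A + B) * \<epsilon> \<ge> 0" by (simp add: algebra_simps)
    then show ?thesis using \<open>\<epsilon> > 0\<close> by (simp add: zero_le_mult_iff)
  qed
  obtain s' where s': "s' > 0" "bot s' < c" "(A + B) * (c - bot s') = x1 - x0 - s'" "?K s' \<noteq> {}" "c \<in> ?K s'"
  proof -
    \<comment> \<open>With \<open>\<delta> \<le> \<epsilon>\<close> the row
      \<open>c - \<delta>\<close> still reaches both flanks, and the second bound keeps its length
      \<open>s\<close> at least half of that of row \<open>c\<close>; the summand 1 covers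
      \<open>A + B = 0\<close>. In that case rows of length \<open>s\<close> may also lie lower, so
      the equality on the flanks is stated for \<open>bot s\<close>.\<close>
    define \<delta> where "\<delta> = min \<epsilon> ((x1 - x0) / (2 * (A + B + 1)))"
    have \<delta>: "\<delta> > 0" "\<delta> \<le> \<epsilon>" using AB \<open>\<epsilon> > 0\<close> \<open>x0 < x1\<close> by (auto simp: \<delta>_def)
    define s where "s = x1 - x0 - (A + B) * \<delta>"
    have "(A + B) * \<delta> \<le> (A + B + 1) * ((x1 - x0) / (2 * (A + B + 1)))"
      using AB \<delta> by (intro mult_mono) (auto simp: \<delta>_def)
    also have "\<dots> = (x1 - x0) / 2" using AB by (simp add: field_simps add_nonneg_eq_0_iff)
    also have "\<dots> < x1 - x0" using \<open>x0 < x1\<close> by simp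
    finally have "s > 0" by (simp add: s_def)
    have mem: "(x + (z - x) * (\<delta> / \<epsilon>), c - \<delta>) \<in> Q" if "(x, c) \<in> Q" "(z, c - \<epsilon>) \<in> Q" for x z
    proof -
      have "(1 - \<delta> / \<epsilon>) *\<^sub>R (x, c) + (\<delta> / \<epsilon>) *\<^sub>R (z, c - \<epsilon>) \<in> Q"
        using that \<delta> by (intro convexD[OF assms(1)]) auto
      moreover have "(1 - \<delta> / \<epsilon>) *\<^sub>R (x, c) + (\<delta> / \<epsilon>) *\<^sub>R (z, c - \<epsilon>) = (x + (z - x) * (\<delta> / \<epsilon>), c - \<delta>)"
        using \<open>\<epsilon> > 0\<close> by (simp add: field_simps)
      ultimately show ?thesis by simp
    qed
    have c: "(x0, c) \<in> Q" "(x1, c) \<in> Q" using flanked by (auto simp: flanked_def)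
    have "(x0 + A * \<delta>, c - \<delta>) \<in> Q" "(x1 - B * \<delta>, c - \<delta>) \<in> Q"
      using mem[OF c(1) below(1)] mem[OF c(2) below(2)] \<open>\<epsilon> > 0\<close> by auto
    moreover have "x0 + A * \<delta> + s = x1 - B * \<delta>" by (simp add: s_def algebra_simps)
    ultimately have K: "c - \<delta> \<in> ?K s" unfolding rows_wide_def by auto
    then have "bot s \<le> c - \<delta>" by (rule K_bounds)
    moreover have "(A + B) * (c - bot s) \<le> x1 - x0 - s" using K_flank K_bounds(3)[OF K] by blast
    ultimately have "(A + B) * (c - bot s) = x1 - x0 - s"
      using AB mult_left_mono[of \<delta> "c - bot s" "A + B"] unfolding s_def by linarith
    moreover have "c \<in> ?K s"
    proof -
      have "(x0 + s, c) \<in> Q"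
        using c \<open>s > 0\<close> AB \<delta> by (intro convex_row[OF assms(1) c]) (auto simp: s_def)
      then show ?thesis using c by (auto simp: rows_wide_def)
    qed
    ultimately show thesis using that[of s] \<open>s > 0\<close> \<open>bot s \<le> c - \<delta>\<close> \<delta> K by auto
  qed
  define h where "h = top s' - bot s'"
  have h: "h > 0" using K_bounds(2)[OF s'(5)] s'(2) by (simp add: h_def)
  define X where "X = {(real k / l, real b / l) | l k b. (l, k, b) \<in> G \<and> l > 0}"
  have "finite X"
    unfolding X_def by (rule finite_subset[of _ "(\<lambda>(l, k, b). (real k / l, real b / l)) ` G"]) (use G in force)+
  have "(s', h) \<in> convex hull X"
  proof -
    \<comment> \<open>Elements of the semigroup whose slices tend to the boundary point. The
      subtracted 1 absorbs rounding the left end of a run, the 2 rounding the first and the last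
      row; both disappear in the limit.\<close>
    define k where "k m = nat (\<lfloor>m * s'\<rfloor> - 1)" for m :: nat
    define b where "b m = nat (\<lfloor>m * h\<rfloor> - 2)" for m :: nat
    have in_S: "(m, k m, b m) \<in> S" if m: "m > 0" "m * s' \<ge> 1" "m * h \<ge> 2" for m
    proof -
      have km: "int (k m) = \<lfloor>m * s'\<rfloor> - 1" and bm: "int (b m) = \<lfloor>m * h\<rfloor> - 2"
        using m by (auto simp: k_def b_def le_floor_iff)
      have "{\<lceil>m * bot s'\<rceil>..\<lfloor>m * top s'\<rfloor>} \<subseteq> ?J m (k m)"
      proof
        fix j assume "j \<in> {\<lceil>m * bot s'\<rceil>..\<lfloor>m * top s'\<rfloor>}"
        then have j: "m * bot s' \<le> j" "j \<le> m * top s'" by (auto simp: ceiling_le_iff le_floor_iff)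
        have "bot s' \<le> of_int j / m" "of_int j / m \<le> top s'"
          using j m(1) by (simp_all add: pos_le_divide_eq pos_divide_le_eq mult.commute)
        then have "of_int j / m \<in> ?K s'"
          by (rule rows_wide_between[OF assms(1) K_bounds(3,4)[OF s'(5)]])
        then obtain x where x: "(x, of_int j / m) \<in> Q" "(x + s', of_int j / m) \<in> Q" by (auto simp: rows_wide_def)
        define i where "i = \<lceil>m * x\<rceil>"
        have i: "m * x \<le> i" "i + int (k m) \<le> m * (x + s')"
          unfolding km i_def by (simp_all add: algebra_simps, linarith)
        have "x \<le> i / m" "i / m \<le> x + s'" "x \<le> (i + int (k m)) / m" "(i + int (k m)) / m \<le> x + s'"
          using i m by (simp_all add: field_simps)
        then have "(i / m, j / m) \<in> Q" "((i + int (k m)) / m, j / m) \<in> Q"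
          by (auto intro!: convex_row[OF assms(1) x])
        then show "j \<in> ?J m (k m)" by (auto simp: wide_rows_of_def scaled_points_def)
      qed
      then have "card {\<lceil>m * bot s'\<rceil>..\<lfloor>m * top s'\<rfloor>} \<le> card (?J m (k m))"
        using fin m by (intro card_mono) auto
      moreover have "int (b m) < \<lfloor>m * top s'\<rfloor> - \<lceil>m * bot s'\<rceil> + 1"
      proof -
        have "real m * h = m * top s' - m * bot s'" by (simp add: h_def algebra_simps)
        then show ?thesis unfolding bm by linarith
      qed
      ultimately have "b m < card (?J m (k m))" by simp
      then show ?thesis using S_pos m by blast
    qed
    have lim: "(\<lambda>m. (real (k m) / m, real (b m) / m)) \<longlonglongrightarrow> (s', h)"
    proof -
      have nat_floor: "(\<lambda>m. real (nat (\<lfloor>real m * z\<rfloor> - a)) / m) \<longlonglongrightarrow> z" if "z > 0" for z and a :: int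
      proof (rule tendsto_sandwich)
        show "\<forall>\<^sub>F m in sequentially. z - (\<bar>a\<bar> + 1) / m \<le> real (nat (\<lfloor>real m * z\<rfloor> - a)) / m"
          using eventually_gt_at_top[of 0]
        proof eventually_elim
          case (elim m)
          have "(m * z - (\<bar>a\<bar> + 1)) / m \<le> real (nat (\<lfloor>real m * z\<rfloor> - a)) / m"
            by (intro divide_right_mono) linarith+
          moreover have "(m * z - (\<bar>a\<bar> + 1)) / m = z - (\<bar>a\<bar> + 1) / m"
            using elim by (simp add: diff_divide_distrib)
          ultimately show ?case by simp
        qed
        show "\<forall>\<^sub>F m in sequentially. real (nat (\<lfloor>real m * z\<rfloor> - a)) / m \<le> z + \<bar>a\<bar> / m"
          using eventually_gt_at_top[of 0]
        proof eventually_elim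
          case (elim m)
          have "real m * z > 0" using elim that by simp
          then have "real (nat (\<lfloor>real m * z\<rfloor> - a)) / m \<le> (m * z + \<bar>a\<bar>) / m"
            by (intro divide_right_mono) linarith+
          also have "\<dots> = z + \<bar>a\<bar> / m" using elim by (simp add: add_divide_distrib)
          finally show ?case .
        qed
        show "(\<lambda>m. z - (\<bar>a\<bar> + 1) / real m) \<longlonglongrightarrow> z"
          by (rule tendsto_eq_intros lim_const_over_n refl)+ simp
        show "(\<lambda>m. z + \<bar>a\<bar> / real m) \<longlonglongrightarrow> z"
          by (rule tendsto_eq_intros lim_const_over_n refl)+ simp
      qed
      show ?thesis unfolding k_def b_def using s'(1) h by (intro tendsto_Pair nat_floor)
    qed
    have large: "\<forall>\<^sub>F m in sequentially. m * z \<ge> a" if "z > 0" for a z :: real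
    proof -
      have "\<forall>\<^sub>F m in sequentially. real m \<ge> a / z" 
        using filterlim_real_sequentially unfolding filterlim_at_top by blast
      then show ?thesis by eventually_elim (use that in \<open>simp add: field_simps\<close>)
    qed
    have ev: "\<forall>\<^sub>F m in sequentially. (real (k m) / m, real (b m) / m) \<in> convex hull X"
      using large[OF s'(1), of 1] large[OF h, of 2] eventually_gt_at_top[of 0]
    proof eventually_elim
      case (elim m)
      then have "(m, k m, b m) \<in> submonoid hull G" using in_S G(2) by blast
      then show ?case unfolding X_def
        using elim S_0 by (intro submonoid_hull_slices) (auto simp: G(2))
    qed
    have "closed (convex hull X)"
      using \<open>finite X\<close> finite_imp_compact_convex_hull compact_imp_closed by blast
    then show ?thesis by (rule Lim_in_closed_set[OF _ ev _ lim]) simp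
  qed
  then obtain u where u: "\<And>x. x \<in> X \<Longrightarrow> u x \<ge> 0" "sum u X = 1" "(\<Sum>x\<in>X. u x *\<^sub>R x) = (s', h)"
    by (auto simp: convex_hull_finite[OF \<open>finite X\<close>])
  have u_fst: "(\<Sum>x\<in>X. u x * fst x) = s'" and u_snd: "(\<Sum>x\<in>X. u x * snd x) = h"
    using arg_cong[OF u(3), of fst] arg_cong[OF u(3), of snd] by (simp_all add: fst_sum snd_sum)
  \<comment> \<open>No generator lies above the boundary: \<open>b + 1\<close> distinct rows span a
    height of at least \<open>b\<close>, and after scaling all of them lie between
    \<open>bot\<close> and \<open>top\<close>.\<close>
  have X_rows: "?K (fst x) \<noteq> {} \<and> snd x \<le> top (fst x) - bot (fst x)" if "x \<in> X" for x
  proof -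
    obtain l k b where x: "x = (real k / l, real b / l)" "(l, k, b) \<in> G" "l > 0"
      using \<open>x \<in> X\<close> by (auto simp: X_def)
    have "(l, k, b) \<in> S" unfolding G(2) using x(2) by (rule hull_inc)
    then have b: "b < card (?J l k)" using S_pos x(3) by blast
    then have ne: "?J l k \<noteq> {}" by auto
    have "card (?J l k) \<le> card {Min (?J l k)..Max (?J l k)}" using fin[OF x(3)] by (intro card_mono) auto
    then have "int b \<le> Max (?J l k) - Min (?J l k)" using b by simp
    then have "real b \<le> Max (?J l k) - Min (?J l k)" by linarith
    then have "real b / l \<le> Max (?J l k) / l - Min (?J l k) / l"
      using x(3) by (simp add: field_simps)
    moreover have "Max (?J l k) / l \<in> ?K (k / l)" "Min (?J l k) / l \<in> ?K (k / l)"
      using Max_in[OF fin[OF x(3)] ne] Min_in[OF fin[OF x(3)] ne] by (auto intro!: K_J)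
    ultimately show ?thesis using K_bounds unfolding x by fastforce
  qed
  have bt: "bot (fst x) \<in> ?K (fst x)" "top (fst x) \<in> ?K (fst x)" if "x \<in> X" for x
    using X_rows[OF that] K_bounds(3,4) by blast+
  have bot_sum: "(\<Sum>x\<in>X. u x * bot (fst x)) \<ge> bot s'"
    using K_convex[where s = fst and y = "\<lambda>x. bot (fst x)", OF \<open>finite X\<close> u(1,2) bt(1)] u_fst K_bounds(1) by simp
  have top_sum: "(\<Sum>x\<in>X. u x * top (fst x)) \<le> top s'"
    using K_convex[where s = fst and y = "\<lambda>x. top (fst x)", OF \<open>finite X\<close> u(1,2) bt(2)] u_fst K_bounds(2) by simp
  have gap: "(\<Sum>x\<in>X. u x * (top (fst x) - bot (fst x) - snd x)) =
      (\<Sum>x\<in>X. u x * top (fst x)) - (\<Sum>x\<in>X. u x * bot (fst x)) - h"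
    unfolding u_snd[symmetric] by (simp add: right_diff_distrib sum_subtractf)
  have gap_nonneg: "u x * (top (fst x) - bot (fst x) - snd x) \<ge> 0" if "x \<in> X" for x
    using X_rows[OF that] u(1)[OF that] by simp
  then have "(\<Sum>x\<in>X. u x * (top (fst x) - bot (fst x) - snd x)) \<ge> 0" by (rule sum_nonneg)
  \<comment> \<open>The averages satisfy the convexity estimates for \<open>bot\<close> and
    \<open>top\<close>, and their heights average to the full height \<open>h\<close>. Hence no
    estimate can be strict.\<close>
  then have bot_eq: "(\<Sum>x\<in>X. u x * bot (fst x)) = bot s'"
    and gap_0: "(\<Sum>x\<in>X. u x * (top (fst x) - bot (fst x) - snd x)) = 0"
    using gap bot_sum top_sum by (auto simp: h_def)
  have flank_nonneg: "u x * (x1 - x0 - fst x - (A + B) * (c - bot (fst x))) \<ge> 0" if "x \<in> X" for x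
    using K_flank[OF bt(1)[OF that]] u(1)[OF that] by simp
  \<comment> \<open>Equality on the flanks at \<open>s'\<close> is an average of inequalities for
    the generators, so it passes to every generator of positive weight.\<close>
  have flank_0: "(\<Sum>x\<in>X. u x * (x1 - x0 - fst x - (A + B) * (c - bot (fst x)))) = 0"
  proof -
    have eq: "(\<Sum>x\<in>X. u x * (x1 - x0 - fst x - (A + B) * (c - bot (fst x)))) =
      (x1 - x0 - (A + B) * c) * sum u X - (\<Sum>x\<in>X. u x * fst x) + (A + B) * (\<Sum>x\<in>X. u x * bot (fst x))"
      unfolding sum_distrib_left sum.distrib[symmetric] sum_subtractf[symmetric]
      by (intro sum.cong refl) (simp add: algebra_simps)
    show ?thesis unfolding eq u(2) u_fst bot_eq using s'(3) by (simp add: algebra_simps)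
  qed
  \<comment> \<open>The values of \<open>bot\<close> average to \<open>bot s'\<close>, which is
    below \<open>c\<close>, so they cannot all be at least \<open>c\<close>.\<close>
  have "\<exists>x\<in>X. u x > 0 \<and> bot (fst x) < c"
  proof (rule ccontr)
    assume neg: "\<not> (\<exists>x\<in>X. u x > 0 \<and> bot (fst x) < c)"
    have "u x * c \<le> u x * bot (fst x)" if "x \<in> X" for x
    proof (cases "u x = 0")
      case False
      then have "c \<le> bot (fst x)" using neg that u(1)[OF that] by force
      then show ?thesis using u(1)[OF that] by (rule mult_left_mono)
    qed simp
    then have "(\<Sum>x\<in>X. u x * bot (fst x)) \<ge> (\<Sum>x\<in>X. u x * c)" by (rule sum_mono)
    then show False using s'(2) u(2) by (simp add: bot_eq flip: sum_distrib_right)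
  qed
  then obtain x where x: "x \<in> X" "u x > 0" "bot (fst x) < c" by blast
  have "u x * (top (fst x) - bot (fst x) - snd x) = 0"
    using gap_0 gap_nonneg x(1) \<open>finite X\<close> by (simp add: sum_nonneg_eq_0_iff)
  then have attained: "snd x = top (fst x) - bot (fst x)" using x(2) by simp
  have "u x * (x1 - x0 - fst x - (A + B) * (c - bot (fst x))) = 0"
    using flank_0 flank_nonneg x(1) \<open>finite X\<close> by (simp add: sum_nonneg_eq_0_iff)
  then have tight: "(A + B) * (c - bot (fst x)) = x1 - x0 - fst x" using x(2) by simp
  obtain l k b where lkb: "x = (real k / l, real b / l)" "(l, k, b) \<in> G" "l > 0"
    using x(1) by (auto simp: X_def)
  define s where "s = real k / l"
  have s: "bot s < c" "real b / l = top s - bot s" "(A + B) * (c - bot s) = x1 - x0 - s"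
    "bot s \<in> ?K s" "top s \<in> ?K s"
    using x(3) attained tight bt[OF x(1)] by (auto simp: lkb s_def)
  \<comment> \<open>Multiples of a generator have the same slice; a large one leaves room for
    \<open>n\<close> lattice rows between its lowest row and the longest row.\<close>
  obtain r :: nat where r: "r * (l * (c - bot s)) \<ge> n" "r > 0"
  proof -
    have "l * (c - bot s) > 0" using s lkb by simp
    then obtain r :: nat where "n < r * (l * (c - bot s))" using reals_Archimedean3 by blast
    then show thesis using that[of r] n(1) by (cases "r = 0") auto
  qed
  define N where "N = r * l"
  have N: "N > 0" "real (r * k) / N = s" "real (r * b) / N = top s - bot s" "N * (c - bot s) \<ge> n"
    using r lkb(3) s(2) by (auto simp: N_def s_def field_simps)
  have "(l, k, b) \<in> S" unfolding G(2) using lkb(2) by (rule hull_inc)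
  then have "(N, r * k, r * b) \<in> S" unfolding N_def by (rule submonoid_multiple[OF \<open>submonoid S\<close>])
  then have card_J: "r * b < card (?J N (r * k))" using S_pos N(1) by blast
  let ?R = "?J N (r * k)"
  have ne: "?R \<noteq> {}" using card_J by auto
  have R_K: "of_int j / N \<in> ?K s" if "j \<in> ?R" for j
    using K_J[OF that] N(2) by simp
  define a z where "a = Min ?R" and "z = Max ?R"
  have az: "a \<in> ?R" "z \<in> ?R" using Min_in Max_in fin[OF N(1)] ne by (auto simp: a_def z_def)
  have R_sub: "?R \<subseteq> {a..z}" using fin[OF N(1)] by (auto simp: a_def z_def)
  have a_ge: "N * bot s \<le> a" and z_le: "z \<le> N * top s"
    using K_bounds(1)[OF R_K[OF az(1)]] K_bounds(2)[OF R_K[OF az(2)]] N(1)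
    by (simp_all add: pos_le_divide_eq pos_divide_le_eq mult.commute)
  have "card ?R \<le> card {a..z}" using R_sub by (intro card_mono) auto
  then have "r * b < nat (z - a + 1)" using card_J by simp
  then have za: "int (r * b) \<le> z - a" by linarith
  have rb: "real (r * b) = N * top s - N * bot s" using N(1,3) by (simp add: field_simps)
  \<comment> \<open>At least \<open>r * b + 1\<close> integral row indices fit into an interval of
    length exactly \<open>r * b\<close>, so both of its ends are integers and, as shown next, every
    row in between is wide.\<close>
  have a_eq: "a = N * bot s" and z_eq: "z = N * top s" and za_eq: "z - a = int (r * b)"
    using za a_ge z_le rb by linarith+
  have "card {a..z} = Suc (r * b)" unfolding card_atLeastAtMost_int za_eq by linarith
  then have "?R = {a..z}"
    using R_sub card_J by (intro card_seteq) auto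
  \<comment> \<open>This places row \<open>a + n\<close> among the wide rows, since it is not above
    the longest row.\<close>
  moreover have "c \<le> top s"
  proof -
    have c: "(x0, c) \<in> Q" "(x1, c) \<in> Q" using flanked by (auto simp: flanked_def)
    have "(A + B) * (c - bot s) \<ge> 0" using AB s(1) by simp
    then have "s \<le> x1 - x0" using s(3) by simp
    then have "(x0 + s, c) \<in> Q" by (intro convex_row[OF assms(1) c]) (auto simp: s_def)
    then have "c \<in> ?K s" using c by (auto simp: rows_wide_def)
    then show ?thesis by (rule K_bounds)
  qed
  then have "N * c \<le> N * top s" by (simp add: mult_left_mono)
  then have "a + n \<le> z" using N(4) a_eq z_eq by (simp add: right_diff_distrib)
  ultimately have "a + n \<in> ?R" using n(1) by auto
  then obtain i' where i': "(i' / N, (a + n) / N) \<in> Q" "((i' + int (r * k)) / N, (a + n) / N) \<in> Q"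
    by (auto simp: wide_rows_of_def scaled_points_def)
  obtain i where i: "(i / N, a / N) \<in> Q" "((i + int (r * k)) / N, a / N) \<in> Q"
    using az(1) by (auto simp: wide_rows_of_def scaled_points_def)
  have rk: "real (r * k) = N * s" using N(1,2) by (simp add: field_simps)
  have flank: "N * x0 + A * (N * c - y) \<le> x \<and> x \<le> N * x1 - B * (N * c - y)"
    if "(x / N, y / N) \<in> Q" for x y
  proof -
    have le: "x0 + A * (c - y / N) \<le> x / N" "x / N \<le> x1 - B * (c - y / N)"
      using flanked that unfolding flanked_def by auto
    have "N * (x0 + A * (c - y / N)) \<le> N * (x / N)" "N * (x / N) \<le> N * (x1 - B * (c - y / N))"
      by (rule mult_left_mono[OF le(1)], simp, rule mult_left_mono[OF le(2)], simp)
    moreover have "N * (x0 + A * (c - y / N)) = N * x0 + A * (N * c - y)"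
      "N * (x1 - B * (c - y / N)) = N * x1 - B * (N * c - y)" "N * (x / N) = x"
      using N(1) by (simp_all add: field_simps)
    ultimately show ?thesis by simp
  qed
  have 1: "N * x0 + A * (N * c - a) \<le> i" "i + r * k \<le> N * x1 - B * (N * c - a)"
    using flank[of i a] flank[of "i + int (r * k)" a] i by auto
  have 2: "N * x0 + A * (N * c - (a + n)) \<le> i'" "i' + r * k \<le> N * x1 - B * (N * c - (a + n))"
    using flank[of i' "a + n"] flank[of "i' + int (r * k)" "a + n"] i' by auto
  \<comment> \<open>Tightness says that the two flanks in row \<open>a\<close> are exactly
    \<open>r * k\<close> apart, so the run there touches both. A run in row \<open>a + n\<close> is
    then shifted by an integer between \<open>- A * n\<close> and \<open>B * n\<close>, which the
    floors forbid.\<close>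
  have "N * ((A + B) * (c - bot s)) = N * (x1 - x0 - s)" using s(3) by simp
  then have 3: "A * (N * c - a) + B * (N * c - a) = N * x1 - N * x0 - r * k"
    unfolding rk a_eq by (simp add: algebra_simps)
  have "i - i' \<le> A * n" "i' - i \<le> B * n"
    using 1 2 3 by (simp_all add: algebra_simps)
  then have "i - i' \<le> \<lfloor>A * n\<rfloor>" "i' - i \<le> \<lfloor>B * n\<rfloor>" by (auto simp: le_floor_iff)
  then show False using n(2) by linarith
qed

section \<open>Smooth complete fans\<close>

lemma inner_of_lattice: "of_lattice m \<bullet> of_lattice u = real_of_int (pairing m u)"
  by (simp add: of_lattice_def pairing_def)

lemma of_lattice_add: "of_lattice (m + m') = of_lattice m + of_lattice m'"
  by (simp add: of_lattice_def)

lemma of_lattice_uminus: "of_lattice (- m) = - of_lattice m"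
  by (simp add: of_lattice_def)

lemma of_lattice_zero [simp]: "of_lattice 0 = 0"
  by (simp add: of_lattice_def zero_prod_def)

lemma of_lattice_eq_iff [simp]: "of_lattice m = of_lattice m' \<longleftrightarrow> m = m'"
  by (auto simp: of_lattice_def prod_eq_iff)

lemma pairing_add_right: "pairing m (u + u') = pairing m u + pairing m u'"
  by (simp add: pairing_def algebra_simps)

section \<open>Smooth cones in dual coordinates\<close>

definition dual_bases :: "int \<times> int \<Rightarrow> int \<times> int \<Rightarrow> int \<times> int \<Rightarrow> int \<times> int \<Rightarrow> bool" where
  "dual_bases u w f g \<longleftrightarrow> pairing f u = 1 \<and> pairing f w = 0 \<and> pairing g u = 0 \<and> pairing g w = 1 \<and>
     (\<forall>z. z = (of_lattice f \<bullet> z) *\<^sub>R of_lattice u + (of_lattice g \<bullet> z) *\<^sub>R of_lattice w)"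

text \<open>The coordinates of the unit vectors in the basis form a left inverse of the matrix with
  rows \<open>u\<close> and \<open>w\<close>. As the determinant is nonzero it is also a right
  inverse, and its columns are the dual basis.\<close>

lemma lattice_basis_dual:
  assumes "lattice_basis u w"
  obtains f g where "dual_bases u w f g"
proof -
  obtain i j where ij: "i * fst u + j * fst w = 1" "i * snd u + j * snd w = 0"
    using assms unfolding lattice_basis_def by (metis prod.inject)
  obtain i' j' where ij': "i' * fst u + j' * fst w = 0" "i' * snd u + j' * snd w = 1"
    using assms unfolding lattice_basis_def by (metis prod.inject)
  let ?\<Delta> = "fst u * snd w - snd u * fst w"
  have "(i * j' - j * i') * ?\<Delta> = (i * fst u + j * fst w) * (i' * snd u + j' * snd w)
      - (i * snd u + j * snd w) * (i' * fst u + j' * fst w)" by (simp add: algebra_simps)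
  then have "(i * j' - j * i') * ?\<Delta> = 1" using ij ij' by simp
  then have nz: "?\<Delta> \<noteq> 0" by auto
  have "i * ?\<Delta> = (i * fst u + j * fst w) * snd w - (i * snd u + j * snd w) * fst w"
    "j * ?\<Delta> = (i * snd u + j * snd w) * fst u - (i * fst u + j * fst w) * snd u"
    "i' * ?\<Delta> = (i' * fst u + j' * fst w) * snd w - (i' * snd u + j' * snd w) * fst w"
    "j' * ?\<Delta> = (i' * snd u + j' * snd w) * fst u - (i' * fst u + j' * fst w) * snd u"
    by (simp_all add: algebra_simps)
  then have \<Delta>: "i * ?\<Delta> = snd w" "j * ?\<Delta> = - snd u" "i' * ?\<Delta> = - fst w" "j' * ?\<Delta> = fst u"
    unfolding ij ij' by simp_all
  have "(i * fst u + i' * snd u) * ?\<Delta> = (i * ?\<Delta>) * fst u + (i' * ?\<Delta>) * snd u"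
    "(i * fst w + i' * snd w) * ?\<Delta> = (i * ?\<Delta>) * fst w + (i' * ?\<Delta>) * snd w"
    "(j * fst u + j' * snd u) * ?\<Delta> = (j * ?\<Delta>) * fst u + (j' * ?\<Delta>) * snd u"
    "(j * fst w + j' * snd w) * ?\<Delta> = (j * ?\<Delta>) * fst w + (j' * ?\<Delta>) * snd w"
    by (simp_all add: algebra_simps)
  then have "(i * fst u + i' * snd u) * ?\<Delta> = 1 * ?\<Delta>" "(i * fst w + i' * snd w) * ?\<Delta> = 0 * ?\<Delta>"
    "(j * fst u + j' * snd u) * ?\<Delta> = 0 * ?\<Delta>" "(j * fst w + j' * snd w) * ?\<Delta> = 1 * ?\<Delta>"
    unfolding \<Delta> by (simp_all add: algebra_simps)
  then have dual: "i * fst u + i' * snd u = 1" "i * fst w + i' * snd w = 0"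
    "j * fst u + j' * snd u = 0" "j * fst w + j' * snd w = 1"
    using nz unfolding mult_cancel_right by auto
  have rep: "z = (of_lattice (i, i') \<bullet> z) *\<^sub>R of_lattice u + (of_lattice (j, j') \<bullet> z) *\<^sub>R of_lattice w" for z
  proof -
    obtain x y where z: "z = (x, y)" by (cases z)
    have "(i * x + i' * y) * fst u + (j * x + j' * y) * fst w
        = x * of_int (i * fst u + j * fst w) + y * of_int (i' * fst u + j' * fst w)"
      "(i * x + i' * y) * snd u + (j * x + j' * y) * snd w
        = x * of_int (i * snd u + j * snd w) + y * of_int (i' * snd u + j' * snd w)"
      by (simp_all add: algebra_simps)
    then show ?thesis unfolding ij ij' by (simp add: z of_lattice_def)
  qed
  show thesis
    by (rule that[of "(i, i')" "(j, j')"]) (use dual rep in \<open>auto simp: dual_bases_def pairing_def\<close>)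
qed

lemma dual_bases_rep:
  "dual_bases u w f g \<Longrightarrow> z = (of_lattice f \<bullet> z) *\<^sub>R of_lattice u + (of_lattice g \<bullet> z) *\<^sub>R of_lattice w"
  unfolding dual_bases_def by blast

lemma convex_coneI:
  fixes S :: "'a::real_vector set"
  assumes "0 \<in> S" "\<And>x y. x \<in> S \<Longrightarrow> y \<in> S \<Longrightarrow> x + y \<in> S" "\<And>x c. x \<in> S \<Longrightarrow> c \<ge> 0 \<Longrightarrow> c *\<^sub>R x \<in> S"
  shows "convex_cone S"
  using assms by (simp add: convex_cone_iff)

lemma cone_over_singleton: "cone_over {u} = {t *\<^sub>R of_lattice u | t. t \<ge> 0}"
proof (intro equalityI)
  have "convex_cone {t *\<^sub>R of_lattice u | t. t \<ge> 0}"
  proof (rule convex_coneI)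
    fix x y assume "x \<in> {t *\<^sub>R of_lattice u | t. t \<ge> 0}" "y \<in> {t *\<^sub>R of_lattice u | t. t \<ge> 0}"
    then show "x + y \<in> {t *\<^sub>R of_lattice u | t. t \<ge> 0}"
      by clarify (metis add_nonneg_nonneg scaleR_add_left)
  next
    fix x and c :: real assume "x \<in> {t *\<^sub>R of_lattice u | t. t \<ge> 0}" "c \<ge> 0"
    then show "c *\<^sub>R x \<in> {t *\<^sub>R of_lattice u | t. t \<ge> 0}"
      by clarify (metis mult_nonneg_nonneg scaleR_scaleR)
  qed (auto intro!: exI[of _ 0])
  moreover have "of_lattice u \<in> {t *\<^sub>R of_lattice u | t. t \<ge> 0}" by (auto intro!: exI[of _ 1])
  ultimately show "cone_over {u} \<subseteq> {t *\<^sub>R of_lattice u | t. t \<ge> 0}"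
    unfolding cone_over_def by (intro hull_minimal) auto
  show "{t *\<^sub>R of_lattice u | t. t \<ge> 0} \<subseteq> cone_over {u}"
    unfolding cone_over_def by (auto intro!: convex_cone_hull_mul[OF hull_inc])
qed

lemma cone_over_subbasis:
  assumes uw: "dual_bases u w f g" and B: "B \<subseteq> {u, w}"
  shows "z \<in> cone_over B \<longleftrightarrow> of_lattice f \<bullet> z \<ge> 0 \<and> of_lattice g \<bullet> z \<ge> 0 \<and>
    (u \<notin> B \<longrightarrow> of_lattice f \<bullet> z = 0) \<and> (w \<notin> B \<longrightarrow> of_lattice g \<bullet> z = 0)"
    (is "_ \<longleftrightarrow> ?C z")
proof
  have uw_coords: "of_lattice f \<bullet> of_lattice u = 1" "of_lattice f \<bullet> of_lattice w = 0"
    "of_lattice g \<bullet> of_lattice u = 0" "of_lattice g \<bullet> of_lattice w = 1"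
    using uw by (simp_all add: dual_bases_def inner_of_lattice)
  have "convex_cone {z. ?C z}"
    by (rule convex_coneI) (auto simp: inner_add_right)
  moreover have "of_lattice ` B \<subseteq> {z. ?C z}"
    using B uw_coords by auto
  ultimately have "cone_over B \<subseteq> {z. ?C z}"
    unfolding cone_over_def by (intro hull_minimal)
  then show "z \<in> cone_over B \<Longrightarrow> ?C z" by auto
next
  assume C: "?C z"
  have mem: "x *\<^sub>R of_lattice b \<in> cone_over B" if "x \<ge> 0" "b \<notin> B \<Longrightarrow> x = 0" for x b
  proof (cases "b \<in> B")
    case True
    then show ?thesis using that unfolding cone_over_def by (intro convex_cone_hull_mul hull_inc) auto
  next
    case False
    then show ?thesis using that(2) by (simp add: cone_over_def convex_cone_hull_contains_0)
  qed
  have "(of_lattice f \<bullet> z) *\<^sub>R of_lattice u + (of_lattice g \<bullet> z) *\<^sub>R of_lattice w \<in> cone_over B"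
    using C mem[of "of_lattice f \<bullet> z" u] mem[of "of_lattice g \<bullet> z" w]
    unfolding cone_over_def by (intro convex_cone_hull_add) auto
  then show "z \<in> cone_over B" using dual_bases_rep[OF uw, of z] by simp
qed

context
  fixes \<Sigma>
  assumes fan: "smooth_complete_fan \<Sigma>"
begin

lemma smooth_coneE:
  assumes "\<sigma> \<in> \<Sigma>"
  obtains u w f g B where "dual_bases u w f g" "B \<subseteq> {u, w}" "\<sigma> = cone_over B"
proof -
  have "smooth_cone \<sigma>" using fan assms by (simp add: smooth_complete_fan_def)
  then obtain u w B where "lattice_basis u w" "B \<subseteq> {u, w}" "\<sigma> = cone_over B"
    unfolding smooth_cone_def by blast
  then show thesis using that lattice_basis_dual by metis
qed

lemma face_in_fan: "\<sigma> \<in> \<Sigma> \<Longrightarrow> \<tau> face_of \<sigma> \<Longrightarrow> \<tau> \<noteq> {} \<Longrightarrow> \<tau> \<in> \<Sigma>"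
  using fan by (simp add: smooth_complete_fan_def complete_fan_def fan_def)

lemma fan_covers: obtains \<sigma> where "\<sigma> \<in> \<Sigma>" "z \<in> \<sigma>"
  using fan unfolding smooth_complete_fan_def complete_fan_def by blast

lemma dual_bases_swap: "dual_bases u w f g \<Longrightarrow> dual_bases w u g f"
  by (simp add: dual_bases_def add.commute)

text \<open>A generator is primitive because a dual vector takes the value 1 on it, and its ray is
  the face on which the other dual vector vanishes.\<close>

lemma generator_is_ray:
  assumes "\<sigma> \<in> \<Sigma>" "dual_bases u w f g" "B \<subseteq> {u, w}" "\<sigma> = cone_over B" "b \<in> B"
  shows "b \<in> rays \<Sigma>"
proof -
  have "u \<in> rays \<Sigma>" if uw: "dual_bases u w f g" and B: "B \<subseteq> {u, w}" "u \<in> B" for u w f g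
  proof -
    have "coprime (fst u) (snd u)"
    proof (rule coprimeI)
      fix c assume "c dvd fst u" "c dvd snd u"
      then have "c dvd pairing f u" by (simp add: pairing_def)
      then show "is_unit c" using uw by (simp add: dual_bases_def)
    qed
    moreover have "cone_over {u} \<in> \<Sigma>"
    proof (rule face_in_fan[OF assms(1)])
      have "w \<noteq> u" using uw by (auto simp: dual_bases_def)
      then have "cone_over {u} = \<sigma> \<inter> {z. of_lattice g \<bullet> z = 0}"
        using cone_over_subbasis[OF uw, of "{u}"] cone_over_subbasis[OF uw B(1)] B(2)
        by (auto simp: assms(4))
      moreover have "convex \<sigma>" by (simp add: assms(4) cone_over_def convex_convex_cone_hull)
      ultimately show "cone_over {u} face_of \<sigma>"
        using cone_over_subbasis[OF uw B(1)]
        by (auto intro!: face_of_Int_supporting_hyperplane_ge simp: assms(4))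
      show "cone_over {u} \<noteq> {}" by (simp add: cone_over_def convex_cone_hull_nonempty)
    qed
    ultimately show ?thesis by (simp add: rays_def primitive_def)
  qed
  from this[OF assms(2)] this[OF dual_bases_swap[OF assms(2)]] show ?thesis
    using assms(3,5) by auto
qed

text \<open>The sum of the dual vectors is positive on a smooth cone away from the origin, so it
  cuts out the face \<open>{0}\<close>.\<close>

lemma zero_cone_in_fan: "{0} \<in> \<Sigma>"
proof -
  obtain \<sigma> where \<sigma>: "\<sigma> \<in> \<Sigma>" using fan_covers by blast
  then obtain u w f g B where uw: "dual_bases u w f g" and B: "B \<subseteq> {u, w}" "\<sigma> = cone_over B"
    by (rule smooth_coneE)
  have "{0} = \<sigma> \<inter> {z. of_lattice (f + g) \<bullet> z = 0}"
  proof (intro equalityI subsetI)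
    fix z assume z: "z \<in> \<sigma> \<inter> {z. of_lattice (f + g) \<bullet> z = 0}"
    then have "of_lattice f \<bullet> z = 0" "of_lattice g \<bullet> z = 0"
      using cone_over_subbasis[OF uw B(1), of z] by (auto simp: B(2) of_lattice_add inner_add_left)
    then have "z = 0" using dual_bases_rep[OF uw, of z] by simp
    then show "z \<in> {0}" by simp
  qed (simp add: B(2) cone_over_def convex_cone_hull_contains_0)
  moreover have "convex \<sigma>" by (simp add: B(2) cone_over_def convex_convex_cone_hull)
  then have "\<sigma> \<inter> {z. of_lattice (f + g) \<bullet> z = 0} face_of \<sigma>"
    using cone_over_subbasis[OF uw B(1)]
    by (intro face_of_Int_supporting_hyperplane_ge) (simp_all add: B(2) of_lattice_add inner_add_left)
  ultimately have "{0} face_of \<sigma>" by simp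
  then show ?thesis by (rule face_in_fan[OF \<sigma>]) simp
qed

text \<open>A ray of the fan contained in \<open>\<sigma>\<close> is a face of it. If both
  coordinates of \<open>\<rho>\<close> were positive, \<open>\<rho>\<close> would be the midpoint of
  points on the two generating rays, and the face would have to contain these. Primitivity then
  fixes the scale.\<close>

lemma ray_in_cone_is_generator:
  assumes "\<sigma> \<in> \<Sigma>" and uw: "dual_bases u w f g" and B: "B \<subseteq> {u, w}" "\<sigma> = cone_over B"
    and "\<rho> \<in> rays \<Sigma>" "of_lattice \<rho> \<in> \<sigma>"
  shows "\<rho> \<in> B"
proof -
  have \<rho>: "cone_over {\<rho>} \<in> \<Sigma>" "coprime (fst \<rho>) (snd \<rho>)" using assms(5) by (auto simp: rays_def primitive_def)
  have "cone_over {\<rho>} \<subseteq> \<sigma>"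
    using assms(6) unfolding B(2) cone_over_def
    by (intro hull_minimal convex_cone_convex_cone_hull) auto
  then have "cone_over {\<rho>} \<inter> \<sigma> = cone_over {\<rho>}" by blast
  moreover have "cone_over {\<rho>} \<inter> \<sigma> face_of \<sigma>"
    using fan \<rho>(1) assms(1) unfolding smooth_complete_fan_def complete_fan_def fan_def by blast
  ultimately have face: "cone_over {\<rho>} face_of \<sigma>" by simp
  define x y where "x = pairing f \<rho>" and "y = pairing g \<rho>"
  have xy: "x \<ge> 0" "y \<ge> 0" "u \<notin> B \<Longrightarrow> x = 0" "w \<notin> B \<Longrightarrow> y = 0"
    using cone_over_subbasis[OF uw B(1), of "of_lattice \<rho>"] assms(6)
    by (auto simp: B(2) inner_of_lattice x_def y_def)
  have rep: "of_lattice \<rho> = x *\<^sub>R of_lattice u + y *\<^sub>R of_lattice w"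
    using dual_bases_rep[OF uw, of "of_lattice \<rho>"] by (simp add: inner_of_lattice x_def y_def)
  have xy_0: "x = 0 \<or> y = 0"
  proof (rule ccontr)
    assume "\<not> ?thesis"
    then have pos: "x > 0" "y > 0" "u \<in> B" "w \<in> B" using xy by auto
    let ?p = "(2 * x) *\<^sub>R of_lattice u" and ?q = "(2 * y) *\<^sub>R of_lattice w"
    have mem: "?p \<in> \<sigma>" "?q \<in> \<sigma>"
      using pos unfolding B(2) cone_over_def by (auto intro!: convex_cone_hull_mul[OF hull_inc])
    have coords: "of_lattice g \<bullet> ?p = 0" "of_lattice f \<bullet> ?p = 2 * x" "of_lattice g \<bullet> ?q = 2 * y"
      "of_lattice g \<bullet> of_lattice \<rho> = y"
      using uw by (auto simp: dual_bases_def inner_of_lattice y_def)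
    have "of_lattice g \<bullet> ?p \<noteq> of_lattice g \<bullet> ?q" unfolding coords using pos by simp
    then have "?p \<noteq> ?q" by metis
    moreover have "of_lattice \<rho> = (1 - 1/2) *\<^sub>R ?p + (1/2) *\<^sub>R ?q" by (simp add: rep)
    ultimately have "of_lattice \<rho> \<in> open_segment ?p ?q"
      unfolding in_segment by (intro conjI exI[of _ "1/2"]) auto
    moreover have "of_lattice \<rho> \<in> cone_over {\<rho>}" unfolding cone_over_singleton by (auto intro!: exI[of _ 1])
    ultimately have "?p \<in> cone_over {\<rho>}" using face mem unfolding face_of_def by blast
    then obtain t where t: "?p = t *\<^sub>R of_lattice \<rho>" by (auto simp: cone_over_singleton)
    then have "0 = t * y" using coords by (metis inner_scaleR_right)
    then have "?p = 0" using t pos by simp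
    then show False using coords(2) pos by simp
  qed
  have primitive: "\<rho> = b" if "of_lattice \<rho> = n *\<^sub>R of_lattice b" "n \<ge> 0" for n :: int and b
  proof -
    have \<rho>b: "fst \<rho> = n * fst b" "snd \<rho> = n * snd b"
      using that by (auto simp: of_lattice_def simp flip: of_int_mult)
    then have "n dvd 1" using \<rho>(2) by (metis coprime_def dvd_triv_left)
    then have "n = 1" using that(2) by simp
    then show ?thesis using \<rho>b by (simp add: prod_eq_iff)
  qed
  have "\<rho> \<noteq> 0" using \<rho>(2) by auto
  then have nz: "x \<noteq> 0 \<or> y \<noteq> 0" using rep of_lattice_eq_iff[of \<rho> 0] by auto
  show ?thesis
  proof (cases "y = 0")
    case True
    then have "\<rho> = u" using rep xy(1) by (intro primitive[of x]) simp_all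
    then show ?thesis using True nz xy(3) by blast
  next
    case False
    then have "\<rho> = w" using rep xy(2) xy_0 by (intro primitive[of y]) simp_all
    then show ?thesis using False xy(4) by blast
  qed
qed

lemma finite_rays: "finite (rays \<Sigma>)"
proof (rule finite_subset)
  show "rays \<Sigma> \<subseteq> (\<Union>\<sigma>\<in>\<Sigma>. {\<rho>\<in>rays \<Sigma>. of_lattice \<rho> \<in> \<sigma>})"
    using fan_covers by blast
  have "finite {\<rho>\<in>rays \<Sigma>. of_lattice \<rho> \<in> \<sigma>}" if \<sigma>: "\<sigma> \<in> \<Sigma>" for \<sigma>
  proof -
    obtain u w f g B where "dual_bases u w f g" "B \<subseteq> {u, w}" "\<sigma> = cone_over B"
      using \<sigma> by (rule smooth_coneE)
    then have "{\<rho>\<in>rays \<Sigma>. of_lattice \<rho> \<in> \<sigma>} \<subseteq> {u, w}"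
      using ray_in_cone_is_generator[OF \<sigma>] by blast
    then show ?thesis by (rule finite_subset) simp
  qed
  then show "finite (\<Union>\<sigma>\<in>\<Sigma>. {\<rho>\<in>rays \<Sigma>. of_lattice \<rho> \<in> \<sigma>})"
    using fan by (simp add: smooth_complete_fan_def complete_fan_def fan_def)
qed

section \<open>Sections and the polytope of a divisor\<close>

text \<open>Smoothness makes the divisor Cartier: prescribed integral values on the generators are
  interpolated by the dual basis.\<close>

lemma chart_exponent_exists:
  assumes "\<sigma> \<in> \<Sigma>"
  obtains m where "chart_exponent \<Sigma> a \<sigma> m"
proof -
  obtain u w f g B where uw: "dual_bases u w f g" and B: "B \<subseteq> {u, w}" "\<sigma> = cone_over B"
    using assms by (rule smooth_coneE)
  define m where "m = (a u * fst f + a w * fst g, a u * snd f + a w * snd g)"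
  have "pairing m x = a u * pairing f x + a w * pairing g x" for x
    by (simp add: m_def pairing_def algebra_simps)
  then have "pairing m u = a u" "pairing m w = a w" using uw by (auto simp: dual_bases_def)
  then have "chart_exponent \<Sigma> a \<sigma> m"
    using ray_in_cone_is_generator[OF assms uw B] B(1) by (auto simp: chart_exponent_def)
  then show thesis by (rule that)
qed

text \<open>The chart of a single ray yields the inequality of that ray. Conversely, a cone of the
  fan is spanned by rays, so nonnegativity on its generators gives regularity on its chart.\<close>

lemma sections_eq: "sections \<Sigma> a = {s. Poly_Mapping.keys s \<subseteq> {m. of_lattice m \<in> polytope_of \<Sigma> a}}"
proof (intro equalityI subsetI)
  fix s :: laurent assume s: "s \<in> sections \<Sigma> a"
  show "s \<in> {s. Poly_Mapping.keys s \<subseteq> {m. of_lattice m \<in> polytope_of \<Sigma> a}}"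
  proof (rule CollectI, rule subsetI)
    fix m' assume m': "m' \<in> Poly_Mapping.keys s"
    have "of_lattice m' \<bullet> of_lattice \<rho> \<ge> - real_of_int (a \<rho>)" if \<rho>: "\<rho> \<in> rays \<Sigma>" for \<rho>
    proof -
      have mem: "of_lattice \<rho> \<in> cone_over {\<rho>}" by (auto simp: cone_over_def intro: hull_inc)
      have "cone_over {\<rho>} \<in> \<Sigma>" using \<rho> by (simp add: rays_def)
      then obtain m where m: "chart_exponent \<Sigma> a (cone_over {\<rho>}) m" "chi m * s \<in> coord_ring (cone_over {\<rho>})"
        using s unfolding sections_def by blast
      have "pairing m \<rho> = a \<rho>" using m(1) \<rho> mem by (simp add: chart_exponent_def)
      have "m + m' \<in> Poly_Mapping.keys (chi m * s)" unfolding chi_def keys_single_times using m' by simp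
      then have "m + m' \<in> dual_monoid (cone_over {\<rho>})" using m(2) by (auto simp: coord_ring_def)
      then have "of_lattice (m + m') \<bullet> of_lattice \<rho> \<ge> 0" using mem by (auto simp: dual_monoid_def)
      then show ?thesis
        using \<open>pairing m \<rho> = a \<rho>\<close> by (simp add: of_lattice_add inner_add_left inner_of_lattice)
    qed
    then show "m' \<in> {m. of_lattice m \<in> polytope_of \<Sigma> a}" by (simp add: polytope_of_def)
  qed
next
  fix s :: laurent assume "s \<in> {s. Poly_Mapping.keys s \<subseteq> {m. of_lattice m \<in> polytope_of \<Sigma> a}}"
  then have s: "\<And>m' \<rho>. m' \<in> Poly_Mapping.keys s \<Longrightarrow> \<rho> \<in> rays \<Sigma> \<Longrightarrow> pairing m' \<rho> \<ge> - a \<rho>"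
    by (fastforce simp: polytope_of_def inner_of_lattice)
  show "s \<in> sections \<Sigma> a"
    unfolding sections_def mem_Collect_eq
  proof
    fix \<sigma> assume \<sigma>: "\<sigma> \<in> \<Sigma>"
    obtain u w f g B where uw: "dual_bases u w f g" and B: "B \<subseteq> {u, w}" "\<sigma> = cone_over B"
      using \<sigma> by (rule smooth_coneE)
    obtain m where m: "chart_exponent \<Sigma> a \<sigma> m" using \<sigma> by (rule chart_exponent_exists)
    have "m + m' \<in> dual_monoid \<sigma>" if m': "m' \<in> Poly_Mapping.keys s" for m'
      unfolding dual_monoid_def mem_Collect_eq
    proof
      fix z assume z: "z \<in> \<sigma>"
      have pos: "of_lattice (m + m') \<bullet> of_lattice b \<ge> 0" if "b \<in> B" for b
      proof -
        have "b \<in> rays \<Sigma>" using generator_is_ray[OF \<sigma> uw B that] .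
        moreover have "of_lattice b \<in> \<sigma>" unfolding B(2) cone_over_def using that by (intro hull_inc) auto
        ultimately have "pairing m b = a b" "pairing m' b \<ge> - a b"
          using m s[OF m'] by (auto simp: chart_exponent_def)
        then show ?thesis by (simp add: of_lattice_add inner_add_left inner_of_lattice flip: of_int_add)
      qed
      have coords: "of_lattice f \<bullet> z \<ge> 0" "of_lattice g \<bullet> z \<ge> 0" "u \<notin> B \<Longrightarrow> of_lattice f \<bullet> z = 0"
          "w \<notin> B \<Longrightarrow> of_lattice g \<bullet> z = 0"
        using z cone_over_subbasis[OF uw B(1), of z] by (auto simp: B(2))
      have "z = (of_lattice f \<bullet> z) *\<^sub>R of_lattice u + (of_lattice g \<bullet> z) *\<^sub>R of_lattice w"
        by (rule dual_bases_rep[OF uw])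
      then have "of_lattice (m + m') \<bullet> z = (of_lattice f \<bullet> z) * (of_lattice (m + m') \<bullet> of_lattice u)
          + (of_lattice g \<bullet> z) * (of_lattice (m + m') \<bullet> of_lattice w)"
        by (metis inner_add_right inner_scaleR_right)
      moreover have "(of_lattice f \<bullet> z) * (of_lattice (m + m') \<bullet> of_lattice u) \<ge> 0"
        using coords pos[of u] by (cases "u \<in> B") auto
      moreover have "(of_lattice g \<bullet> z) * (of_lattice (m + m') \<bullet> of_lattice w) \<ge> 0"
        using coords pos[of w] by (cases "w \<in> B") auto
      ultimately show "of_lattice (m + m') \<bullet> z \<ge> 0" by simp
    qed
    then have "chi m * s \<in> coord_ring \<sigma>" by (auto simp: coord_ring_def chi_def keys_single_times)
    then show "\<exists>m. chart_exponent \<Sigma> a \<sigma> m \<and> chi m * s \<in> coord_ring \<sigma>" using m by blast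
  qed
qed

text \<open>By completeness \<open>z\<close> is a nonnegative combination of rays, and adding up
  their inequalities bounds the inner product. The factor \<open>K\<close> is kept apart so that
  \<open>K = 0\<close> also settles the zero divisor.\<close>

lemma polytope_inner_bound:
  obtains C :: real where "\<And>m a. (\<And>\<rho>. \<rho> \<in> rays \<Sigma> \<Longrightarrow> \<bar>real_of_int (a \<rho>)\<bar> \<le> K) \<Longrightarrow> m \<in> polytope_of \<Sigma> a \<Longrightarrow> m \<bullet> z \<ge> - C * K"
proof -
  obtain \<sigma> where \<sigma>: "\<sigma> \<in> \<Sigma>" "z \<in> \<sigma>" using fan_covers by blast
  obtain u w f g B where uw: "dual_bases u w f g" and B: "B \<subseteq> {u, w}" "\<sigma> = cone_over B"
    using \<sigma>(1) by (rule smooth_coneE)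
  define x y where "x = of_lattice f \<bullet> z" and "y = of_lattice g \<bullet> z"
  have coords: "x \<ge> 0" "y \<ge> 0" "u \<notin> B \<Longrightarrow> x = 0" "w \<notin> B \<Longrightarrow> y = 0"
    using \<sigma>(2) cone_over_subbasis[OF uw B(1), of z] by (auto simp: B(2) x_def y_def)
  have z: "z = x *\<^sub>R of_lattice u + y *\<^sub>R of_lattice w"
    unfolding x_def y_def by (rule dual_bases_rep[OF uw])
  have "m \<bullet> z \<ge> - (x + y) * K"
    if K: "\<And>\<rho>. \<rho> \<in> rays \<Sigma> \<Longrightarrow> \<bar>real_of_int (a \<rho>)\<bar> \<le> K" and m: "m \<in> polytope_of \<Sigma> a" for m a
  proof -
    have le: "m \<bullet> of_lattice b \<ge> - K" if "b \<in> B" for b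
      using generator_is_ray[OF \<sigma>(1) uw B that] m K[of b] by (fastforce simp: polytope_of_def)
    have "x * (m \<bullet> of_lattice u) \<ge> x * - K"
      using coords le[of u] mult_left_mono[of "- K" "m \<bullet> of_lattice u" x] by (cases "u \<in> B") auto
    moreover have "y * (m \<bullet> of_lattice w) \<ge> y * - K"
      using coords le[of w] mult_left_mono[of "- K" "m \<bullet> of_lattice w" y] by (cases "w \<in> B") auto
    ultimately show ?thesis by (simp add: z inner_add_right algebra_simps)
  qed
  then show thesis by (rule that)
qed

lemma bounded_polytope: "bounded (polytope_of \<Sigma> a)"
proof -
  define K where "K = (\<Sum>\<rho>\<in>rays \<Sigma>. \<bar>real_of_int (a \<rho>)\<bar>)"
  have K: "\<bar>real_of_int (a \<rho>)\<bar> \<le> K" if "\<rho> \<in> rays \<Sigma>" for \<rho>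
    using that finite_rays unfolding K_def by (intro member_le_sum) auto
  have lower: "\<exists>C. \<forall>m\<in>polytope_of \<Sigma> a. m \<bullet> z \<ge> C" for z
    using polytope_inner_bound[of K z] K by metis
  obtain C1 C2 C3 C4 where C: "\<forall>m\<in>polytope_of \<Sigma> a. m \<bullet> (1, 0) \<ge> C1" "\<forall>m\<in>polytope_of \<Sigma> a. m \<bullet> (0, 1) \<ge> C2"
    "\<forall>m\<in>polytope_of \<Sigma> a. m \<bullet> (-1, 0) \<ge> C3" "\<forall>m\<in>polytope_of \<Sigma> a. m \<bullet> (0, -1) \<ge> C4"
    using lower by meson
  have "polytope_of \<Sigma> a \<subseteq> {C1..-C3} \<times> {C2..-C4}"
  proof
    fix m assume m: "m \<in> polytope_of \<Sigma> a"
    obtain x y where xy: "m = (x, y)" by (cases m)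
    have "C1 \<le> x" "C2 \<le> y" "C3 \<le> - x" "C4 \<le> - y"
      using C[THEN bspec, OF m] by (simp_all add: xy)
    then show "m \<in> {C1..-C3} \<times> {C2..-C4}" by (simp add: xy)
  qed
  then show ?thesis
    by (rule bounded_subset[rotated]) (intro bounded_Times bounded_closed_interval)
qed

lemma polytope_zero: "polytope_of \<Sigma> (multiple 0 a) \<subseteq> {0}"
proof
  fix m0 assume m0: "m0 \<in> polytope_of \<Sigma> (multiple 0 a)"
  obtain C where C: "\<And>m a. (\<And>\<rho>. \<rho> \<in> rays \<Sigma> \<Longrightarrow> \<bar>real_of_int (a \<rho>)\<bar> \<le> 0) \<Longrightarrow>
      m \<in> polytope_of \<Sigma> a \<Longrightarrow> m \<bullet> (- m0) \<ge> - C * 0"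
    using polytope_inner_bound[of 0 "- m0"] by blast
  \<comment> \<open>Testing \<open>m0\<close> against its own negative makes the lower bound 0 an
    upper bound for its squared norm.\<close>
  have "m0 \<bullet> (- m0) \<ge> - C * 0" by (rule C[OF _ m0]) (simp add: multiple_def)
  then have "m0 \<bullet> m0 \<le> 0" by (simp add: inner_minus_right)
  then have "m0 \<bullet> m0 = 0" using inner_ge_zero[of m0] by linarith
  then show "m0 \<in> {0}" by simp
qed

lemma ample_not_in_line:
  assumes "ample \<Sigma> a" and e: "e \<noteq> 0" and line: "\<And>m. m \<in> polytope_of \<Sigma> a \<Longrightarrow> m \<bullet> e = \<kappa>"
  shows False
proof -
  obtain \<sigma> where \<sigma>: "\<sigma> \<in> \<Sigma>" "e \<in> \<sigma>" using fan_covers by blast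
  obtain u w f g B where uw: "dual_bases u w f g" and B: "B \<subseteq> {u, w}" "\<sigma> = cone_over B"
    using \<sigma>(1) by (rule smooth_coneE)
  define x y where "x = of_lattice f \<bullet> e" and "y = of_lattice g \<bullet> e"
  have coords: "x \<ge> 0" "y \<ge> 0" "u \<notin> B \<Longrightarrow> x = 0" "w \<notin> B \<Longrightarrow> y = 0"
    using \<sigma>(2) cone_over_subbasis[OF uw B(1), of e] by (auto simp: B(2) x_def y_def)
  have e_rep: "e = x *\<^sub>R of_lattice u + y *\<^sub>R of_lattice w"
    unfolding x_def y_def by (rule dual_bases_rep[OF uw])
  text \<open>The limit of the one-parameter subgroup of \<open>e\<close>. If the polytope lies in a level set of \<open>e\<close>, a section
    that does not vanish at \<open>1\<close> does not vanish at this limit either, and the locus where it does not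
    vanish is not contained in the torus.\<close>
  define pe :: "int \<times> int \<Rightarrow> complex" where "pe m = (if of_lattice m \<bullet> e = 0 then 1 else 0)" for m
  have pe: "pe \<in> chart_points \<sigma>"
    unfolding chart_points_def mem_Collect_eq
  proof (intro conjI ballI)
    fix m m' assume "m \<in> dual_monoid \<sigma>" "m' \<in> dual_monoid \<sigma>"
    then have "of_lattice m \<bullet> e \<ge> 0" "of_lattice m' \<bullet> e \<ge> 0" using \<sigma>(2) by (auto simp: dual_monoid_def)
    then show "pe (m + m') = pe m * pe m'" by (auto simp: pe_def of_lattice_add inner_add_left)
  qed (simp add: pe_def)
  have exponent: "of_lattice m \<bullet> e = n * (x * a u + y * a w)"
    if m: "chart_exponent \<Sigma> (multiple n a) \<sigma> m" for m n
  proof -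
    have eq: "of_lattice m \<bullet> of_lattice b = n * a b" if "b \<in> B" for b
    proof -
      have "of_lattice b \<in> \<sigma>" unfolding B(2) cone_over_def using that by (intro hull_inc) auto
      then have "pairing m b = multiple n a b"
        using m generator_is_ray[OF \<sigma>(1) uw B that] by (auto simp: chart_exponent_def)
      then show ?thesis by (simp add: inner_of_lattice multiple_def)
    qed
    have u: "x * (of_lattice m \<bullet> of_lattice u) = x * (n * a u)"
      using coords eq[of u] by (cases "u \<in> B") auto
    have w: "y * (of_lattice m \<bullet> of_lattice w) = y * (n * a w)"
      using coords eq[of w] by (cases "w \<in> B") auto
    have "of_lattice m \<bullet> e = x * (n * a u) + y * (n * a w)"
      unfolding e_rep inner_add_right inner_scaleR_right u w ..
    then show ?thesis by (simp add: algebra_simps)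
  qed
  have section_key: "of_lattice k \<bullet> e = n * \<kappa>"
    if "n \<ge> 1" "s \<in> sections \<Sigma> (multiple n a)" "k \<in> Poly_Mapping.keys s" for n s k
  proof -
    have "of_lattice k \<in> polytope_of \<Sigma> (multiple n a)" using that sections_eq by auto
    then have "(1 / n) *\<^sub>R of_lattice k \<in> polytope_of \<Sigma> a"
      using that(1) by (auto simp: polytope_of_def multiple_def field_simps)
    then have "((1 / n) *\<^sub>R of_lattice k) \<bullet> e = \<kappa>" by (rule line)
    then show ?thesis using that(1) by (simp add: field_simps)
  qed
  have one: "1 \<in> coord_ring \<tau>" "value_at 1 z = z 0" for \<tau> z
    by (auto simp: coord_ring_def value_at_def dual_monoid_def)
  have ample: "\<exists>n\<ge>1. \<exists>s\<in>sections \<Sigma> (multiple n a). nonvanishing \<Sigma> (multiple n a) s \<tau> z \<and>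
      (\<forall>\<tau>'\<in>\<Sigma>. \<forall>y\<in>chart_points \<tau>'. nonvanishing \<Sigma> (multiple n a) s \<tau>' y \<longrightarrow>
        (\<exists>z\<in>chart_points (\<tau> \<inter> \<tau>'). \<forall>m\<in>dual_monoid \<tau>'. z m = y m))"
    if "\<tau> \<in> \<Sigma>" "z \<in> chart_points \<tau>" for \<tau> z
  proof -
    have "value_at 1 z \<noteq> 0" using that(2) one(2) by (simp add: chart_points_def)
    then show ?thesis using assms(1) that one(1)[of \<tau>] unfolding ample_def by metis
  qed
  have value_chi: "value_at (chi m * s) z = (\<Sum>k\<in>Poly_Mapping.keys s. Poly_Mapping.lookup s k * z (m + k))" for m s z
    unfolding value_at_def chi_def keys_single_times
    by (subst sum.reindex) (auto simp: lookup_single_times inj_on_def)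
  \<comment> \<open>This section serves only to compare constants: a term that is nonzero at
    \<open>pe\<close> shows that the level \<open>\<kappa>\<close> of the polytope along
    \<open>e\<close> is opposite to the level of the local equations.\<close>
  obtain n s where n: "n \<ge> 1" and s: "s \<in> sections \<Sigma> (multiple n a)" "nonvanishing \<Sigma> (multiple n a) s \<sigma> pe"
    using ample[OF \<sigma>(1) pe] by blast
  then obtain m where m: "chart_exponent \<Sigma> (multiple n a) \<sigma> m" "value_at (chi m * s) pe \<noteq> 0"
    by (auto simp: nonvanishing_def)
  then obtain k where k: "k \<in> Poly_Mapping.keys s" "pe (m + k) \<noteq> 0"
    unfolding value_chi by (metis (no_types, lifting) mult_zero_right sum.neutral)
  have "of_lattice m \<bullet> e + of_lattice k \<bullet> e = 0"
    using k(2) by (auto simp: pe_def of_lattice_add inner_add_left split: if_splits)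
  then have "n * (x * a u + y * a w + \<kappa>) = 0"
    using exponent[OF m(1)] section_key[OF n s(1) k(1)] by (simp add: algebra_simps)
  then have \<kappa>: "x * a u + y * a w = - \<kappa>" using n by simp
  \<comment> \<open>Ampleness at the unit, tested on the chart of \<open>{0}\<close>, yields a
    section that does not vanish there and whose nonvanishing locus lies in the torus.\<close>
  have "(\<lambda>_. 1) \<in> chart_points {0}" by (simp add: chart_points_def)
  then obtain n' s' where n': "n' \<ge> 1" and s': "s' \<in> sections \<Sigma> (multiple n' a)"
      "nonvanishing \<Sigma> (multiple n' a) s' {0} (\<lambda>_. 1)"
    and torus: "\<And>\<tau> y. \<tau> \<in> \<Sigma> \<Longrightarrow> y \<in> chart_points \<tau> \<Longrightarrow> nonvanishing \<Sigma> (multiple n' a) s' \<tau> y \<Longrightarrow>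
        \<exists>z\<in>chart_points ({0} \<inter> \<tau>). \<forall>m\<in>dual_monoid \<tau>. z m = y m"
    using ample[OF zero_cone_in_fan] by blast
  obtain m' where m': "chart_exponent \<Sigma> (multiple n' a) \<sigma> m'"
    using \<sigma>(1) by (rule chart_exponent_exists)
  have "pe (m' + k) = 1" if "k \<in> Poly_Mapping.keys s'" for k
    using exponent[OF m'] section_key[OF n' s'(1) that] \<kappa>
    by (simp add: pe_def of_lattice_add inner_add_left)
  then have "value_at (chi m' * s') pe = value_at (chi m0 * s') (\<lambda>_. 1)" for m0
    unfolding value_chi by (intro sum.cong) auto
  then have "nonvanishing \<Sigma> (multiple n' a) s' \<sigma> pe"
    using s'(2) m' unfolding nonvanishing_def by metis
  then obtain z where z: "z \<in> chart_points ({0} \<inter> \<sigma>)" "\<And>m. m \<in> dual_monoid \<sigma> \<Longrightarrow> z m = pe m"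
    using torus[OF \<sigma>(1) pe] by blast
  \<comment> \<open>The monomial of \<open>f + g\<close> vanishes at \<open>pe\<close>, whereas at a
    point of the torus every monomial is invertible.\<close>
  have fg: "f + g \<in> dual_monoid \<sigma>"
    using cone_over_subbasis[OF uw B(1)] by (auto simp: dual_monoid_def B(2) of_lattice_add inner_add_left)
  have "x + y \<noteq> 0" using e e_rep coords by (auto simp: add_nonneg_eq_0_iff)
  then have "z (f + g) = 0"
    using z(2)[OF fg] by (simp add: pe_def of_lattice_add inner_add_left x_def y_def)
  moreover have "m \<in> dual_monoid ({0} \<inter> \<sigma>)" for m by (simp add: dual_monoid_def)
  then have "z ((f + g) + - (f + g)) = z (f + g) * z (- (f + g))" "z 0 = 1"
    using z(1) unfolding chart_points_def by blast+
  ultimately show False by simp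
qed

end

section \<open>The cones of the flag\<close>

lemma cone_of_normals_swap: "cone_of_normals w n n' = cone_of_normals w n' n"
proof -
  have sub: "{x *\<^sub>R n + y *\<^sub>R of_lattice w | x y. y \<ge> 0} \<subseteq> {x *\<^sub>R n' + y *\<^sub>R of_lattice w | x y. y \<ge> 0}"
    if "n = - k *\<^sub>R n'" for k n n'
  proof
    fix z assume "z \<in> {x *\<^sub>R n + y *\<^sub>R of_lattice w | x y. y \<ge> 0}"
    then obtain x y where "z = x *\<^sub>R n + y *\<^sub>R of_lattice w" "y \<ge> 0" by blast
    then have "z = (- (x * k)) *\<^sub>R n' + y *\<^sub>R of_lattice w" by (simp add: that)
    then show "z \<in> {x *\<^sub>R n' + y *\<^sub>R of_lattice w | x y. y \<ge> 0}" using \<open>y \<ge> 0\<close> by blast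
  qed
  have flip: "n = - (1 / k) *\<^sub>R n'" if "n' = - k *\<^sub>R n" "k > 0" for k and n n' :: "real \<times> real"
    using that by simp
  show ?thesis
  proof (cases "\<exists>k>0. n' = - k *\<^sub>R n")
    case True
    then obtain k where k: "k > 0" "n' = - k *\<^sub>R n" by blast
    then have k': "1 / k > 0" "n = - (1 / k) *\<^sub>R n'" using flip by auto
    have "\<exists>k>0. n = - k *\<^sub>R n'" using k' by blast
    moreover have "{x *\<^sub>R n + y *\<^sub>R of_lattice w | x y. y \<ge> 0} = {x *\<^sub>R n' + y *\<^sub>R of_lattice w | x y. y \<ge> 0}"
      using sub[OF k(2)] sub[OF k'(2)] by (rule equalityI[rotated])
    ultimately show ?thesis using True by (simp add: cone_of_normals_def)
  next
    case False
    then have "\<not> (\<exists>k>0. n = - k *\<^sub>R n')" using flip by (metis zero_less_divide_1_iff)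
    then show ?thesis
      unfolding cone_of_normals_def if_not_P[OF False] by (simp only: if_not_P if_False insert_commute)
  qed
qed

lemma flag_cone_swap: "flag_cone \<Delta> w c p q \<sigma> \<longleftrightarrow> flag_cone \<Delta> w c q p \<sigma>"
  unfolding flag_cone_def by (metis cone_of_normals_swap)

context flag_frame
begin

section \<open>The flag's coordinates over the reals\<close>

definition w :: "int \<times> int" where
  "w = (snd e, - fst e)"

definition emb :: "real \<Rightarrow> real \<Rightarrow> real \<times> real" where
  "emb x y = x *\<^sub>R of_lattice d + y *\<^sub>R of_lattice e"

lemma pairings: "pairing d v = 0" "pairing d w = 1" "pairing e w = 0"
  using det_eq by (simp_all add: pairing_def d_def w_def mult.commute)

lemma emb_inner_v [simp]: "emb x y \<bullet> of_lattice v = y"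
  and emb_inner_w [simp]: "emb x y \<bullet> of_lattice w = x"
  by (simp_all add: emb_def inner_add_left inner_of_lattice pairings pairing_e_v)

lemma dual_bases_wv: "dual_bases w v d e"
proof -
  have "z = (of_lattice d \<bullet> z) *\<^sub>R of_lattice w + (of_lattice e \<bullet> z) *\<^sub>R of_lattice v" for z
  proof -
    obtain x y where z: "z = (x, y)" by (cases z)
    have det: "real_of_int (fst e) * fst v + snd e * snd v = 1"
      using arg_cong[OF det_eq, of real_of_int] by simp
    have "(snd v * x - fst v * y) * snd e + (fst e * x + snd e * y) * fst v
        = (real_of_int (fst e) * fst v + snd e * snd v) * x"
      "(fst e * x + snd e * y) * snd v - (snd v * x - fst v * y) * fst e
        = (real_of_int (fst e) * fst v + snd e * snd v) * y"
      by (simp_all add: algebra_simps)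
    then show ?thesis unfolding det by (simp add: z of_lattice_def d_def w_def)
  qed
  then show ?thesis by (simp add: dual_bases_def pairings pairing_e_v)
qed

lemma emb_cases: obtains x y where "z = emb x y"
proof
  obtain x y where z: "z = (x, y)" by (cases z)
  have det: "real_of_int (fst e) * fst v + snd e * snd v = 1"
    using arg_cong[OF det_eq, of real_of_int] by simp
  have "(x * snd e - y * fst e) * snd v + (x * fst v + y * snd v) * fst e
      = (real_of_int (fst e) * fst v + snd e * snd v) * x"
    "(x * fst v + y * snd v) * snd e - (x * snd e - y * fst e) * fst v
      = (real_of_int (fst e) * fst v + snd e * snd v) * y"
    by (simp_all add: algebra_simps)
  then show "z = emb (z \<bullet> of_lattice w) (z \<bullet> of_lattice v)"
    unfolding det by (simp add: z of_lattice_def d_def w_def emb_def)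
qed

lemma emb_eq_iff [simp]: "emb x y = emb x' y' \<longleftrightarrow> x = x' \<and> y = y'"
  by (metis emb_inner_v emb_inner_w)

lemma emb_inner: "emb x y \<bullet> n = x * (of_lattice d \<bullet> n) + y * (of_lattice e \<bullet> n)"
  by (simp add: emb_def inner_add_left)

lemma emb_combination: "s *\<^sub>R emb x y + t *\<^sub>R emb x' y' = emb (s * x + t * x') (s * y + t * y')"
  by (simp add: emb_def algebra_simps)

lemma emb_pt: "emb (of_int i) (of_int j) = of_lattice (pt i j)"
  by (simp add: emb_def pt_def of_lattice_def algebra_simps)

definition coords :: "(real \<times> real) set \<Rightarrow> (real \<times> real) set" where
  "coords \<Delta> = {(x, y). emb x y \<in> \<Delta>}"

lemma coords_iff: "z \<in> coords \<Delta> \<longleftrightarrow> emb (fst z) (snd z) \<in> \<Delta>"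
  by (auto simp: coords_def)

lemma convex_coords:
  assumes "convex \<Delta>"
  shows "convex (coords \<Delta>)"
proof (rule convexI)
  fix z z' :: "real \<times> real" and s t :: real
  assume "z \<in> coords \<Delta>" "z' \<in> coords \<Delta>" "0 \<le> s" "0 \<le> t" "s + t = 1"
  then have "s *\<^sub>R emb (fst z) (snd z) + t *\<^sub>R emb (fst z') (snd z') \<in> \<Delta>"
    using assms unfolding coords_iff by (intro convexD)
  then show "s *\<^sub>R z + t *\<^sub>R z' \<in> coords \<Delta>" by (simp add: coords_iff emb_combination)
qed

lemma compact_coords:
  assumes "compact \<Delta>"
  shows "compact (coords \<Delta>)"
proof -
  have "compact ((\<lambda>z. (z \<bullet> of_lattice w, z \<bullet> of_lattice v)) ` \<Delta>)"
    by (intro compact_continuous_image continuous_intros assms)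
  moreover have "coords \<Delta> = (\<lambda>z. (z \<bullet> of_lattice w, z \<bullet> of_lattice v)) ` \<Delta>"
  proof (intro equalityI subsetI)
    fix z assume "z \<in> (\<lambda>z. (z \<bullet> of_lattice w, z \<bullet> of_lattice v)) ` \<Delta>"
    then obtain z' where "z' \<in> \<Delta>" "z = (z' \<bullet> of_lattice w, z' \<bullet> of_lattice v)" by blast
    then show "z \<in> coords \<Delta>" by (cases z' rule: emb_cases) (simp add: coords_def)
  next
    fix z assume z: "z \<in> coords \<Delta>"
    then have "emb (fst z) (snd z) \<in> \<Delta>" by (auto simp: coords_def)
    then have "(emb (fst z) (snd z) \<bullet> of_lattice w, emb (fst z) (snd z) \<bullet> of_lattice v)
        \<in> (\<lambda>z. (z \<bullet> of_lattice w, z \<bullet> of_lattice v)) ` \<Delta>" by (rule imageI)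
    then show "z \<in> (\<lambda>z. (z \<bullet> of_lattice w, z \<bullet> of_lattice v)) ` \<Delta>" by simp
  qed
  ultimately show ?thesis by simp
qed

lemma lattice_vector:
  obtains u where "of_lattice d \<bullet> of_lattice u = real_of_int i" "of_lattice e \<bullet> of_lattice u = real_of_int j"
proof
  let ?u = "(i * fst w + j * fst v, i * snd w + j * snd v)"
  have "pairing m ?u = i * pairing m w + j * pairing m v" for m
    by (simp add: pairing_def algebra_simps)
  then show "of_lattice d \<bullet> of_lattice ?u = real_of_int i" "of_lattice e \<bullet> of_lattice ?u = real_of_int j"
    by (simp_all add: inner_of_lattice pairings pairing_e_v)
qed

text \<open>In the coordinates given by the pairings with \<open>d\<close> and \<open>e\<close>, the
  normals point along (1, A) and (-1, B) and \<open>v\<close> is (0, 1), so the cone is cut out by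
  the two lines through the normals. The normals are opposite exactly if \<open>A + B = 0\<close>;
  the two half-planes then coincide and contain \<open>v\<close>, in accordance with the
  convention.\<close>

lemma interior_cone_of_normals:
  assumes n: "of_lattice d \<bullet> n = \<delta>" "of_lattice e \<bullet> n = \<delta> * A" "\<delta> > 0"
    and n': "of_lattice d \<bullet> n' = - \<delta>'" "of_lattice e \<bullet> n' = \<delta>' * B" "\<delta>' > 0"
    and AB: "A + B \<ge> 0"
  shows "z \<in> interior (cone_of_normals v n n') \<longleftrightarrow>
    of_lattice e \<bullet> z > A * (of_lattice d \<bullet> z) \<and> of_lattice e \<bullet> z > - B * (of_lattice d \<bullet> z)"
proof -
  let ?a = "of_lattice e - A *\<^sub>R of_lattice d" and ?b = "of_lattice e + B *\<^sub>R of_lattice d"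
  have z_eqI: "z = z'" if "of_lattice d \<bullet> z = of_lattice d \<bullet> z'" "of_lattice e \<bullet> z = of_lattice e \<bullet> z'" for z z'
    using dual_bases_rep[OF dual_bases_wv, of z] dual_bases_rep[OF dual_bases_wv, of z'] that by simp
  have dv: "of_lattice d \<bullet> of_lattice v = 0" "of_lattice e \<bullet> of_lattice v = 1"
    by (simp_all add: inner_of_lattice pairings pairing_e_v)
  have cone: "cone_of_normals v n n' = {z. ?a \<bullet> z \<ge> 0} \<inter> {z. ?b \<bullet> z \<ge> 0}"
  proof (cases "A + B = 0")
    case True
    have B: "B = - A" using True by simp
    have "n' = - (\<delta>' / \<delta>) *\<^sub>R n" using n n' unfolding B by (intro z_eqI) (auto simp: field_simps)
    then have "\<exists>k>0. n' = - k *\<^sub>R n" using n(3) n'(3) by (intro exI[of _ "\<delta>' / \<delta>"]) auto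
    then have "cone_of_normals v n n' = {x *\<^sub>R n + y *\<^sub>R of_lattice v | x y. y \<ge> 0}"
      by (simp add: cone_of_normals_def)
    also have "\<dots> = {z. ?a \<bullet> z \<ge> 0}"
    proof (intro equalityI subsetI)
      fix z assume z: "z \<in> {z. ?a \<bullet> z \<ge> 0}"
      have "z = ((of_lattice d \<bullet> z) / \<delta>) *\<^sub>R n + (?a \<bullet> z) *\<^sub>R of_lattice v"
        using n by (intro z_eqI) (auto simp: inner_add_right dv inner_diff_left)
      then show "z \<in> {x *\<^sub>R n + y *\<^sub>R of_lattice v | x y. y \<ge> 0}" using z by blast
    qed (auto simp: inner_add_right inner_diff_left n dv)
    also have "?b = ?a" using True by (simp add: eq_neg_iff_add_eq_0[symmetric] add.commute)
    then have "{z. ?a \<bullet> z \<ge> 0} = {z. ?a \<bullet> z \<ge> 0} \<inter> {z. ?b \<bullet> z \<ge> 0}" by simp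
    finally show ?thesis .
  next
    case False
    then have pos: "A + B > 0" using AB by simp
    have "\<not> (\<exists>k>0. n' = - k *\<^sub>R n)"
    proof clarify
      fix k :: real assume k: "k > 0" "n' = - k *\<^sub>R n"
      then have "\<delta>' = k * \<delta>" "\<delta>' * B = - (k * (\<delta> * A))" using n n' by auto
      then have "\<delta>' * (A + B) = 0" by (simp add: algebra_simps)
      then show False using pos n'(3) by simp
    qed
    then have "cone_of_normals v n n' = convex_cone hull {n, n'}"
      unfolding cone_of_normals_def by (rule if_not_P)
    also have "\<dots> = {z. ?a \<bullet> z \<ge> 0} \<inter> {z. ?b \<bullet> z \<ge> 0}"
    proof (intro equalityI)
      have "convex_cone ({z. ?a \<bullet> z \<ge> 0} \<inter> {z. ?b \<bullet> z \<ge> 0})"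
        by (rule convex_coneI) (auto simp: inner_add_right)
      moreover have "?a \<bullet> n = 0" "?a \<bullet> n' = \<delta>' * (A + B)" "?b \<bullet> n = \<delta> * (A + B)" "?b \<bullet> n' = 0"
        using n n' by (auto simp: inner_diff_left inner_add_left algebra_simps)
      then have "{n, n'} \<subseteq> {z. ?a \<bullet> z \<ge> 0} \<inter> {z. ?b \<bullet> z \<ge> 0}"
        using n(3) n'(3) pos by simp
      ultimately show "convex_cone hull {n, n'} \<subseteq> {z. ?a \<bullet> z \<ge> 0} \<inter> {z. ?b \<bullet> z \<ge> 0}"
        by (intro hull_minimal)
      show "{z. ?a \<bullet> z \<ge> 0} \<inter> {z. ?b \<bullet> z \<ge> 0} \<subseteq> convex_cone hull {n, n'}"
      proof clarify
        fix x y :: real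
        let ?z = "(x, y)"
        assume z: "?a \<bullet> ?z \<ge> 0" "?b \<bullet> ?z \<ge> 0"
        \<comment> \<open>The form \<open>?a\<close> vanishes on \<open>n\<close> and
          \<open>?b\<close> on \<open>n'\<close>; dividing by their values on the other normal gives
          the coefficients.\<close>
        define s t where "s = (?b \<bullet> ?z) / (\<delta> * (A + B))" and "t = (?a \<bullet> ?z) / (\<delta>' * (A + B))"
        have "s * \<delta> = (?b \<bullet> ?z) / (A + B)" "t * \<delta>' = (?a \<bullet> ?z) / (A + B)"
          using n(3) n'(3) by (simp_all add: s_def t_def)
        then have st: "(A + B) * (s * \<delta>) = ?b \<bullet> ?z" "(A + B) * (t * \<delta>') = ?a \<bullet> ?z"
          using pos by simp_all
        have "?z = s *\<^sub>R n + t *\<^sub>R n'"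
        proof (intro z_eqI)
          have "(A + B) * (of_lattice d \<bullet> (s *\<^sub>R n + t *\<^sub>R n')) = (A + B) * (s * \<delta>) - (A + B) * (t * \<delta>')"
            by (simp add: inner_add_right n n' algebra_simps)
          also have "\<dots> = (A + B) * (of_lattice d \<bullet> ?z)"
            unfolding st by (simp add: inner_diff_left inner_add_left algebra_simps)
          finally show "of_lattice d \<bullet> ?z = of_lattice d \<bullet> (s *\<^sub>R n + t *\<^sub>R n')" using pos by simp
          have "(A + B) * (of_lattice e \<bullet> (s *\<^sub>R n + t *\<^sub>R n')) = A * ((A + B) * (s * \<delta>)) + B * ((A + B) * (t * \<delta>'))"
            by (simp add: inner_add_right n n' algebra_simps)
          also have "\<dots> = (A + B) * (of_lattice e \<bullet> ?z)"
            unfolding st by (simp add: inner_diff_left inner_add_left algebra_simps)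
          finally show "of_lattice e \<bullet> ?z = of_lattice e \<bullet> (s *\<^sub>R n + t *\<^sub>R n')" using pos by simp
        qed
        moreover have "s \<ge> 0" "t \<ge> 0" using z pos n(3) n'(3) by (auto simp: s_def t_def)
        then have "s *\<^sub>R n + t *\<^sub>R n' \<in> convex_cone hull {n, n'}"
          by (intro convex_cone_hull_add convex_cone_hull_mul hull_inc) auto
        ultimately show "?z \<in> convex_cone hull {n, n'}" by simp
      qed
    qed
    finally show ?thesis .
  qed
  have "?a \<bullet> of_lattice v = 1" "?b \<bullet> of_lattice v = 1"
    by (simp_all add: inner_diff_left inner_add_left dv)
  then have "?a \<noteq> 0" "?b \<noteq> 0" by auto
  then have int: "interior ({z. ?a \<bullet> z \<ge> 0} \<inter> {z. ?b \<bullet> z \<ge> 0}) = {z. ?a \<bullet> z > 0} \<inter> {z. ?b \<bullet> z > 0}"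
    unfolding interior_Int by (simp only: interior_halfspace_ge not_False_eq_True)
  show ?thesis unfolding cone int by (simp add: inner_diff_left inner_add_left) linarith
qed

text \<open>In these coordinates the summands of \<open>v\<close> are (i, j) and (-i, 1 - j). Here i
  = 0 would force 0 < j < 1, and exchanging the summands makes i positive; what remains is an
  integer \<open>j\<close> strictly between \<open>A * i\<close> and
  \<open>1 - B * i\<close>.\<close>

lemma strongly_decomposable_iff_floors:
  assumes AB: "A + B \<ge> 0"
    and interior: "\<And>z. z \<in> interior \<sigma> \<longleftrightarrow>
      of_lattice e \<bullet> z > A * (of_lattice d \<bullet> z) \<and> of_lattice e \<bullet> z > - B * (of_lattice d \<bullet> z)"
  shows "strongly_decomposable v \<sigma> \<longleftrightarrow> (\<exists>n\<ge>1::int. \<lfloor>A * n\<rfloor> + \<lfloor>B * n\<rfloor> < 0)"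
proof -
  have mem: "of_lattice u \<in> interior \<sigma> \<longleftrightarrow>
      A * pairing d u < pairing e u \<and> - B * pairing d u < pairing e u" for u
    by (simp add: interior inner_of_lattice)
  have v_mem: "of_lattice v \<in> interior \<sigma>" by (simp add: mem pairings pairing_e_v)
  show ?thesis
  proof
    assume "strongly_decomposable v \<sigma>"
    then obtain u u' where u: "of_lattice u \<in> interior \<sigma>" "of_lattice u' \<in> interior \<sigma>" "v = u + u'"
      by (auto simp: strongly_decomposable_def)
    define i j where "i = pairing d u" and "j = pairing e u"
    have "pairing d u' = - i" "pairing e u' = 1 - j"
      using pairings(1) pairing_e_v by (simp_all add: u(3) pairing_add_right i_def j_def)
    then have ij: "A * i < j" "- B * i < j" "- A * i < 1 - j" "B * i < 1 - j"
      using u(1,2) by (auto simp: mem i_def j_def)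
    have "i \<noteq> 0" using ij by auto
    then consider "i \<ge> 1" | "- i \<ge> 1" by linarith
    then show "\<exists>n\<ge>1::int. \<lfloor>A * n\<rfloor> + \<lfloor>B * n\<rfloor> < 0"
    proof cases
      case 1
      moreover have "\<lfloor>A * i\<rfloor> < j" "\<lfloor>B * i\<rfloor> < 1 - j" using ij by (simp_all add: floor_less_iff)
      ultimately show ?thesis by (intro exI[of _ i]) linarith
    next
      case 2
      have "\<lfloor>A * of_int (- i)\<rfloor> < 1 - j" "\<lfloor>B * of_int (- i)\<rfloor> < j" using ij by (simp_all add: floor_less_iff)
      then show ?thesis using 2 by (intro exI[of _ "- i"]) linarith
    qed
  next
    assume "\<exists>n\<ge>1::int. \<lfloor>A * n\<rfloor> + \<lfloor>B * n\<rfloor> < 0"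
    then obtain n :: int where n: "n \<ge> 1" "\<lfloor>A * n\<rfloor> + \<lfloor>B * n\<rfloor> < 0" by blast
    have "(A + B) * n \<ge> 0" using AB n(1) by simp
    then have sum: "A * n + B * n \<ge> 0" by (simp add: algebra_simps)
    \<comment> \<open>The least integer above \<open>A * n\<close>. Negativity of the sum of floors
      gives the bound with \<open>B\<close>, and the two remaining inequalities follow from
      \<open>A + B \<ge> 0\<close>.\<close>
    define j where "j = \<lfloor>A * n\<rfloor> + 1"
    have j: "A * n < j" "- B * n < j" "- A * n < 1 - j" "B * n < 1 - j"
      using n(2) sum unfolding j_def by linarith+
    obtain u where u: "of_lattice d \<bullet> of_lattice u = real_of_int n" "of_lattice e \<bullet> of_lattice u = real_of_int j"
      by (rule lattice_vector)
    then have "pairing d u = n" "pairing e u = j" by (simp_all add: inner_of_lattice)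
    moreover from this have "pairing d (v - u) = - n" "pairing e (v - u) = 1 - j"
      using pairing_add_right[of d u "v - u"] pairing_add_right[of e u "v - u"] pairings(1) pairing_e_v by auto
    ultimately have "of_lattice u \<in> interior \<sigma>" "of_lattice (v - u) \<in> interior \<sigma>"
      using j by (auto simp: mem)
    then show "strongly_decomposable v \<sigma>"
      using v_mem unfolding strongly_decomposable_def by (metis add.commute diff_add_cancel)
  qed
qed

lemma emb_diff: "emb x y - emb x' y' = emb (x - x') (y - y')"
  by (simp add: emb_def algebra_simps)

lemma norm_d_pos: "norm (of_lattice d) > 0"
  using pairings(2) inner_of_lattice[of d w] by auto

lemma dist_emb: "dist (emb x y) (emb x' y) = \<bar>x - x'\<bar> * norm (of_lattice d)"
  by (simp add: dist_norm emb_diff) (simp add: emb_def)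

lemma interior_square:
  assumes "interior \<Delta> \<noteq> {}"
  obtains x y t where "t > 0" "emb x y \<in> \<Delta>" "emb (x + t) y \<in> \<Delta>" "emb x (y + t) \<in> \<Delta>"
proof -
  obtain z \<epsilon> where z: "\<epsilon> > 0" "cball z \<epsilon> \<subseteq> \<Delta>" using assms mem_interior_cball by blast
  obtain x y where xy: "z = emb x y" by (rule emb_cases)
  let ?N = "norm (of_lattice d) + norm (of_lattice e)"
  have N: "?N > 0" using norm_d_pos by (simp add: add_pos_nonneg)
  define t where "t = \<epsilon> / ?N"
  have t: "t > 0" "t * ?N = \<epsilon>" using z(1) N by (simp_all add: t_def)
  have "t * norm (of_lattice d) \<le> t * ?N" "t * norm (of_lattice e) \<le> t * ?N"
    using t(1) by (auto intro!: mult_left_mono)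
  then have le: "t * norm (of_lattice d) \<le> \<epsilon>" "t * norm (of_lattice e) \<le> \<epsilon>" unfolding t(2) .
  have "emb x y - emb (x + t) y = - t *\<^sub>R of_lattice d" "emb x y - emb x (y + t) = - t *\<^sub>R of_lattice e"
    by (simp_all add: emb_def algebra_simps)
  then have "dist (emb x y) (emb (x + t) y) = t * norm (of_lattice d)"
    "dist (emb x y) (emb x (y + t)) = t * norm (of_lattice e)"
    using t(1) by (simp_all add: dist_norm)
  then have "emb x y \<in> cball z \<epsilon>" "emb (x + t) y \<in> cball z \<epsilon>" "emb x (y + t) \<in> cball z \<epsilon>"
    using le z(1) by (simp_all add: xy)
  then show thesis using that t(1) z(2) by blast
qed

section \<open>The longest row and the edges at its ends\<close>

text \<open>Maximality in \<open>longest_segment\<close> refers to level sets given as segments, so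
  each row is first shown to be one, being compact and convex. An interior point makes some row, and
  thus the longest one, nondegenerate. The ends are obtained up to order because the order of
  \<open>p\<close> and \<open>q\<close> is arbitrary.\<close>

lemma longest_segment_endpoints:
  assumes "convex \<Delta>" "compact \<Delta>" "interior \<Delta> \<noteq> {}" and seg: "longest_segment \<Delta> v c p q"
  obtains x0 x1 where "x0 < x1" "{p, q} = {emb x0 c, emb x1 c}"
    "\<And>x x' y. (x, y) \<in> coords \<Delta> \<Longrightarrow> (x', y) \<in> coords \<Delta> \<Longrightarrow> x' - x \<le> x1 - x0"
proof -
  have level: "level_set \<Delta> v c = closed_segment p q" using seg by (simp add: longest_segment_def)
  obtain xp yp xq yq where pq: "p = emb xp yp" "q = emb xq yq" by (metis emb_cases)
  have "p \<in> level_set \<Delta> v c" "q \<in> level_set \<Delta> v c" unfolding level by simp_all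
  then have pq: "p = emb xp c" "q = emb xq c" by (auto simp: level_set_def pq)
  have widest: "x' - x \<le> \<bar>xp - xq\<bar>" if xy: "emb x y \<in> \<Delta>" "emb x' y \<in> \<Delta>" for x x' y
  proof -
    let ?R = "{x. emb x y \<in> \<Delta>}"
    have "compact ((\<lambda>m. m \<bullet> of_lattice w) ` (\<Delta> \<inter> {m. of_lattice v \<bullet> m = y}))"
      by (intro compact_continuous_image continuous_intros compact_Int_closed assms closed_hyperplane)
    moreover have "(\<lambda>m. m \<bullet> of_lattice w) ` (\<Delta> \<inter> {m. of_lattice v \<bullet> m = y}) = ?R"
    proof (intro equalityI subsetI)
      fix x assume "x \<in> (\<lambda>m. m \<bullet> of_lattice w) ` (\<Delta> \<inter> {m. of_lattice v \<bullet> m = y})"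
      then obtain m where m: "m \<in> \<Delta>" "m \<bullet> of_lattice v = y" "x = m \<bullet> of_lattice w" by (auto simp: inner_commute)
      obtain x' y' where "m = emb x' y'" by (rule emb_cases)
      then show "x \<in> ?R" using m by simp
    next
      fix x assume "x \<in> ?R"
      then show "x \<in> (\<lambda>m. m \<bullet> of_lattice w) ` (\<Delta> \<inter> {m. of_lattice v \<bullet> m = y})"
        by (intro image_eqI[of _ _ "emb x y"]) (auto simp: inner_commute[of "of_lattice v"])
    qed
    ultimately have "compact ?R" by simp
    moreover have "convex ?R"
    proof (rule convexI)
      fix x x' s t :: real assume "x \<in> ?R" "x' \<in> ?R" and st: "0 \<le> s" "0 \<le> t" "s + t = 1"
      then have "s *\<^sub>R emb x y + t *\<^sub>R emb x' y \<in> \<Delta>" using assms(1) by (auto dest: convexD)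
      moreover have "s * y + t * y = y" using st(3) by (metis distrib_right mult_1)
      ultimately show "s *\<^sub>R x + t *\<^sub>R x' \<in> ?R" by (simp add: emb_combination)
    qed
    ultimately obtain a b where ab: "?R = {a..b}"
      using connected_compact_interval_1 convex_connected by blast
    have "x \<in> {a..b}" unfolding ab[symmetric] using xy(1) by simp
    then have "a \<le> b" by simp
    have "level_set \<Delta> v y = closed_segment (emb a y) (emb b y)"
    proof (intro equalityI subsetI)
      fix m assume m: "m \<in> level_set \<Delta> v y"
      obtain x y' where "m = emb x y'" by (rule emb_cases)
      then have mx: "m = emb x y" "x \<in> ?R" using m by (auto simp: level_set_def)
      then have "x \<in> closed_segment a b" using ab \<open>a \<le> b\<close> by (simp add: closed_segment_eq_real_ivl)
      then obtain u where u: "0 \<le> u" "u \<le> 1" "x = (1 - u) *\<^sub>R a + u *\<^sub>R b" unfolding closed_segment_def by blast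
      have "m = (1 - u) *\<^sub>R emb a y + u *\<^sub>R emb b y"
        unfolding emb_combination mx(1) using u(3) by (simp add: algebra_simps)
      then show "m \<in> closed_segment (emb a y) (emb b y)" using u by (auto simp: closed_segment_def)
    next
      fix m assume "m \<in> closed_segment (emb a y) (emb b y)"
      then obtain u where u: "0 \<le> u" "u \<le> 1" "m = (1 - u) *\<^sub>R emb a y + u *\<^sub>R emb b y" by (auto simp: closed_segment_def)
      have "a \<in> ?R" "b \<in> ?R" unfolding ab using \<open>a \<le> b\<close> by auto
      then have "m \<in> \<Delta>" using u assms(1) by (auto intro!: convexD)
      moreover have "m \<bullet> of_lattice v = y" unfolding u(3) emb_combination by (simp add: algebra_simps)
      ultimately show "m \<in> level_set \<Delta> v y" by (simp add: level_set_def)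
    qed
    then have "dist (emb a y) (emb b y) \<le> dist p q" using seg unfolding longest_segment_def by blast
    then have "\<bar>a - b\<bar> \<le> \<bar>xp - xq\<bar>" using norm_d_pos by (simp add: pq dist_emb)
    moreover have "x \<in> {a..b}" "x' \<in> {a..b}" using xy unfolding ab[symmetric] by auto
    ultimately show ?thesis by auto
  qed
  obtain x y t where "t > 0" "emb x y \<in> \<Delta>" "emb (x + t) y \<in> \<Delta>"
    using assms(3) by (rule interior_square)
  then have "\<bar>xp - xq\<bar> > 0" using widest[of x y "x + t"] by auto
  then show thesis
    using that[of xp xq] that[of xq xp] widest by (cases "xp < xq") (auto simp: pq coords_def insert_commute)
qed

text \<open>If nothing lies below row \<open>c\<close>, both edges are the bottom edge; the normals
  are positive multiples of \<open>v\<close>, and a cone inside a line has no interior. Otherwise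
  each edge enters the lower half-plane, its normal is not parallel to \<open>v\<close>, and the
  slopes read off from the normals are the flanks.\<close>

lemma flag_cone_data:
  assumes "convex \<Delta>" "interior \<Delta> \<noteq> {}" and x01: "x0 < x1"
    and widest: "\<And>x x' y. (x, y) \<in> coords \<Delta> \<Longrightarrow> (x', y) \<in> coords \<Delta> \<Longrightarrow> x' - x \<le> x1 - x0"
    and p: "emb x0 c \<in> \<Delta>" "emb x1 c \<in> \<Delta>"
    and cone: "flag_cone \<Delta> v c (emb x0 c) (emb x1 c) \<sigma>"
  shows "(\<forall>(x, y)\<in>coords \<Delta>. c \<le> y) \<and> \<not> strongly_decomposable v \<sigma> \<or>
    (\<exists>A B \<epsilon>. \<epsilon> > 0 \<and> flanked (coords \<Delta>) c x0 x1 A B \<and>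
      (x0 + A * \<epsilon>, c - \<epsilon>) \<in> coords \<Delta> \<and> (x1 - B * \<epsilon>, c - \<epsilon>) \<in> coords \<Delta> \<and>
      (strongly_decomposable v \<sigma> \<longleftrightarrow> (\<exists>n\<ge>1::int. \<lfloor>A * n\<rfloor> + \<lfloor>B * n\<rfloor> < 0)))"
proof -
  obtain E E' n n' where E: "edge_into \<Delta> (- v) (- c) (emb x0 c) E" and E': "edge_into \<Delta> (- v) (- c) (emb x1 c) E'"
    and n: "inner_normal \<Delta> E n" and n': "inner_normal \<Delta> E' n'" and \<sigma>: "\<sigma> = cone_of_normals v n n'"
    using cone unfolding flag_cone_def by blast
  have pE: "emb x0 c \<in> E" "emb x1 c \<in> E'" and E\<Delta>: "E \<subseteq> \<Delta>" "E' \<subseteq> \<Delta>"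
    using E E' by (auto simp: edge_into_def dest: edge_of_imp_subset)
  have n_ge: "emb x0 c \<bullet> n \<le> m \<bullet> n" "emb x1 c \<bullet> n' \<le> m \<bullet> n'" if "m \<in> \<Delta>" for m
    using that n n' pE by (auto simp: inner_normal_def)
  have n_eq: "emb x0 c \<bullet> n = m \<bullet> n" if "m \<in> E" for m
    using that n pE E\<Delta> unfolding inner_normal_def by (meson order_antisym subsetD)
  have n'_eq: "emb x1 c \<bullet> n' = m \<bullet> n'" if "m \<in> E'" for m
    using that n' pE E\<Delta> unfolding inner_normal_def by (meson order_antisym subsetD)
  have n_nz: "of_lattice d \<bullet> n \<noteq> 0 \<or> of_lattice e \<bullet> n \<noteq> 0" "of_lattice d \<bullet> n' \<noteq> 0 \<or> of_lattice e \<bullet> n' \<noteq> 0"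
    using n n' dual_bases_rep[OF dual_bases_wv, of n] dual_bases_rep[OF dual_bases_wv, of n']
    by (auto simp: inner_normal_def)
  show ?thesis
  proof (cases "\<forall>m\<in>\<Delta>. m \<bullet> of_lattice (- v) \<le> - c")
    case True
    then have ge_c: "\<forall>(x, y)\<in>coords \<Delta>. c \<le> y"
      by (fastforce simp: coords_def of_lattice_uminus)
    have "E = level_set \<Delta> (- v) (- c)" "E' = level_set \<Delta> (- v) (- c)"
      using E E' True by (simp_all add: edge_into_def)
    then have "emb x1 c \<in> E" "emb x0 c \<in> E'" using p by (auto simp: level_set_def of_lattice_uminus)
    then have d0: "of_lattice d \<bullet> n = 0" "of_lattice d \<bullet> n' = 0"
      using n_eq[of "emb x1 c"] n'_eq[of "emb x0 c"] x01 by (simp_all add: emb_inner)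
    obtain x y t where t: "t > 0" "emb x y \<in> \<Delta>" "emb x (y + t) \<in> \<Delta>"
      using assms(2) by (rule interior_square)
    then have "(x, y) \<in> coords \<Delta>" by (simp add: coords_def)
    then have "y \<ge> c" using ge_c by blast
    have "(y + t - c) * (of_lattice e \<bullet> n) \<ge> 0" "(y + t - c) * (of_lattice e \<bullet> n') \<ge> 0"
      using n_ge[OF t(3)] by (simp_all add: emb_inner d0 algebra_simps)
    then have e_pos: "of_lattice e \<bullet> n > 0" "of_lattice e \<bullet> n' > 0"
      using n_nz d0 \<open>y \<ge> c\<close> t(1) by (auto simp: zero_le_mult_iff)
    have "\<not> (\<exists>k>0. n' = - k *\<^sub>R n)"
    proof clarify
      fix k :: real assume "k > 0" "n' = - k *\<^sub>R n"
      then have "of_lattice e \<bullet> n' = - (k * (of_lattice e \<bullet> n))" by simp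
      moreover have "k * (of_lattice e \<bullet> n) > 0" using \<open>k > 0\<close> e_pos(1) by simp
      ultimately show False using e_pos(2) by simp
    qed
    then have "\<sigma> = convex_cone hull {n, n'}" unfolding \<sigma> cone_of_normals_def by (rule if_not_P)
    also have "\<dots> \<subseteq> {z. of_lattice d \<bullet> z = 0}"
      using d0 by (intro hull_minimal convex_coneI) (auto simp: inner_add_right)
    finally have "interior \<sigma> \<subseteq> interior {z. of_lattice d \<bullet> z = 0}" by (rule interior_mono)
    also have "\<dots> = {}" using norm_d_pos by (intro interior_hyperplane) auto
    finally have "\<not> strongly_decomposable v \<sigma>" by (auto simp: strongly_decomposable_def)
    then show ?thesis using ge_c by blast
  next
    case False
    then obtain m m' where m: "m \<in> E" "m \<bullet> of_lattice (- v) > - c" and m': "m' \<in> E'" "m' \<bullet> of_lattice (- v) > - c"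
      using E E' unfolding edge_into_def if_not_P[OF False] by blast
    obtain xm ym where xm: "m = emb xm ym" by (rule emb_cases)
    obtain xm' ym' where xm': "m' = emb xm' ym'" by (rule emb_cases)
    have ym: "ym < c" "ym' < c" using m(2) m'(2) by (simp_all add: xm xm' of_lattice_uminus)
    define \<delta> \<delta>' where "\<delta> = of_lattice d \<bullet> n" and "\<delta>' = - (of_lattice d \<bullet> n')"
    have line: "(xm - x0) * \<delta> = (c - ym) * (of_lattice e \<bullet> n)"
      "(x1 - xm') * \<delta>' = (c - ym') * (of_lattice e \<bullet> n')"
      using n_eq[OF m(1)] n'_eq[OF m'(1)] by (simp_all add: xm xm' emb_inner \<delta>_def \<delta>'_def algebra_simps)
    have "(x1 - x0) * \<delta> \<ge> 0" "(x1 - x0) * \<delta>' \<ge> 0"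
      using n_ge(1)[OF p(2)] n_ge(2)[OF p(1)] by (simp_all add: emb_inner \<delta>_def \<delta>'_def algebra_simps)
    then have "\<delta> \<ge> 0" "\<delta>' \<ge> 0" using x01 by (simp_all add: zero_le_mult_iff)
    \<comment> \<open>A normal with \<open>\<delta> = 0\<close> would be orthogonal to
      \<open>e\<close> as well, since its edge really changes height, and so it would
      vanish.\<close>
    moreover have "\<delta> \<noteq> 0" using line(1) ym(1) n_nz(1) by (auto simp: \<delta>_def)
    moreover have "\<delta>' \<noteq> 0" using line(2) ym(2) n_nz(2) by (auto simp: \<delta>'_def)
    ultimately have \<delta>: "\<delta> > 0" "\<delta>' > 0" by simp_all
    \<comment> \<open>With this scaling the left edge runs through the points (x0 + A h, c - h) and
      the right one through (x1 - B h, c - h), and the normals have the form required by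
      \<open>interior_cone_of_normals\<close>.\<close>
    define A B where "A = (of_lattice e \<bullet> n) / \<delta>" and "B = (of_lattice e \<bullet> n') / \<delta>'"
    have AB_eq: "of_lattice e \<bullet> n = \<delta> * A" "of_lattice e \<bullet> n' = \<delta>' * B" using \<delta> by (simp_all add: A_def B_def)
    have flank: "x0 + A * (c - y) \<le> x" "x \<le> x1 - B * (c - y)" if "emb x y \<in> \<Delta>" for x y
    proof -
      have "\<delta> * (x0 + A * (c - y)) \<le> \<delta> * x" "\<delta>' * x \<le> \<delta>' * (x1 - B * (c - y))"
        using n_ge[OF that] AB_eq by (simp_all add: emb_inner \<delta>_def[symmetric] \<delta>'_def algebra_simps)
      then show "x0 + A * (c - y) \<le> x" "x \<le> x1 - B * (c - y)" using \<delta> by simp_all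
    qed
    have "\<delta> * (xm - x0) = \<delta> * (A * (c - ym))" "\<delta>' * (x1 - xm') = \<delta>' * (B * (c - ym'))"
      using line unfolding AB_eq by (simp_all add: mult_ac)
    then have "xm - x0 = A * (c - ym)" "x1 - xm' = B * (c - ym')" using \<delta> by simp_all
    then have xm_eq: "xm = x0 + A * (c - ym)" "xm' = x1 - B * (c - ym')" by simp_all
    \<comment> \<open>A depth that both edges reach; \<open>on_edge\<close> moves up along each of
      them to this common row.\<close>
    define \<epsilon> where "\<epsilon> = min (c - ym) (c - ym')"
    have \<epsilon>: "\<epsilon> > 0" "\<epsilon> \<le> c - ym" "\<epsilon> \<le> c - ym'" using ym by (simp_all add: \<epsilon>_def)
    have on_edge: "emb (x + K * \<epsilon>) (c - \<epsilon>) \<in> \<Delta>"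
      if "emb x c \<in> \<Delta>" "emb (x + K * h) (c - h) \<in> \<Delta>" "\<epsilon> \<le> h" for x K h
    proof -
      have h: "h > 0" using \<epsilon>(1) that(3) by simp
      have "(1 - \<epsilon> / h) *\<^sub>R emb x c + (\<epsilon> / h) *\<^sub>R emb (x + K * h) (c - h) \<in> \<Delta>"
        using that \<epsilon> h by (intro convexD[OF assms(1)]) auto
      moreover have "(1 - \<epsilon> / h) * x + \<epsilon> / h * (x + K * h) = x + K * \<epsilon>"
        "(1 - \<epsilon> / h) * c + \<epsilon> / h * (c - h) = c - \<epsilon>" using h by (simp_all add: field_simps)
      ultimately show ?thesis by (simp add: emb_combination)
    qed
    have "emb (x0 + A * \<epsilon>) (c - \<epsilon>) \<in> \<Delta>"
      using m(1) E\<Delta> p \<epsilon> by (intro on_edge[where h = "c - ym"]) (auto simp: xm simp flip: xm_eq)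
    moreover have "emb (x1 + - B * \<epsilon>) (c - \<epsilon>) \<in> \<Delta>"
      using m'(1) E\<Delta> p \<epsilon> xm_eq(2) by (intro on_edge[where h = "c - ym'"]) (auto simp: xm')
    ultimately have below: "(x0 + A * \<epsilon>, c - \<epsilon>) \<in> coords \<Delta>" "(x1 - B * \<epsilon>, c - \<epsilon>) \<in> coords \<Delta>"
      by (simp_all add: coords_def)
    have "(A + B) * \<epsilon> \<ge> 0" using widest[OF below] by (simp add: algebra_simps)
    then have "A + B \<ge> 0" using \<epsilon>(1) by (simp add: zero_le_mult_iff)
    then have "strongly_decomposable v \<sigma> \<longleftrightarrow> (\<exists>n\<ge>1::int. \<lfloor>A * n\<rfloor> + \<lfloor>B * n\<rfloor> < 0)"
      unfolding \<sigma> using \<delta> AB_eq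
      by (intro strongly_decomposable_iff_floors interior_cone_of_normals[of n \<delta> A n' \<delta>' B])
        (simp_all add: \<delta>_def \<delta>'_def)
    moreover have "flanked (coords \<Delta>) c x0 x1 A B"
      using p flank by (auto simp: flanked_def coords_def)
    ultimately show ?thesis using \<epsilon>(1) below by blast
  qed
qed

end

section \<open>The valuation semigroup\<close>

lemma closed_convex_polytope:
  "closed (polytope_of \<Sigma> a)" "convex (polytope_of \<Sigma> a)"
proof -
  have "polytope_of \<Sigma> a = (\<Inter>\<rho>\<in>rays \<Sigma>. {m. of_lattice \<rho> \<bullet> m \<ge> - real_of_int (a \<rho>)})"
    by (auto simp: polytope_of_def inner_commute)
  then show "closed (polytope_of \<Sigma> a)" "convex (polytope_of \<Sigma> a)"
    by (auto intro!: closed_INT convex_INT closed_halfspace_ge convex_halfspace_ge)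
qed

lemma polytope_scale:
  assumes "l > 0"
  shows "m \<in> polytope_of \<Sigma> (multiple l a) \<longleftrightarrow> (1 / real l) *\<^sub>R m \<in> polytope_of \<Sigma> a"
  using assms by (simp add: polytope_of_def multiple_def field_simps)

lemma finite_lattice_points:
  assumes "bounded P"
  shows "finite {m. of_lattice m \<in> P}"
proof -
  have "{m. of_lattice m \<in> P} = scaled_points P 1"
    by (auto simp: scaled_points_def of_lattice_def)
  then show ?thesis using finite_scaled_points[OF assms, of 1] by simp
qed

text \<open>This is how ampleness enters: a convex set without interior lies in a line, and
  \<open>ample_not_in_line\<close> excludes that.\<close>

lemma interior_polytope:
  assumes "smooth_complete_fan \<Sigma>" "ample \<Sigma> a"
  shows "interior (polytope_of \<Sigma> a) \<noteq> {}"
proof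
  assume "interior (polytope_of \<Sigma> a) = {}"
  then obtain n \<kappa> where "n \<noteq> 0" "polytope_of \<Sigma> a \<subseteq> {m. n \<bullet> m = \<kappa>}"
    using empty_interior_subset_hyperplane[OF closed_convex_polytope(2)] by metis
  then show False
    using ample_not_in_line[OF assms, of n \<kappa>] by (auto simp: inner_commute)
qed

context flag_frame
begin

text \<open>Based on the polytope of the multiple rather than on a rescaled one, so that level 0 is
  described correctly and the inequalities are homogeneous in the level.\<close>

definition lattice_rows :: "(real \<times> real) set set \<Rightarrow> (int \<times> int \<Rightarrow> int) \<Rightarrow> nat \<Rightarrow> (int \<times> int) set" where
  "lattice_rows \<Sigma> a l = {(i, j). of_lattice (pt i j) \<in> polytope_of \<Sigma> (multiple l a)}"

lemma valuation_semigroup_eq: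
  assumes "smooth_complete_fan \<Sigma>"
  shows "valuation_semigroup \<Sigma> a v = {(l, k, b). b < card (wide_rows_of (lattice_rows \<Sigma> a l) k)}"
proof -
  have "flag_val v ` {s. s \<in> sections \<Sigma> (multiple l a) \<and> s \<noteq> 0}
      = {(k, b). b < card (wide_rows_of (lattice_rows \<Sigma> a l) k)}" for l
  proof -
    let ?A = "{m. of_lattice m \<in> polytope_of \<Sigma> (multiple l a)}"
    have "flag_val v ` {s. Poly_Mapping.keys s \<subseteq> ?A \<and> s \<noteq> 0} = {(k, b). b < card (wide_rows ?A k)}"
    proof (rule flag_vals_of_support)
      show "finite ?A" by (intro finite_lattice_points bounded_polytope assms)
      fix i h i' j assume ih: "pt i j \<in> ?A" "pt i' j \<in> ?A" "i \<le> h" "h \<le> i'"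
      then have "(real_of_int i, real_of_int j) \<in> coords (polytope_of \<Sigma> (multiple l a))"
        "(real_of_int i', real_of_int j) \<in> coords (polytope_of \<Sigma> (multiple l a))"
        by (simp_all add: coords_def emb_pt)
      from convex_row[OF convex_coords[OF closed_convex_polytope(2)] this, of "of_int h"]
      have "(real_of_int h, real_of_int j) \<in> coords (polytope_of \<Sigma> (multiple l a))"
        using ih(3,4) by simp
      then show "pt h j \<in> ?A" by (simp add: coords_def emb_pt)
    qed
    moreover have "wide_rows ?A k = wide_rows_of (lattice_rows \<Sigma> a l) k" for k
      by (simp add: wide_rows_def wide_rows_of_def lattice_rows_def)
    ultimately show ?thesis by (simp add: sections_eq[OF assms])
  qed
  then have iff: "(k, b) \<in> flag_val v ` {s. s \<in> sections \<Sigma> (multiple l a) \<and> s \<noteq> 0}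
      \<longleftrightarrow> b < card (wide_rows_of (lattice_rows \<Sigma> a l) k)" for l k b by simp
  have "(l, k, b) \<in> valuation_semigroup \<Sigma> a v \<longleftrightarrow>
      (k, b) \<in> flag_val v ` {s. s \<in> sections \<Sigma> (multiple l a) \<and> s \<noteq> 0}" for l k b
    unfolding valuation_semigroup_def by blast
  then show ?thesis unfolding iff by auto
qed

lemma lattice_rows_scaled:
  assumes "l > 0"
  shows "lattice_rows \<Sigma> a l = scaled_points (coords (polytope_of \<Sigma> a)) l"
proof -
  have "(1 / real l) *\<^sub>R of_lattice (pt i j) = emb (of_int i / l) (of_int j / l)" for i j
    unfolding emb_pt[symmetric] by (simp add: emb_def scaleR_add_right)
  then show ?thesis
    by (simp add: lattice_rows_def scaled_points_def coords_def polytope_scale[OF assms])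
qed

lemma lattice_rows_0:
  assumes "smooth_complete_fan \<Sigma>"
  shows "lattice_rows \<Sigma> a 0 \<subseteq> {0}"
proof clarify
  fix i j assume "(i, j) \<in> lattice_rows \<Sigma> a 0"
  then have "of_lattice (pt i j) = 0" using polytope_zero[OF assms] by (auto simp: lattice_rows_def)
  then have "pt i j = pt 0 0" by (metis of_lattice_eq_iff of_lattice_zero pt_0_0)
  then show "(i, j) = 0" by (simp add: zero_prod_def)
qed

lemma lattice_rows_inequalities:
  "lattice_rows \<Sigma> a l = {(x, y). \<forall>(\<alpha>, \<beta>, \<gamma>)\<in>(\<lambda>\<rho>. (pairing d \<rho>, pairing e \<rho>, a \<rho>)) ` rays \<Sigma>.
     \<alpha> * x + \<beta> * y + int l * \<gamma> \<ge> 0}"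
proof -
  have "pairing (pt i j) \<rho> = pairing d \<rho> * i + pairing e \<rho> * j" for i j \<rho>
    by (simp add: pairing_def pt_def algebra_simps)
  then have "- real_of_int (int l * a \<rho>) \<le> of_lattice (pt i j) \<bullet> of_lattice \<rho> \<longleftrightarrow>
      0 \<le> pairing d \<rho> * i + pairing e \<rho> * j + int l * a \<rho>" for i j \<rho>
    unfolding inner_of_lattice of_int_minus[symmetric] of_int_le_iff by simp linarith
  then show ?thesis by (simp add: lattice_rows_def polytope_of_def multiple_def)
qed

end

lemma flag_frame_exists:
  assumes "primitive v"
  obtains e where "flag_frame v e"
proof -
  obtain x y where "x * fst v + y * snd v = 1"
    using assms bezout_int[of "fst v" "snd v"] by (auto simp: primitive_def coprime_iff_gcd_eq_1)
  then have "flag_frame v (x, y)" by (simp add: flag_frame_def pairing_def)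
  then show thesis by (rule that)
qed

theorem theorem6p8:
  fixes \<Sigma> :: "(real \<times> real) set set"
    and a :: "int \<times> int \<Rightarrow> int"
    and v :: "int \<times> int"
    and c :: real
    and p q :: "real \<times> real"
    and \<sigma>plus \<sigma>minus :: "(real \<times> real) set"
  assumes "smooth_complete_fan \<Sigma>"
    and "ample \<Sigma> a"
    and "primitive v"
    and "longest_segment (polytope_of \<Sigma> a) v c p q"
    and "flag_cone (polytope_of \<Sigma> a) v c p q \<sigma>plus"
    and "flag_cone (polytope_of \<Sigma> a) (- v) (- c) p q \<sigma>minus"
  shows "finitely_generated (valuation_semigroup \<Sigma> a v) \<longleftrightarrow>
    \<not> strongly_decomposable v \<sigma>plus \<and> \<not> strongly_decomposable (- v) \<sigma>minus"
proof -
  obtain e where "flag_frame v e" using assms(3) by (rule flag_frame_exists)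
  then interpret flag_frame v e .
  \<comment> \<open>The flag for \<open>- v\<close> exchanges the two sides of the longest row, so
    everything about \<open>\<sigma>minus\<close> comes from the statements about
    \<open>\<sigma>plus\<close>, applied to the reflected polygon.\<close>
  interpret N: flag_frame "- v" "- e"
    using pairing_e_v by unfold_locales (simp add: pairing_def)
  let ?\<Delta> = "polytope_of \<Sigma> a"
  define Q where "Q = coords ?\<Delta>"
  have compact: "compact ?\<Delta>"
    using closed_convex_polytope(1) bounded_polytope[OF assms(1)] by (simp add: compact_eq_bounded_closed)
  have interior: "interior ?\<Delta> \<noteq> {}" using assms(1,2) by (rule interior_polytope)
  have Q: "convex Q" "compact Q"
    unfolding Q_def by (intro convex_coords closed_convex_polytope compact_coords compact)+
  have N_emb: "N.emb x y = emb (- x) (- y)" for x y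
    by (simp add: N.emb_def emb_def N.d_def d_def of_lattice_def)
  have N_coords: "N.coords ?\<Delta> = uminus ` Q"
  proof -
    have "z \<in> N.coords ?\<Delta> \<longleftrightarrow> - z \<in> Q" for z
      by (simp add: N.coords_iff coords_iff Q_def N_emb)
    moreover have "z \<in> uminus ` Q \<longleftrightarrow> - z \<in> Q" for z :: "real \<times> real"
      by (metis image_iff minus_minus)
    ultimately show ?thesis by blast
  qed
  obtain x0 x1 where x01: "x0 < x1" "{p, q} = {emb x0 c, emb x1 c}"
    and widest: "\<And>x x' y. (x, y) \<in> Q \<Longrightarrow> (x', y) \<in> Q \<Longrightarrow> x' - x \<le> x1 - x0"
    using longest_segment_endpoints[OF closed_convex_polytope(2) compact interior assms(4)] unfolding Q_def by blast
  have "p \<in> ?\<Delta>" "q \<in> ?\<Delta>" using assms(4) by (auto simp: longest_segment_def level_set_def)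
  then have ends: "emb x0 c \<in> ?\<Delta>" "emb x1 c \<in> ?\<Delta>" using x01(2) by (metis doubleton_eq_iff)+
  have cone: "flag_cone ?\<Delta> v c (emb x0 c) (emb x1 c) \<sigma>plus"
    using assms(5) x01(2) flag_cone_swap by (metis doubleton_eq_iff)
  have plus: "(\<forall>(x, y)\<in>Q. c \<le> y) \<and> \<not> strongly_decomposable v \<sigma>plus \<or>
    (\<exists>A B \<epsilon>. \<epsilon> > 0 \<and> flanked Q c x0 x1 A B \<and> (x0 + A * \<epsilon>, c - \<epsilon>) \<in> Q \<and> (x1 - B * \<epsilon>, c - \<epsilon>) \<in> Q \<and>
      (strongly_decomposable v \<sigma>plus \<longleftrightarrow> (\<exists>n\<ge>1::int. \<lfloor>A * n\<rfloor> + \<lfloor>B * n\<rfloor> < 0)))"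
    unfolding Q_def
    by (rule flag_cone_data[OF closed_convex_polytope(2) interior x01(1) _ ends cone])
      (erule (1) widest[unfolded Q_def])
  have N_widest: "x' - x \<le> (- x0) - (- x1)" if "(x, y) \<in> uminus ` Q" "(x', y) \<in> uminus ` Q" for x x' y
    using that widest[of "- x'" "- y" "- x"] by (auto simp: image_iff)
  have N_ends: "N.emb (- x1) (- c) \<in> ?\<Delta>" "N.emb (- x0) (- c) \<in> ?\<Delta>"
    using ends by (simp_all add: N_emb)
  have N_cone: "flag_cone ?\<Delta> (- v) (- c) (N.emb (- x1) (- c)) (N.emb (- x0) (- c)) \<sigma>minus"
    using assms(6) x01(2) flag_cone_swap unfolding N_emb minus_minus by (metis doubleton_eq_iff)
  have N_x01: "- x1 < - x0" using x01(1) by simp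
  have minus: "(\<forall>(x, y)\<in>uminus ` Q. - c \<le> y) \<and> \<not> strongly_decomposable (- v) \<sigma>minus \<or>
    (\<exists>A B \<epsilon>. \<epsilon> > 0 \<and> flanked (uminus ` Q) (- c) (- x1) (- x0) A B \<and>
      (- x1 + A * \<epsilon>, - c - \<epsilon>) \<in> uminus ` Q \<and> (- x0 - B * \<epsilon>, - c - \<epsilon>) \<in> uminus ` Q \<and>
      (strongly_decomposable (- v) \<sigma>minus \<longleftrightarrow> (\<exists>n\<ge>1::int. \<lfloor>A * n\<rfloor> + \<lfloor>B * n\<rfloor> < 0)))"
    unfolding N_coords[symmetric]
    by (rule N.flag_cone_data[OF closed_convex_polytope(2) interior N_x01 _ N_ends N_cone])
      (erule (1) N_widest[folded N_coords])
  have N_Q: "convex (uminus ` Q)" "compact (uminus ` Q)"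
    using Q by (simp_all add: convex_negations compact_negations)
  define S where "S = {(l, k, b). b < card (wide_rows_of (lattice_rows \<Sigma> a l) k)}"
  have S: "valuation_semigroup \<Sigma> a v = S"
    unfolding S_def by (rule valuation_semigroup_eq[OF assms(1)])
  have S_pos: "(l, k, b) \<in> S \<longleftrightarrow> b < card (wide_rows_of (scaled_points Q l) k)" if "l > 0" for l k b
    by (simp add: S_def lattice_rows_scaled[OF that] Q_def)
  have N_S_pos: "(l, k, b) \<in> S \<longleftrightarrow> b < card (wide_rows_of (scaled_points (uminus ` Q) l) k)" if "l > 0" for l k b
    by (simp add: S_pos[OF that] wide_rows_of_uminus card_image)
  have zero: "i = 0 \<and> j = 0" if "(i, j) \<in> lattice_rows \<Sigma> a 0" for i j
    using lattice_rows_0[OF assms(1), of a] that by (auto simp: zero_prod_def)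
  \<comment> \<open>Level 0 has only constant sections, so only the row 0 occurs, and only for
    \<open>k = 0\<close>.\<close>
  have rows_0: "wide_rows_of (lattice_rows \<Sigma> a 0) k \<subseteq> {0}" "k > 0 \<Longrightarrow> wide_rows_of (lattice_rows \<Sigma> a 0) k = {}" for k
    by (auto simp: wide_rows_of_def dest!: zero)
  have S_0: "k = 0 \<and> b = 0" if "(0, k, b) \<in> S" for k b
  proof -
    have b: "b < card (wide_rows_of (lattice_rows \<Sigma> a 0) k)" using that by (simp add: S_def)
    then have "k = 0" using rows_0(2)[of k] by (cases "k = 0") auto
    moreover have "card (wide_rows_of (lattice_rows \<Sigma> a 0) k) \<le> card {0::int}"
      using rows_0(1) by (intro card_mono) auto
    ultimately show ?thesis using b by simp
  qed
  have "\<not> finitely_generated S" if "strongly_decomposable v \<sigma>plus"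
  proof -
    obtain A B \<epsilon> and n :: int where *: "\<epsilon> > 0" "flanked Q c x0 x1 A B" "(x0 + A * \<epsilon>, c - \<epsilon>) \<in> Q"
      "(x1 - B * \<epsilon>, c - \<epsilon>) \<in> Q" "n \<ge> 1" "\<lfloor>A * n\<rfloor> + \<lfloor>B * n\<rfloor> < 0"
      using plus \<open>strongly_decomposable v \<sigma>plus\<close> by blast
    show ?thesis
      by (rule not_finitely_generated_if_floors_neg[OF Q *(2) _ x01(1) *(1,3,4,5,6)])
        (erule (1) widest, erule S_0, erule S_pos)
  qed
  moreover have "\<not> finitely_generated S" if "strongly_decomposable (- v) \<sigma>minus"
  proof -
    obtain A B \<epsilon> and n :: int where *: "\<epsilon> > 0" "flanked (uminus ` Q) (- c) (- x1) (- x0) A B"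
      "(- x1 + A * \<epsilon>, - c - \<epsilon>) \<in> uminus ` Q" "(- x0 - B * \<epsilon>, - c - \<epsilon>) \<in> uminus ` Q"
      "n \<ge> 1" "\<lfloor>A * n\<rfloor> + \<lfloor>B * n\<rfloor> < 0"
      using minus \<open>strongly_decomposable (- v) \<sigma>minus\<close> by blast
    show ?thesis
      by (rule not_finitely_generated_if_floors_neg[OF N_Q *(2) _ N_x01 *(1,3,4,5,6)])
        (erule (1) N_widest, erule S_0, erule N_S_pos)
  qed
  moreover have "finitely_generated S"
    if indec: "\<not> strongly_decomposable v \<sigma>plus" "\<not> strongly_decomposable (- v) \<sigma>minus"
  proof -
    \<comment> \<open>Formulated for an arbitrary polygon so that it applies to both sides. If no
      row lies below \<open>h\<close>, then \<open>j1\<close> is already the row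
      \<open>j\<close>.\<close>
    have upwards: "j \<in> wide_rows_of (scaled_points R l) k"
      if alt: "(\<forall>(x, y)\<in>R. h \<le> y) \<or> (\<exists>A B. flanked R h z0 z1 A B \<and> (\<forall>n\<ge>1::int. \<lfloor>A * n\<rfloor> + \<lfloor>B * n\<rfloor> \<ge> 0))"
        and "convex R" "l > 0" and j1: "j1 \<in> wide_rows_of (scaled_points R l) k" "j1 \<le> j" "of_int j \<le> l * h"
      for R h z0 z1 l k j1 j
      using alt
    proof
      assume h: "\<forall>(x, y)\<in>R. h \<le> y"
      have "h \<le> of_int j1 / l" using j1(1) h by (auto simp: wide_rows_of_def scaled_points_def)
      then have "l * h \<le> of_int j1" using \<open>l > 0\<close> by (simp add: field_simps)
      then have "j1 = j" using j1(2,3) by linarith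
      then show ?thesis using j1(1) by simp
    next
      assume "\<exists>A B. flanked R h z0 z1 A B \<and> (\<forall>n\<ge>1::int. \<lfloor>A * n\<rfloor> + \<lfloor>B * n\<rfloor> \<ge> 0)"
      then show ?thesis using wide_rows_extend_up[OF \<open>convex R\<close> _ _ \<open>l > 0\<close> j1] by blast
    qed
    have plus': "(\<forall>(x, y)\<in>Q. c \<le> y) \<or> (\<exists>A B. flanked Q c x0 x1 A B \<and> (\<forall>n\<ge>1::int. \<lfloor>A * n\<rfloor> + \<lfloor>B * n\<rfloor> \<ge> 0))"
      using plus indec(1) by (meson not_less)
    have minus': "(\<forall>(x, y)\<in>uminus ` Q. - c \<le> y) \<or>
        (\<exists>A B. flanked (uminus ` Q) (- c) (- x1) (- x0) A B \<and> (\<forall>n\<ge>1::int. \<lfloor>A * n\<rfloor> + \<lfloor>B * n\<rfloor> \<ge> 0))"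
      using minus indec(2) by (meson not_less)
    have no_gaps: "j \<in> wide_rows_of (lattice_rows \<Sigma> a l) k"
      if j: "j1 \<in> wide_rows_of (lattice_rows \<Sigma> a l) k" "j2 \<in> wide_rows_of (lattice_rows \<Sigma> a l) k" "j1 \<le> j" "j \<le> j2"
      for l k j1 j2 j
    proof (cases "l = 0")
      case True
      then have "j1 = 0" "j2 = 0" using j(1,2) rows_0(1) by auto
      then show ?thesis using j by simp
    next
      case False
      then have l: "l > 0" by simp
      note rows = lattice_rows_scaled[OF l, of \<Sigma> a, folded Q_def]
      show ?thesis
      \<comment> \<open>A row up to the longest one inherits a run from \<open>j1\<close> below it;
        a row beyond it inherits one from \<open>j2\<close>, by reflection.\<close>
      proof (cases "of_int j \<le> l * c")
        case True
        then show ?thesis using upwards[OF plus' Q(1) l] j unfolding rows by blast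
      next
        case False
        have "- j2 \<in> wide_rows_of (scaled_points (uminus ` Q) l) k"
          using j(2) unfolding wide_rows_of_uminus rows by simp
        moreover have "- j2 \<le> - j" "of_int (- j) \<le> l * - c" using j(4) False by simp_all
        ultimately have "- j \<in> wide_rows_of (scaled_points (uminus ` Q) l) k"
          using upwards[OF minus' N_Q(1) l] by blast
        then show ?thesis unfolding wide_rows_of_uminus rows by auto
      qed
    qed
    have finite_rows: "finite (lattice_rows \<Sigma> a l)" for l
    proof (cases "l = 0")
      case True
      then show ?thesis using lattice_rows_0[OF assms(1), of a] finite_subset by fastforce
    next
      case False
      then show ?thesis
        using lattice_rows_scaled[of l \<Sigma> a] finite_scaled_points[OF compact_imp_bounded[OF Q(2)], of l]
        by (simp add: Q_def)
    qed
    show ?thesis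
      unfolding S_def
      by (rule finitely_generated_if_no_gaps[of "(\<lambda>\<rho>. (pairing d \<rho>, pairing e \<rho>, a \<rho>)) ` rays \<Sigma>",
            folded lattice_rows_inequalities])
        (rule finite_imageI[OF finite_rays[OF assms(1)]], rule lattice_rows_0[OF assms(1)],
          rule finite_rows, rule no_gaps)
  qed
  ultimately show ?thesis unfolding S by blast
qed

end
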